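(* The system $\mathsf{ACA}_0^{\omega}+\neg\mathsf{NIN}_{[0,1]}$ cannot prove $\mathsf{ATR}_0$.
   Context: $\mathsf{NIN}_{[0,1]}$ is the statement that there is no injection from $[0,1]$ to $\mathbb{N}$, i.e. no function $Y:[0,1]\to\mathbb{N}$ (respecting equality of reals) such that $Y(x)=Y(y)\to x=_{\mathbb{R}}y$ for all $x,y\in[0,1]$. $\mathsf{ATR}_0$ is the usual system of arithmetical transfinite recursion in second-order arithmetic. $\mathsf{RCA}_0^{\omega}$ is Kohlenbach's base theory of higher-order Reverse Mathematics: classical logic in the language of all finite types, primitive recursive arithmetic in all finite types (combinators, recursor for type $0$, quantifier-free induction, axiom of extensionality) plus $\mathsf{QF\text{-}AC}^{1,0}$, i.e. for quantifier-free $\varphi$: $(\forall f\in\mathbb{N}^{\mathbb{N}})(\exists n\in\mathbb{N})\varphi(f,n)\to(\exists\Phi:\mathbb{N}^{\mathbb{N}}\to\mathbb{N})(\forall f)\varphi(f,\Phi(f))$. $\mathsf{ACA}_0^{\omega}$ is $\mathsf{RCA}_0^{\omega}+(\exists^2)$, where $(\exists^2)$ is: $(\exists E:\mathbb{N}^{\mathbb{N}}\to\{0,1\})(\forall f\in\mathbb{N}^{\mathbb{N}})\big(E(f)=0\leftrightarrow(\exists n\in\mathbb{N})(f(n)=0)\big)$. Reals are fast-converging Cauchy sequences of rationals; functions on $\mathbb{R}$ are functionals on Baire space respecting $=_{\mathbb{R}}$. *)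

theory Defs
  imports Main
begin

section \<open>The language of all finite types\<close>

datatype ftype = Base | Arr ftype ftype (infixr "\<Rrightarrow>" 65)

abbreviation type1 :: ftype where "type1 \<equiv> Base \<Rrightarrow> Base"
abbreviation type2 :: ftype where "type2 \<equiv> type1 \<Rrightarrow> Base"

text \<open>Variables are named and carry their type, so \<open>(0, \<sigma>)\<close> and \<open>(0, \<tau>)\<close> are different
  variables when \<open>\<sigma> \<noteq> \<tau>\<close>.\<close>

type_synonym var = "nat \<times> ftype"

datatype trm =
    Var var
  | Zero
  | Succ
  | CombK ftype ftype
  | CombS ftype ftype ftype
  | Rec0
  | App trm trm (infixl "\<cdot>" 90)

text \<open>On ill-typed terms \<open>typ_of\<close> returns junk; it is meaningful only together with \<open>wt\<close>.\<close>

fun cod :: "ftype \<Rightarrow> ftype" where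
  "cod (\<sigma> \<Rrightarrow> \<tau>) = \<tau>"
| "cod Base = Base"

fun typ_of :: "trm \<Rightarrow> ftype" where
  "typ_of (Var x) = snd x"
| "typ_of Zero = Base"
| "typ_of Succ = Base \<Rrightarrow> Base"
| "typ_of (CombK \<sigma> \<tau>) = \<sigma> \<Rrightarrow> \<tau> \<Rrightarrow> \<sigma>"
| "typ_of (CombS \<rho> \<sigma> \<tau>) = (\<rho> \<Rrightarrow> \<sigma> \<Rrightarrow> \<tau>) \<Rrightarrow> (\<rho> \<Rrightarrow> \<sigma>) \<Rrightarrow> \<rho> \<Rrightarrow> \<tau>"
| "typ_of Rec0 = Base \<Rrightarrow> (Base \<Rrightarrow> Base \<Rrightarrow> Base) \<Rrightarrow> Base \<Rrightarrow> Base"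
| "typ_of (s \<cdot> t) = cod (typ_of s)"

fun wt :: "trm \<Rightarrow> bool" where
  "wt (s \<cdot> t) \<longleftrightarrow> wt s \<and> wt t \<and> (\<exists>\<tau>. typ_of s = typ_of t \<Rrightarrow> \<tau>)"
| "wt _ \<longleftrightarrow> True"

fun fv_trm :: "trm \<Rightarrow> var set" where
  "fv_trm (Var x) = {x}"
| "fv_trm (s \<cdot> t) = fv_trm s \<union> fv_trm t"
| "fv_trm _ = {}"

fun subst_trm :: "var \<Rightarrow> trm \<Rightarrow> trm \<Rightarrow> trm" where
  "subst_trm x r (Var y) = (if y = x then r else Var y)"
| "subst_trm x r (s \<cdot> t) = subst_trm x r s \<cdot> subst_trm x r t"
| "subst_trm x r t = t"

text \<open>The only prime formulas are equations between terms of type \<open>0\<close> (and falsum);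
  equality at higher types is the abbreviation \<open>eq_at\<close> below.\<close>

datatype fm = Eq trm trm | Falsum | Imp fm fm | Forall var fm

abbreviation Neg :: "fm \<Rightarrow> fm" where "Neg \<phi> \<equiv> Imp \<phi> Falsum"
abbreviation Disj :: "fm \<Rightarrow> fm \<Rightarrow> fm" where "Disj \<phi> \<psi> \<equiv> Imp (Neg \<phi>) \<psi>"
abbreviation Conj :: "fm \<Rightarrow> fm \<Rightarrow> fm" where "Conj \<phi> \<psi> \<equiv> Neg (Imp \<phi> (Neg \<psi>))"
abbreviation Iff :: "fm \<Rightarrow> fm \<Rightarrow> fm" where "Iff \<phi> \<psi> \<equiv> Conj (Imp \<phi> \<psi>) (Imp \<psi> \<phi>)"
abbreviation Exists :: "var \<Rightarrow> fm \<Rightarrow> fm" where "Exists x \<phi> \<equiv> Neg (Forall x (Neg \<phi>))"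

fun wff :: "fm \<Rightarrow> bool" where
  "wff (Eq s t) \<longleftrightarrow> wt s \<and> wt t \<and> typ_of s = Base \<and> typ_of t = Base"
| "wff Falsum \<longleftrightarrow> True"
| "wff (Imp \<phi> \<psi>) \<longleftrightarrow> wff \<phi> \<and> wff \<psi>"
| "wff (Forall x \<phi>) \<longleftrightarrow> wff \<phi>"

fun fv :: "fm \<Rightarrow> var set" where
  "fv (Eq s t) = fv_trm s \<union> fv_trm t"
| "fv Falsum = {}"
| "fv (Imp \<phi> \<psi>) = fv \<phi> \<union> fv \<psi>"
| "fv (Forall x \<phi>) = fv \<phi> - {x}"

fun qf :: "fm \<Rightarrow> bool" where
  "qf (Imp \<phi> \<psi>) \<longleftrightarrow> qf \<phi> \<and> qf \<psi>"
| "qf (Forall x \<phi>) \<longleftrightarrow> False"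
| "qf _ \<longleftrightarrow> True"

text \<open>Substitution does not rename bound variables; \<open>free_for\<close> is the usual side condition
  excluding capture.\<close>

fun subst :: "var \<Rightarrow> trm \<Rightarrow> fm \<Rightarrow> fm" where
  "subst x r (Eq s t) = Eq (subst_trm x r s) (subst_trm x r t)"
| "subst x r Falsum = Falsum"
| "subst x r (Imp \<phi> \<psi>) = Imp (subst x r \<phi>) (subst x r \<psi>)"
| "subst x r (Forall y \<phi>) = (if y = x then Forall y \<phi> else Forall y (subst x r \<phi>))"

fun free_for :: "trm \<Rightarrow> var \<Rightarrow> fm \<Rightarrow> bool" where
  "free_for r x (Imp \<phi> \<psi>) \<longleftrightarrow> free_for r x \<phi> \<and> free_for r x \<psi>"
| "free_for r x (Forall y \<phi>) \<longleftrightarrow>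
     x \<notin> fv (Forall y \<phi>) \<or> (y \<notin> fv_trm r \<and> free_for r x \<phi>)"
| "free_for r x _ \<longleftrightarrow> True"

fun fresh_index :: "trm \<Rightarrow> nat" where
  "fresh_index (Var x) = Suc (fst x)"
| "fresh_index (s \<cdot> t) = max (fresh_index s) (fresh_index t)"
| "fresh_index _ = 0"

fun eq_at :: "ftype \<Rightarrow> trm \<Rightarrow> trm \<Rightarrow> fm" where
  "eq_at Base s t = Eq s t"
| "eq_at (\<sigma> \<Rrightarrow> \<tau>) s t =
     (let x = (max (fresh_index s) (fresh_index t), \<sigma>)
      in Forall x (eq_at \<tau> (s \<cdot> Var x) (t \<cdot> Var x)))"

section \<open>Classical many-sorted predicate logic\<close>

text \<open>A Hilbert calculus. Since generalisation is unrestricted, a nonlogical axiom with free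
  variables has the force of its universal closure.\<close>

inductive provable :: "fm set \<Rightarrow> fm \<Rightarrow> bool" (infix "\<turnstile>" 50) for T :: "fm set" where
  axm: "\<phi> \<in> T \<Longrightarrow> T \<turnstile> \<phi>"
| imp_K: "wff \<phi> \<Longrightarrow> wff \<psi> \<Longrightarrow> T \<turnstile> Imp \<phi> (Imp \<psi> \<phi>)"
| imp_S: "wff \<phi> \<Longrightarrow> wff \<psi> \<Longrightarrow> wff \<chi> \<Longrightarrow>
    T \<turnstile> Imp (Imp \<phi> (Imp \<psi> \<chi>)) (Imp (Imp \<phi> \<psi>) (Imp \<phi> \<chi>))"
| dneg: "wff \<phi> \<Longrightarrow> T \<turnstile> Imp (Neg (Neg \<phi>)) \<phi>"
| all_inst: "wff \<phi> \<Longrightarrow> wt t \<Longrightarrow> typ_of t = snd x \<Longrightarrow> free_for t x \<phi> \<Longrightarrow>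
    T \<turnstile> Imp (Forall x \<phi>) (subst x t \<phi>)"
| all_distrib: "wff \<phi> \<Longrightarrow> wff \<psi> \<Longrightarrow> x \<notin> fv \<phi> \<Longrightarrow>
    T \<turnstile> Imp (Forall x (Imp \<phi> \<psi>)) (Imp \<phi> (Forall x \<psi>))"
| mp: "T \<turnstile> Imp \<phi> \<psi> \<Longrightarrow> T \<turnstile> \<phi> \<Longrightarrow> T \<turnstile> \<psi>"
| gen: "T \<turnstile> \<phi> \<Longrightarrow> T \<turnstile> Forall x \<phi>"

section \<open>The systems \<open>RCA\<^sub>0\<^sup>\<omega>\<close> and \<open>ACA\<^sub>0\<^sup>\<omega>\<close>\<close>

text \<open>The Leibniz rule for equality at all types follows from \<open>ext\<close> and the combinators. The other
  primitive recursive functions, in particular addition and multiplication, are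
  definable from the recursor.\<close>

inductive_set RCA0w :: "fm set" where
  refl: "Eq (Var (0, Base)) (Var (0, Base)) \<in> RCA0w"
| sym: "Imp (Eq (Var (0, Base)) (Var (1, Base))) (Eq (Var (1, Base)) (Var (0, Base))) \<in> RCA0w"
| trans: "Imp (Eq (Var (0, Base)) (Var (1, Base)))
      (Imp (Eq (Var (1, Base)) (Var (2, Base))) (Eq (Var (0, Base)) (Var (2, Base)))) \<in> RCA0w"
| ext: "Imp (eq_at \<rho> (Var (0, \<rho>)) (Var (1, \<rho>)))
      (eq_at \<tau> (Var (2, \<rho> \<Rrightarrow> \<tau>) \<cdot> Var (0, \<rho>)) (Var (2, \<rho> \<Rrightarrow> \<tau>) \<cdot> Var (1, \<rho>))) \<in> RCA0w"
| succ_nonzero: "Neg (Eq (Succ \<cdot> Var (0, Base)) Zero) \<in> RCA0w"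
| succ_inj: "Imp (Eq (Succ \<cdot> Var (0, Base)) (Succ \<cdot> Var (1, Base)))
      (Eq (Var (0, Base)) (Var (1, Base))) \<in> RCA0w"
| comb_K: "eq_at \<sigma> (CombK \<sigma> \<tau> \<cdot> Var (0, \<sigma>) \<cdot> Var (1, \<tau>)) (Var (0, \<sigma>)) \<in> RCA0w"
| comb_S: "eq_at \<tau>
      (CombS \<rho> \<sigma> \<tau> \<cdot> Var (0, \<rho> \<Rrightarrow> \<sigma> \<Rrightarrow> \<tau>) \<cdot> Var (1, \<rho> \<Rrightarrow> \<sigma>) \<cdot> Var (2, \<rho>))
      (Var (0, \<rho> \<Rrightarrow> \<sigma> \<Rrightarrow> \<tau>) \<cdot> Var (2, \<rho>) \<cdot> (Var (1, \<rho> \<Rrightarrow> \<sigma>) \<cdot> Var (2, \<rho>))) \<in> RCA0w"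
| rec_zero: "Eq (Rec0 \<cdot> Var (0, Base) \<cdot> Var (1, Base \<Rrightarrow> Base \<Rrightarrow> Base) \<cdot> Zero)
      (Var (0, Base)) \<in> RCA0w"
| rec_succ: "Eq
      (Rec0 \<cdot> Var (0, Base) \<cdot> Var (1, Base \<Rrightarrow> Base \<Rrightarrow> Base) \<cdot> (Succ \<cdot> Var (2, Base)))
      (Var (1, Base \<Rrightarrow> Base \<Rrightarrow> Base)
         \<cdot> (Rec0 \<cdot> Var (0, Base) \<cdot> Var (1, Base \<Rrightarrow> Base \<Rrightarrow> Base) \<cdot> Var (2, Base))
         \<cdot> Var (2, Base)) \<in> RCA0w"
| qf_induction: "qf \<phi> \<Longrightarrow> wff \<phi> \<Longrightarrow> snd x = Base \<Longrightarrow>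
    Imp (subst x Zero \<phi>) (Imp (Forall x (Imp \<phi> (subst x (Succ \<cdot> Var x) \<phi>))) (Forall x \<phi>))
      \<in> RCA0w"
| qf_choice: "qf \<phi> \<Longrightarrow> wff \<phi> \<Longrightarrow> snd f = type1 \<Longrightarrow> snd n = Base \<Longrightarrow> snd F = type2 \<Longrightarrow> F \<notin> fv \<phi> \<Longrightarrow>
    Imp (Forall f (Exists n \<phi>)) (Exists F (Forall f (subst n (Var F \<cdot> Var f) \<phi>))) \<in> RCA0w"

abbreviation One :: trm where "One \<equiv> Succ \<cdot> Zero"

definition exists2 :: fm where
  "exists2 =
    (let E = (0, type2); f = (0, type1); n = (0, Base)
     in Exists E (Forall f (Conj
          (Disj (Eq (Var E \<cdot> Var f) Zero) (Eq (Var E \<cdot> Var f) One))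
          (Iff (Eq (Var E \<cdot> Var f) Zero) (Exists n (Eq (Var f \<cdot> Var n) Zero))))))"

definition ACA0w :: "fm set" where
  "ACA0w = insert exists2 RCA0w"

section \<open>Some primitive recursive functions as closed terms\<close>

text \<open>Bracket abstraction: \<open>lam x t\<close> is the combinator term for \<open>\<lambda>x. t\<close>.\<close>

fun lam :: "var \<Rightarrow> trm \<Rightarrow> trm" where
  "lam x (s \<cdot> t) =
     (if x \<notin> fv_trm (s \<cdot> t) then CombK (typ_of (s \<cdot> t)) (snd x) \<cdot> (s \<cdot> t)
      else CombS (snd x) (typ_of t) (typ_of (s \<cdot> t)) \<cdot> lam x s \<cdot> lam x t)"
| "lam x t =
     (if t = Var x
      then CombS (snd x) (snd x \<Rrightarrow> snd x) (snd x)
             \<cdot> CombK (snd x) (snd x \<Rrightarrow> snd x) \<cdot> CombK (snd x) (snd x)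
      else CombK (typ_of t) (snd x) \<cdot> t)"

definition plusC :: trm where
  "plusC = (let x = (0, Base); y = (1, Base); u = (2, Base); v = (3, Base)
    in lam x (lam y (Rec0 \<cdot> Var x \<cdot> lam u (lam v (Succ \<cdot> Var u)) \<cdot> Var y)))"

definition timesC :: trm where
  "timesC = (let x = (0, Base); y = (1, Base); u = (2, Base); v = (3, Base)
    in lam x (lam y (Rec0 \<cdot> Zero \<cdot> lam u (lam v (plusC \<cdot> Var u \<cdot> Var x)) \<cdot> Var y)))"

definition predC :: trm where
  "predC = (let y = (1, Base); u = (2, Base); v = (3, Base)
    in lam y (Rec0 \<cdot> Zero \<cdot> lam u (lam v (Var v)) \<cdot> Var y))"

text \<open>Truncated subtraction.\<close>

definition minusC :: trm where
  "minusC = (let x = (0, Base); y = (1, Base); u = (2, Base); v = (3, Base)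
    in lam x (lam y (Rec0 \<cdot> Var x \<cdot> lam u (lam v (predC \<cdot> Var u)) \<cdot> Var y)))"

definition pow2C :: trm where
  "pow2C = (let y = (1, Base); u = (2, Base); v = (3, Base)
    in lam y (Rec0 \<cdot> One \<cdot> lam u (lam v (plusC \<cdot> Var u \<cdot> Var u)) \<cdot> Var y))"

abbreviation plus_trm :: "trm \<Rightarrow> trm \<Rightarrow> trm" where "plus_trm s t \<equiv> plusC \<cdot> s \<cdot> t"
abbreviation times_trm :: "trm \<Rightarrow> trm \<Rightarrow> trm" where "times_trm s t \<equiv> timesC \<cdot> s \<cdot> t"
abbreviation minus_trm :: "trm \<Rightarrow> trm \<Rightarrow> trm" where "minus_trm s t \<equiv> minusC \<cdot> s \<cdot> t"

definition Le :: "trm \<Rightarrow> trm \<Rightarrow> fm" where "Le s t = Eq (minus_trm s t) Zero"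
definition Less :: "trm \<Rightarrow> trm \<Rightarrow> fm" where "Less s t = Le (Succ \<cdot> s) t"

text \<open>The pairing \<open>(i, j) \<mapsto> (i + j)\<^sup>2 + i\<close>; it is injective but not surjective.\<close>

definition pair_trm :: "trm \<Rightarrow> trm \<Rightarrow> trm" where
  "pair_trm s t = plus_trm (times_trm (plus_trm s t) (plus_trm s t)) s"

section \<open>Real numbers and \<open>NIN\<^bsub>[0,1]\<^esub>\<close>\<close>

text \<open>The number \<open>rat_code a b d\<close> codes the rational \<open>(a - b) / (d + 1)\<close>. Rationals have several
  codes, and not every number is a code.\<close>

definition rat_code :: "trm \<Rightarrow> trm \<Rightarrow> trm \<Rightarrow> trm" where
  "rat_code a b d = pair_trm (pair_trm a b) d"

text \<open>\<open>with_rats s t \<Phi>\<close> says that \<open>s\<close> and \<open>t\<close> code rationals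
  \<open>(a - b) / (d + 1)\<close> and \<open>(a' - b') / (d' + 1)\<close> such that \<open>\<Phi> P Q D\<close>, where their difference is
  \<open>(P - Q) / D\<close> with \<open>D = (d + 1) (d' + 1)\<close> and \<open>P, Q \<ge> 0\<close>. The number variables
  \<open>2, \<dots>, 7\<close> are bound here and must not occur in \<open>s\<close>, \<open>t\<close> or the body of \<open>\<Phi>\<close>.\<close>

definition with_rats :: "trm \<Rightarrow> trm \<Rightarrow> (trm \<Rightarrow> trm \<Rightarrow> trm \<Rightarrow> fm) \<Rightarrow> fm" where
  "with_rats s t \<Phi> =
    (let a = (2, Base); b = (3, Base); d = (4, Base);
         a' = (5, Base); b' = (6, Base); d' = (7, Base);
         e = Succ \<cdot> Var d; e' = Succ \<cdot> Var d'
     in Exists a (Exists b (Exists d (Exists a' (Exists b' (Exists d'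
          (Conj (Conj (Eq s (rat_code (Var a) (Var b) (Var d)))
                      (Eq t (rat_code (Var a') (Var b') (Var d'))))
                (\<Phi> (plus_trm (times_trm (Var a) e') (times_trm (Var b') e))
                   (plus_trm (times_trm (Var b) e') (times_trm (Var a') e))
                   (times_trm e e')))))))))"

abbreviation absdiff_trm :: "trm \<Rightarrow> trm \<Rightarrow> trm" where
  "absdiff_trm s t \<equiv> plus_trm (minus_trm s t) (minus_trm t s)"

text \<open>In the following three formulas \<open>x\<close> and \<open>y\<close> are type-1 terms without number variables,
  i.e. sequences \<open>(q\<^sub>n)\<close> and \<open>(r\<^sub>n)\<close> of codes of rationals.\<close>

text \<open>\<open>\<bar>q\<^sub>n - q\<^bsub>n+k\<^esub>\<bar> < 2\<^sup>-\<^sup>n\<close> for all \<open>n\<close>, \<open>k\<close>.\<close>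

definition is_real :: "trm \<Rightarrow> fm" where
  "is_real x = (let n = (0, Base); k = (1, Base)
    in Forall n (Forall k (with_rats (x \<cdot> Var n) (x \<cdot> plus_trm (Var n) (Var k))
         (\<lambda>P Q D. Less (times_trm (pow2C \<cdot> Var n) (absdiff_trm P Q)) D))))"

text \<open>\<open>\<bar>q\<^sub>n - r\<^sub>n\<bar> \<le> 2 \<cdot> 2\<^sup>-\<^sup>n\<close> for all \<open>n\<close>.\<close>

definition eq_real :: "trm \<Rightarrow> trm \<Rightarrow> fm" where
  "eq_real x y = (let n = (0, Base)
    in Forall n (with_rats (x \<cdot> Var n) (y \<cdot> Var n)
         (\<lambda>P Q D. Le (times_trm (pow2C \<cdot> Var n) (absdiff_trm P Q)) (plus_trm D D))))"

text \<open>\<open>q\<^sub>n - r\<^sub>n \<le> 2 \<cdot> 2\<^sup>-\<^sup>n\<close> for all \<open>n\<close>.\<close>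

definition le_real :: "trm \<Rightarrow> trm \<Rightarrow> fm" where
  "le_real x y = (let n = (0, Base)
    in Forall n (with_rats (x \<cdot> Var n) (y \<cdot> Var n)
         (\<lambda>P Q D. Le (times_trm (pow2C \<cdot> Var n) (minus_trm P Q)) (plus_trm D D))))"

definition zero_real :: trm where
  "zero_real = CombK Base Base \<cdot> rat_code Zero Zero Zero"

definition one_real :: trm where
  "one_real = CombK Base Base \<cdot> rat_code One Zero Zero"

definition in_unit :: "trm \<Rightarrow> fm" where
  "in_unit x = Conj (is_real x) (Conj (le_real zero_real x) (le_real x one_real))"

definition NIN :: fm where
  "NIN = (let Y = (0, type2); x = (0, type1); y = (1, type1)
    in Neg (Exists Y (Conj
         (Forall x (Forall y (Imp (Conj (in_unit (Var x)) (in_unit (Var y)))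
            (Imp (eq_real (Var x) (Var y)) (Eq (Var Y \<cdot> Var x) (Var Y \<cdot> Var y))))))
         (Forall x (Forall y (Imp (Conj (in_unit (Var x)) (in_unit (Var y)))
            (Imp (Eq (Var Y \<cdot> Var x) (Var Y \<cdot> Var y)) (eq_real (Var x) (Var y)))))))))"

section \<open>Second-order arithmetic and \<open>ATR\<^sub>0\<close>\<close>

datatype trm2 = NVar nat | Zero2 | One2 | Plus2 trm2 trm2 | Times2 trm2 trm2

text \<open>Number variables and set variables are two separate families, each indexed by \<open>nat\<close>.
  Equality of sets is not primitive.\<close>

datatype fm2 =
    Eq2 trm2 trm2
  | Less2 trm2 trm2
  | Mem2 trm2 nat
  | Falsum2
  | Imp2 fm2 fm2
  | AllN nat fm2
  | AllS nat fm2

abbreviation Neg2 :: "fm2 \<Rightarrow> fm2" where "Neg2 \<phi> \<equiv> Imp2 \<phi> Falsum2"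
abbreviation Disj2 :: "fm2 \<Rightarrow> fm2 \<Rightarrow> fm2" where "Disj2 \<phi> \<psi> \<equiv> Imp2 (Neg2 \<phi>) \<psi>"
abbreviation Conj2 :: "fm2 \<Rightarrow> fm2 \<Rightarrow> fm2" where "Conj2 \<phi> \<psi> \<equiv> Neg2 (Imp2 \<phi> (Neg2 \<psi>))"
abbreviation Iff2 :: "fm2 \<Rightarrow> fm2 \<Rightarrow> fm2" where "Iff2 \<phi> \<psi> \<equiv> Conj2 (Imp2 \<phi> \<psi>) (Imp2 \<psi> \<phi>)"
abbreviation ExN :: "nat \<Rightarrow> fm2 \<Rightarrow> fm2" where "ExN n \<phi> \<equiv> Neg2 (AllN n (Neg2 \<phi>))"
abbreviation ExS :: "nat \<Rightarrow> fm2 \<Rightarrow> fm2" where "ExS X \<phi> \<equiv> Neg2 (AllS X (Neg2 \<phi>))"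

fun fvN_trm :: "trm2 \<Rightarrow> nat set" where
  "fvN_trm (NVar n) = {n}"
| "fvN_trm (Plus2 s t) = fvN_trm s \<union> fvN_trm t"
| "fvN_trm (Times2 s t) = fvN_trm s \<union> fvN_trm t"
| "fvN_trm _ = {}"

fun fvN :: "fm2 \<Rightarrow> nat set" where
  "fvN (Eq2 s t) = fvN_trm s \<union> fvN_trm t"
| "fvN (Less2 s t) = fvN_trm s \<union> fvN_trm t"
| "fvN (Mem2 t X) = fvN_trm t"
| "fvN Falsum2 = {}"
| "fvN (Imp2 \<phi> \<psi>) = fvN \<phi> \<union> fvN \<psi>"
| "fvN (AllN n \<phi>) = fvN \<phi> - {n}"
| "fvN (AllS X \<phi>) = fvN \<phi>"

fun fvS :: "fm2 \<Rightarrow> nat set" where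
  "fvS (Mem2 t X) = {X}"
| "fvS (Imp2 \<phi> \<psi>) = fvS \<phi> \<union> fvS \<psi>"
| "fvS (AllN n \<phi>) = fvS \<phi>"
| "fvS (AllS X \<phi>) = fvS \<phi> - {X}"
| "fvS _ = {}"

fun arithmetical :: "fm2 \<Rightarrow> bool" where
  "arithmetical (Imp2 \<phi> \<psi>) \<longleftrightarrow> arithmetical \<phi> \<and> arithmetical \<psi>"
| "arithmetical (AllN n \<phi>) \<longleftrightarrow> arithmetical \<phi>"
| "arithmetical (AllS X \<phi>) \<longleftrightarrow> False"
| "arithmetical _ \<longleftrightarrow> True"

definition pair2 :: "trm2 \<Rightarrow> trm2 \<Rightarrow> trm2" where
  "pair2 s t = Plus2 (Times2 (Plus2 s t) (Plus2 s t)) s"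

text \<open>A set \<open>X\<close> is viewed as the relation \<open>i \<le>\<^sub>X j \<longleftrightarrow> (i, j) \<in> X\<close>, whose field is
  \<open>{i. (i, i) \<in> X}\<close> (reflexivity is part of \<open>LO2\<close>).\<close>

definition le2 :: "nat \<Rightarrow> trm2 \<Rightarrow> trm2 \<Rightarrow> fm2" where
  "le2 X s t = Mem2 (pair2 s t) X"

definition lt2 :: "nat \<Rightarrow> trm2 \<Rightarrow> trm2 \<Rightarrow> fm2" where
  "lt2 X s t = Conj2 (le2 X s t) (Neg2 (le2 X t s))"

definition field2 :: "nat \<Rightarrow> trm2 \<Rightarrow> fm2" where
  "field2 X s = le2 X s s"

definition LO2 :: "nat \<Rightarrow> fm2" where
  "LO2 X = (let i = NVar 0; j = NVar 1; k = NVar 2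
    in AllN 0 (AllN 1 (Conj2
         (Conj2 (Imp2 (le2 X i j) (Conj2 (field2 X i) (field2 X j)))
                (Imp2 (Conj2 (field2 X i) (field2 X j)) (Disj2 (le2 X i j) (le2 X j i))))
         (Conj2 (Imp2 (Conj2 (le2 X i j) (le2 X j i)) (Eq2 i j))
                (AllN 2 (Imp2 (Conj2 (le2 X i j) (le2 X j k)) (le2 X i k)))))))"

text \<open>\<open>F\<close> is (the graph of) a function from the natural numbers to the field of \<open>X\<close>.\<close>

definition fun_into_field2 :: "nat \<Rightarrow> nat \<Rightarrow> fm2" where
  "fun_into_field2 F X = (let k = NVar 0; n = NVar 1; m = NVar 2; m' = NVar 3
    in Conj2
         (AllN 0 (Imp2 (Mem2 k F) (ExN 1 (ExN 2 (Conj2 (Eq2 k (pair2 n m)) (field2 X m))))))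
         (AllN 1 (ExN 2 (Conj2 (Mem2 (pair2 n m) F)
            (AllN 3 (Imp2 (Mem2 (pair2 n m') F) (Eq2 m' m)))))))"

definition WF2 :: "nat \<Rightarrow> fm2" where
  "WF2 X = (let F = Suc X; n = NVar 0; m = NVar 1; m' = NVar 2
    in Neg2 (ExS F (Conj2 (fun_into_field2 F X)
         (AllN 0 (AllN 1 (AllN 2 (Imp2
            (Conj2 (Mem2 (pair2 n m) F) (Mem2 (pair2 (Plus2 n One2) m') F))
            (lt2 X m' m))))))))"

definition WO2 :: "nat \<Rightarrow> fm2" where
  "WO2 X = Conj2 (LO2 X) (WF2 X)"

text \<open>In \<open>\<theta>(n, Z)\<close> the number \<open>n\<close> is number variable \<open>0\<close> and \<open>Z\<close> is set variable \<open>0\<close>. For an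
  order \<open>X\<close>, the formula \<open>H2 \<theta>\<close> says
  \<open>Y = {(n, j). j \<in> field X \<and> \<theta>(n, Y\<^sup>j)}\<close> where \<open>Y\<^sup>j = {(m, i). i <\<^sub>X j \<and> (m, i) \<in> Y}\<close>,
  \<open>X\<close> is set variable \<open>1\<close> and \<open>Y\<close> is set variable \<open>2\<close>. The set term \<open>Y\<^sup>j\<close> is eliminated by an
  existential quantifier over \<open>Z\<close>; such a \<open>Z\<close> exists by arithmetical comprehension and is unique
  up to extensional equality.\<close>

definition H2 :: "fm2 \<Rightarrow> fm2" where
  "H2 \<theta> = (let Z = 0; X = 1; Y = 2; n = NVar 0; j = NVar 1; k = NVar 2;
               w = NVar 3; m = NVar 4; i = NVar 5
    in AllN 2 (Iff2 (Mem2 k Y)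
         (ExN 0 (ExN 1 (Conj2 (Eq2 k (pair2 n j)) (Conj2 (field2 X j)
            (ExS Z (Conj2
               (AllN 3 (Iff2 (Mem2 w Z)
                  (ExN 4 (ExN 5 (Conj2 (Eq2 w (pair2 m i))
                     (Conj2 (lt2 X i j) (Mem2 (pair2 m i) Y)))))))
               \<theta>))))))))"

definition ATR_instance :: "fm2 \<Rightarrow> fm2" where
  "ATR_instance \<theta> = AllS 1 (Imp2 (WO2 1) (ExS 2 (H2 \<theta>)))"

text \<open>In the transfinite recursion scheme, \<open>\<theta>\<close> may have further free variables as parameters, but
  these must differ from the variables \<open>j\<close>, \<open>k\<close>, \<open>X\<close>, \<open>Y\<close> bound in front of \<open>\<theta>\<close>.\<close>

inductive_set ATR0_ax :: "fm2 set" where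
  succ_nonzero: "Neg2 (Eq2 (Plus2 (NVar 0) One2) Zero2) \<in> ATR0_ax"
| succ_inj: "Imp2 (Eq2 (Plus2 (NVar 0) One2) (Plus2 (NVar 1) One2))
      (Eq2 (NVar 0) (NVar 1)) \<in> ATR0_ax"
| plus_zero: "Eq2 (Plus2 (NVar 0) Zero2) (NVar 0) \<in> ATR0_ax"
| plus_succ: "Eq2 (Plus2 (NVar 0) (Plus2 (NVar 1) One2))
      (Plus2 (Plus2 (NVar 0) (NVar 1)) One2) \<in> ATR0_ax"
| times_zero: "Eq2 (Times2 (NVar 0) Zero2) Zero2 \<in> ATR0_ax"
| times_succ: "Eq2 (Times2 (NVar 0) (Plus2 (NVar 1) One2))
      (Plus2 (Times2 (NVar 0) (NVar 1)) (NVar 0)) \<in> ATR0_ax"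
| less_zero: "Neg2 (Less2 (NVar 0) Zero2) \<in> ATR0_ax"
| less_succ: "Iff2 (Less2 (NVar 0) (Plus2 (NVar 1) One2))
      (Disj2 (Less2 (NVar 0) (NVar 1)) (Eq2 (NVar 0) (NVar 1))) \<in> ATR0_ax"
| induction: "AllS 0 (Imp2 (Conj2 (Mem2 Zero2 0)
        (AllN 0 (Imp2 (Mem2 (NVar 0) 0) (Mem2 (Plus2 (NVar 0) One2) 0))))
      (AllN 0 (Mem2 (NVar 0) 0))) \<in> ATR0_ax"
| comprehension: "arithmetical \<phi> \<Longrightarrow> X \<notin> fvS \<phi> \<Longrightarrow>
    ExS X (AllN n (Iff2 (Mem2 (NVar n) X) \<phi>)) \<in> ATR0_ax"
| transfinite_recursion: "arithmetical \<theta> \<Longrightarrow> fvN \<theta> \<inter> {1, 2} = {} \<Longrightarrow> fvS \<theta> \<inter> {1, 2} = {} \<Longrightarrow>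
    ATR_instance \<theta> \<in> ATR0_ax"

inductive_set generalisations :: "fm2 set \<Rightarrow> fm2 set" for A :: "fm2 set" where
  base: "\<phi> \<in> A \<Longrightarrow> \<phi> \<in> generalisations A"
| number: "\<phi> \<in> generalisations A \<Longrightarrow> AllN n \<phi> \<in> generalisations A"
| set: "\<phi> \<in> generalisations A \<Longrightarrow> AllS X \<phi> \<in> generalisations A"

text \<open>The axioms of \<open>ATR\<^sub>0\<close> are the universal closures of the formulas above.\<close>

definition ATR0 :: "fm2 set" where
  "ATR0 = {\<phi> \<in> generalisations ATR0_ax. fvN \<phi> = {} \<and> fvS \<phi> = {}}"

section \<open>Second-order arithmetic inside the language of all finite types\<close>

text \<open>Sets of natural numbers are represented by their characteristic functions, with value \<open>1\<close>
  for membership.\<close>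

fun tr_trm :: "trm2 \<Rightarrow> trm" where
  "tr_trm (NVar n) = Var (n, Base)"
| "tr_trm Zero2 = Zero"
| "tr_trm One2 = One"
| "tr_trm (Plus2 s t) = plus_trm (tr_trm s) (tr_trm t)"
| "tr_trm (Times2 s t) = times_trm (tr_trm s) (tr_trm t)"

definition is_set :: "nat \<Rightarrow> fm" where
  "is_set X = Forall (0, Base) (Disj (Eq (Var (X, type1) \<cdot> Var (0, Base)) Zero)
                                     (Eq (Var (X, type1) \<cdot> Var (0, Base)) One))"

fun tr :: "fm2 \<Rightarrow> fm" where
  "tr (Eq2 s t) = Eq (tr_trm s) (tr_trm t)"
| "tr (Less2 s t) = Less (tr_trm s) (tr_trm t)"
| "tr (Mem2 t X) = Eq (Var (X, type1) \<cdot> tr_trm t) One"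
| "tr Falsum2 = Falsum"
| "tr (Imp2 \<phi> \<psi>) = Imp (tr \<phi>) (tr \<psi>)"
| "tr (AllN n \<phi>) = Forall (n, Base) (tr \<phi>)"
| "tr (AllS X \<phi>) = Forall (X, type1) (Imp (is_set X) (tr \<phi>))"

text \<open>The system with nonlogical axioms \<open>T\<close> proves the second-order system with axioms \<open>A\<close>.\<close>

definition proves_system :: "fm set \<Rightarrow> fm2 set \<Rightarrow> bool" where
  "proves_system T A \<longleftrightarrow> (\<forall>\<phi> \<in> A. T \<turnstile> tr \<phi>)"

end

theory Submission
  imports Defs Complex_Main "HOL-Library.Countable_Set"
begin

text \<open>Let \<open>M\<close> be a countable class of functions on the natural numbers that is closed under
  composition, primitive recursion and the \<open>\<mu>\<close>-operator. It is the type-1 part of an extensional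
  type structure in which \<open>\<sigma> \<Rrightarrow> \<tau>\<close> consists of the functionals that preserve uniformly \<open>M\<close>-presented
  sequences. The elements are represented by closed combinatory terms with an infinitary evaluation
  relation, so that one HOL type serves all finite types. Every \<open>F\<close> of type 2 such that
  \<open>x \<mapsto> F (g x)\<close> belongs to \<open>M\<close> for all sequences \<open>g\<close> presented in \<open>M\<close> is an element, which gives
  \<open>\<exists>\<^sup>2\<close> and choice. It also gives an injection on the reals: enumerate the binary functions of
  \<open>M\<close> as \<open>e\<^sub>0, e\<^sub>1, \<dots>\<close> and map a real \<open>f\<close> to the least \<open>(i, a)\<close> such that \<open>e\<^sub>i(a, -)\<close>
  represents \<open>f\<close>. On a sequence of reals presented by \<open>e\<^sub>j\<close> only \<open>i \<le> j\<close> matter, so that finitely many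
  arithmetical searches compute the map.

  To refute \<open>ATR\<^sub>0\<close>, take for \<open>M\<close> the functions generated from a suitable base function \<open>b\<close>. The
  base function encodes the rules by which the graphs of the generated functions are
  derived. Iterating these rules along \<open>\<omega>\<close> is an instance of arithmetical transfinite recursion, and
  a solution in \<open>M\<close> would be a universal function for \<open>M\<close> in \<open>M\<close>.\<close>

abbreviation pe :: "nat \<Rightarrow> nat \<Rightarrow> nat" where "pe a b \<equiv> prod_encode (a, b)"
abbreviation p1 :: "nat \<Rightarrow> nat" where "p1 z \<equiv> fst (prod_decode z)"
abbreviation p2 :: "nat \<Rightarrow> nat" where "p2 z \<equiv> snd (prod_decode z)"

text \<open>The default 0 makes unbounded search total. A class closed under this operator is closed
  under quantification over numbers, not merely under computable search.\<close>

definition mu :: "(nat \<Rightarrow> nat) \<Rightarrow> nat" where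
  "mu h = (if \<exists>n. h n = 0 then LEAST n. h n = 0 else 0)"

lemma mu_zero: "h n = 0 \<Longrightarrow> h (mu h) = 0"
  unfolding mu_def by (metis (mono_tags, lifting) LeastI)

lemma indicator_zero [simp]:
  "(if P then 0 else Suc 0) = 0 \<longleftrightarrow> P" "(if P then Suc 0 else 0) = 0 \<longleftrightarrow> \<not> P"
  by simp_all

section \<open>Arithmetically closed classes of functions\<close>

locale arith_closed =
  fixes M :: "(nat \<Rightarrow> nat) set"
  assumes M_id: "(\<lambda>x. x) \<in> M"
    and M_comp: "f \<in> M \<Longrightarrow> g \<in> M \<Longrightarrow> (\<lambda>x. f (g x)) \<in> M"
    and M_const: "(\<lambda>x. c) \<in> M"
    and M_pair: "f \<in> M \<Longrightarrow> g \<in> M \<Longrightarrow> (\<lambda>x. pe (f x) (g x)) \<in> M"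
    and M_fst: "p1 \<in> M"
    and M_snd: "p2 \<in> M"
    and M_Suc: "Suc \<in> M"
    and M_ifz: "(\<lambda>z. if p1 z = 0 then p1 (p2 z) else p2 (p2 z)) \<in> M"
    and M_eq: "(\<lambda>z. if p1 z = p2 z then 0 else 1) \<in> M"
    and M_rec: "f \<in> M \<Longrightarrow> g \<in> M \<Longrightarrow>
      (\<lambda>z. rec_nat (f (p1 z)) (\<lambda>k r. g (pe r (pe k (p1 z)))) (p2 z)) \<in> M"
    and M_mu: "f \<in> M \<Longrightarrow> (\<lambda>x. mu (\<lambda>n. f (pe x n))) \<in> M"
begin

section \<open>Definition by cases, number quantifiers and search within \<open>M\<close>\<close>

lemma M_fst': "f \<in> M \<Longrightarrow> (\<lambda>x. p1 (f x)) \<in> M"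
  using M_comp[OF M_fst] .

lemma M_snd': "f \<in> M \<Longrightarrow> (\<lambda>x. p2 (f x)) \<in> M"
  using M_comp[OF M_snd] .

lemma M_if_zero:
  assumes "f \<in> M" "g \<in> M" "h \<in> M"
  shows "(\<lambda>x. if f x = 0 then g x else h x) \<in> M"
  using M_comp[OF M_ifz M_pair[OF assms(1) M_pair[OF assms(2,3)]]] by (simp cong: if_cong)

lemma M_if_eq:
  assumes "f \<in> M" "g \<in> M" "a \<in> M" "b \<in> M"
  shows "(\<lambda>x. if f x = g x then a x else b x) \<in> M"
proof -
  have "(\<lambda>x. if f x = g x then 0 else 1 :: nat) \<in> M"
    using M_comp[OF M_eq M_pair[OF assms(1,2)]] by simp
  from M_if_zero[OF this assms(3,4)] show ?thesis by (simp cong: if_cong)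
qed

lemma M_rec':
  assumes "a \<in> M" "g \<in> M" "m \<in> M"
  shows "(\<lambda>x. rec_nat (a x) (\<lambda>k r. g (pe r (pe k x))) (m x)) \<in> M"
  using M_comp[OF M_rec[OF assms(1,2)] M_pair[OF M_id assms(3)]] by simp

text \<open>Search for a counterexample and then test the candidate. Because \<open>mu\<close>
  always returns something, the value of \<open>q\<close> at the candidate decides whether a
  counterexample exists.\<close>

lemma M_all_zero:
  assumes "q \<in> M"
  shows "(\<lambda>x. if \<forall>n. q (pe x n) = 0 then 0 else 1) \<in> M"
proof -
  let ?c = "\<lambda>z. if q z = 0 then 1 else (0 :: nat)"
  have "?c \<in> M" by (intro M_if_zero assms M_const)
  note c = M_mu[OF this]
  have "(\<lambda>x. q (pe x (mu (\<lambda>n. ?c (pe x n))))) \<in> M"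
    by (intro M_comp[OF assms] M_pair M_id c)
  moreover have "q (pe x (mu (\<lambda>n. ?c (pe x n)))) = 0 \<longleftrightarrow> (\<forall>n. q (pe x n) = 0)" for x
    using mu_zero[of "\<lambda>n. ?c (pe x n)"] by (metis zero_neq_one)
  ultimately show ?thesis
    using M_if_zero[OF _ M_const[of 0] M_const[of 1]] by (fastforce cong: if_cong)
qed

text \<open>The candidate returned by \<open>mu\<close> is a zero as soon as there is one, so one
  more evaluation of \<open>p\<close> selects the branch.\<close>

lemma M_search:
  assumes "p \<in> M" "f \<in> M" "g \<in> M"
  shows "(\<lambda>x. if \<exists>n. p (pe x n) = 0 then f (pe x (mu (\<lambda>n. p (pe x n)))) else g x) \<in> M"
proof -
  have m: "(\<lambda>x. pe x (mu (\<lambda>n. p (pe x n)))) \<in> M" by (intro M_pair M_id M_mu assms)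
  have "p (pe x (mu (\<lambda>n. p (pe x n)))) = 0 \<longleftrightarrow> (\<exists>n. p (pe x n) = 0)" for x
    using mu_zero[of "\<lambda>n. p (pe x n)"] by auto
  then show ?thesis
    using M_if_zero[OF M_comp[OF assms(1) m] M_comp[OF assms(2) m] assms(3)]
    by (simp cong: if_cong)
qed

section \<open>Type-2 functionals over \<open>M\<close> and selectors for partial equivalence
  relations\<close>

text \<open>A function \<open>g\<close> in \<open>M\<close> is read as the sequence of its rows
  \<open>g (pe x -)\<close>. Below, this condition makes \<open>Fun2 F\<close> an element of type
  2.\<close>

definition closed2 :: "((nat \<Rightarrow> nat) \<Rightarrow> nat) \<Rightarrow> bool" where
  "closed2 F \<longleftrightarrow> (\<forall>g\<in>M. (\<lambda>x. F (\<lambda>n. g (pe x n))) \<in> M)"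

text \<open>\<open>F f\<close> is the first position at which some row of an enumeration of
  \<open>M\<close> is \<open>Q\<close>-related to \<open>f\<close>. By symmetry and transitivity,
  \<open>Q\<close>-related functions have the same representatives, and a common representative
  forces \<open>Q\<close>. The shape of \<open>Q\<close>, a universal statement about two values of
  each function, suits the equality of Cauchy sequences, where \<open>f n\<close> and
  \<open>f (n + k)\<close> are compared.\<close>

lemma closed2_selector:
  fixes q :: "nat \<Rightarrow> nat"
  assumes cnt: "countable M" and q: "q \<in> M" and s: "s \<in> M" and t: "t \<in> M"
    and Q: "\<And>h f. Q h f \<longleftrightarrow> (\<forall>k. q (pe k (pe (pe (h (s k)) (h (t k))) (pe (f (s k)) (f (t k))))) = 0)"
    and sym: "\<And>h f. Q h f \<Longrightarrow> Q f h"
    and trans: "\<And>h f g. Q h f \<Longrightarrow> Q f g \<Longrightarrow> Q h g"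
  obtains F where "closed2 F" "\<And>f g. f \<in> M \<Longrightarrow> g \<in> M \<Longrightarrow> Q f f \<Longrightarrow> Q g g \<Longrightarrow> F f = F g \<longleftrightarrow> Q f g"
proof -
  define e :: "nat \<Rightarrow> nat \<Rightarrow> nat" where "e = from_nat_into M"
  have eM: "e i \<in> M" for i unfolding e_def by (rule from_nat_into) (use M_id in auto)
  have e_surj: "\<exists>j. e j = g" if "g \<in> M" for g
    unfolding e_def using from_nat_into_surj[OF cnt that] by auto
  define T where "T i a f \<longleftrightarrow> Q (\<lambda>n. e i (pe a n)) f" for i a f
  \<comment> \<open>The default 0 may coincide with some \<open>pe i a\<close>. This does no harm:
    by \<open>F_T\<close> below, an \<open>f\<close> in \<open>M\<close> with \<open>Q f f\<close>
    always has a representative.\<close>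
  define F where "F f = (if \<exists>i a. T i a f
    then let i = LEAST i. \<exists>a. T i a f in pe i (LEAST a. T i a f) else 0)" for f
  \<comment> \<open>A row of \<open>e j\<close> that is \<open>Q\<close>-related to anything is
    \<open>Q\<close>-related to itself, hence represented at index \<open>j\<close>. So
    \<open>j\<close> bounds the search over \<open>i\<close>.\<close>
  have wit: "\<exists>a. T j a (\<lambda>n. g (pe x n))" if "e j = g" "Q f (\<lambda>n. g (pe x n))" for j g x f
    unfolding T_def using trans[OF sym[OF that(2)] that(2)] that(1) by auto
  \<comment> \<open>For fixed \<open>i\<close>, being a representative is a universal number
    quantifier over a test in \<open>M\<close>, so it is decided in \<open>M\<close>, and the least
    \<open>a\<close> is found by one search.\<close>
  have step: "(\<lambda>x. if \<exists>a. T i a (\<lambda>n. g (pe x n)) then pe i (LEAST a. T i a (\<lambda>n. g (pe x n))) else k x) \<in> M"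
    if g: "g \<in> M" and k: "k \<in> M" for i g k
  proof -
    have 1: "(\<lambda>z. q (pe (p2 z) (pe (pe (e i (pe (p2 (p1 z)) (s (p2 z)))) (e i (pe (p2 (p1 z)) (t (p2 z)))))
       (pe (g (pe (p1 (p1 z)) (s (p2 z)))) (g (pe (p1 (p1 z)) (t (p2 z)))))))) \<in> M"
      by (intro M_comp[OF q] M_comp[OF eM] M_comp[OF g] M_comp[OF s] M_comp[OF t] M_pair M_fst' M_snd' M_id)
    from M_all_zero[OF this]
    have "(\<lambda>z. if T i (p2 z) (\<lambda>n. g (pe (p1 z) n)) then 0 else 1 :: nat) \<in> M"
      unfolding T_def Q by (simp cong: if_cong)
    from M_search[OF this M_pair[OF M_const[of i] M_snd] k]
    have "(\<lambda>x. if \<exists>a. T i a (\<lambda>n. g (pe x n)) then pe i (mu (\<lambda>a. if T i a (\<lambda>n. g (pe x n)) then 0 else 1)) else k x) \<in> M"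
      by (simp cong: if_cong)
    moreover have "mu (\<lambda>a. if T i a f then 0 else 1) = (LEAST a. T i a f)" if "\<exists>a. T i a f" for f
      using that unfolding mu_def by (auto intro!: arg_cong[where f=Least])
    ultimately show ?thesis by (simp cong: if_cong)
  qed
  have bounded: "(\<lambda>x. if \<exists>i<J. \<exists>a. T i a (\<lambda>n. g (pe x n)) then F (\<lambda>n. g (pe x n)) else 0) \<in> M"
    if g: "g \<in> M" for g J
  proof -
    \<comment> \<open>\<open>G I\<close> searches only the indices in the interval from
      \<open>I\<close> up to, but excluding, \<open>J\<close>. Starting from the empty interval,
      each step of the descending induction puts one search in front; \<open>G 0\<close> is the
      desired function.\<close>
    define B where "B I x \<longleftrightarrow> (\<exists>i<J. i \<ge> I \<and> (\<exists>a. T i a (\<lambda>n. g (pe x n))))" for I x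
    define G where "G I x = (if B I x
      then let i = LEAST i. i \<ge> I \<and> (\<exists>a. T i a (\<lambda>n. g (pe x n)))
           in pe i (LEAST a. T i a (\<lambda>n. g (pe x n))) else 0)" for I x
    have "G (J - I) \<in> M" for I
    proof (induction I)
      case 0
      have "G J = (\<lambda>x. 0)" unfolding G_def B_def by (rule HOL.ext) auto
      then show ?case using M_const by simp
    next
      case (Suc I)
      show ?case
      proof (cases "I < J")
        case False
        then show ?thesis using Suc by simp
      next
        case True
        define K where "K = J - Suc I"
        have K: "J - I = Suc K" "K < J" using True by (auto simp: K_def)
        have "G K x = (if \<exists>a. T K a (\<lambda>n. g (pe x n)) then pe K (LEAST a. T K a (\<lambda>n. g (pe x n)))
           else G (Suc K) x)" for x
        proof (cases "\<exists>a. T K a (\<lambda>n. g (pe x n))")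
          case True
          then have "(LEAST i. i \<ge> K \<and> (\<exists>a. T i a (\<lambda>n. g (pe x n)))) = K"
            by (intro Least_equality) auto
          then show ?thesis using True K(2) unfolding G_def B_def by (auto simp: Let_def)
        next
          case False
          then have "i \<ge> K \<and> (\<exists>a. T i a (\<lambda>n. g (pe x n))) \<longleftrightarrow> i \<ge> Suc K \<and> (\<exists>a. T i a (\<lambda>n. g (pe x n)))" for i
            by (metis Suc_le_eq le_less)
          then show ?thesis using False unfolding G_def B_def by auto
        qed
        then have "G K = (\<lambda>x. if \<exists>a. T K a (\<lambda>n. g (pe x n)) then pe K (LEAST a. T K a (\<lambda>n. g (pe x n)))
           else G (Suc K) x)" by (rule HOL.ext)
        with step[OF g Suc[unfolded K]] show ?thesis unfolding K_def[symmetric] by simp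
      qed
    qed
    from this[of J] have "G 0 \<in> M" by simp
    moreover have "G 0 = (\<lambda>x. if \<exists>i<J. \<exists>a. T i a (\<lambda>n. g (pe x n)) then F (\<lambda>n. g (pe x n)) else 0)"
      unfolding G_def B_def F_def by (rule HOL.ext) auto
    ultimately show ?thesis by simp
  qed
  have "closed2 F" unfolding closed2_def
  proof
    fix g assume g: "g \<in> M"
    then obtain j where j: "e j = g" using e_surj by auto
    have "(\<exists>i<Suc j. \<exists>a. T i a (\<lambda>n. g (pe x n))) \<longleftrightarrow> (\<exists>i a. T i a (\<lambda>n. g (pe x n)))" for x
      using wit[OF j] unfolding T_def by blast
    then have "(\<lambda>x. if \<exists>i<Suc j. \<exists>a. T i a (\<lambda>n. g (pe x n)) then F (\<lambda>n. g (pe x n)) else 0) = (\<lambda>x. F (\<lambda>n. g (pe x n)))"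
      by (intro HOL.ext) (auto simp: F_def)
    with bounded[OF g, of "Suc j"] show "(\<lambda>x. F (\<lambda>n. g (pe x n))) \<in> M" by simp
  qed
  moreover have "F f = F g \<longleftrightarrow> Q f g" if fg: "f \<in> M" "g \<in> M" "Q f f" "Q g g" for f g
  proof
    assume "Q f g"
    then have "T i a f \<longleftrightarrow> T i a g" for i a unfolding T_def using sym trans by blast
    then show "F f = F g" unfolding F_def by simp
  next
    assume eq: "F f = F g"
    \<comment> \<open>The sequence with constant row \<open>f\<close> belongs to \<open>M\<close>,
      so it is some \<open>e j\<close> and provides a representative of \<open>f\<close>.\<close>
    have F_T: "\<exists>i a. F f = pe i a \<and> T i a f" if f: "f \<in> M" "Q f f" for f
    proof -
      have "(\<lambda>z. f (p2 z)) \<in> M" using M_comp[OF f(1) M_snd] .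
      then obtain j where "e j = (\<lambda>z. f (p2 z))" using e_surj by blast
      then have ex: "\<exists>i a. T i a f" unfolding T_def using f(2) by (auto intro!: exI[of _ j])
      define i where "i = (LEAST i. \<exists>a. T i a f)"
      have "\<exists>a. T i a f" unfolding i_def by (rule LeastI_ex) (rule ex)
      then have "T i (LEAST a. T i a f) f" by (rule LeastI_ex)
      then show ?thesis using ex unfolding F_def i_def by (auto simp: Let_def)
    qed
    obtain i a where "T i a f" "T i a g"
      using F_T[OF fg(1,3)] F_T[OF fg(2,4)] eq by auto
    then show "Q f g" unfolding T_def using sym trans by blast
  qed
  ultimately show ?thesis using that by blast
qed

end

section \<open>An extensional type structure over an arithmetically closed class\<close>

text \<open>Arbitrary functions and functionals occur as constants. Membership in the type structure
  is imposed only later, by \<open>El\<close>.\<close>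

datatype tm = Num nat | Fn "nat \<Rightarrow> nat" | Fun2 "(nat \<Rightarrow> nat) \<Rightarrow> nat" | KK | SS | RR
  | Ap tm tm (infixl "\<bullet>" 90)

text \<open>Head reduction: redexes in argument position are not contracted, so a term has at most
  one reduct.\<close>

inductive step :: "tm \<Rightarrow> tm \<Rightarrow> bool" where
  step_K: "step (KK \<bullet> a \<bullet> b) a"
| step_S: "step (SS \<bullet> a \<bullet> b \<bullet> c) (a \<bullet> c \<bullet> (b \<bullet> c))"
| step_Ap: "step s t \<Longrightarrow> step (s \<bullet> u) (t \<bullet> u)"

text \<open>The rule for \<open>Fun2\<close> has one premise for each numeral: the argument must be
  a total function before the functional is applied to its graph. \<open>RR\<close> evaluates its
  third argument first and then recurs at a numeral.\<close>

inductive ev :: "tm \<Rightarrow> nat \<Rightarrow> bool" where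
  ev_Num: "ev (Num n) n"
| ev_Fn: "ev t n \<Longrightarrow> ev (Fn f \<bullet> t) (f n)"
| ev_Fun2: "(\<And>m. ev (t \<bullet> Num m) (h m)) \<Longrightarrow> ev (Fun2 F \<bullet> t) (F h)"
| ev_RR_0: "ev m 0 \<Longrightarrow> ev a n \<Longrightarrow> ev (RR \<bullet> a \<bullet> g \<bullet> m) n"
| ev_RR_Suc: "ev m (Suc k) \<Longrightarrow> ev (g \<bullet> (RR \<bullet> a \<bullet> g \<bullet> Num k) \<bullet> Num k) n \<Longrightarrow> ev (RR \<bullet> a \<bullet> g \<bullet> m) n"
| ev_step: "step s t \<Longrightarrow> ev t n \<Longrightarrow> ev s n"

lemma step_simps [simp]:
  "\<not> step (Num n) t" "\<not> step (Fn f) t" "\<not> step (Fun2 F) t" "\<not> step KK t" "\<not> step SS t" "\<not> step RR t"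
  by (subst step.simps, simp)+

lemma step_simps_Ap [simp]:
  "\<not> step (Fn f \<bullet> a) t" "\<not> step (Fun2 F \<bullet> a) t" "\<not> step (KK \<bullet> a) t" "\<not> step (SS \<bullet> a) t" "\<not> step (RR \<bullet> a) t"
  by (subst step.simps, simp)+

lemma step_simps_Ap2 [simp]:
  "\<not> step (SS \<bullet> a \<bullet> b) t" "\<not> step (RR \<bullet> a \<bullet> b) t"
  by (subst step.simps, simp)+

lemma step_simps_Ap3 [simp]:
  "\<not> step (RR \<bullet> a \<bullet> b \<bullet> c) t" "step (KK \<bullet> a \<bullet> b) t \<longleftrightarrow> t = a" "step (SS \<bullet> a \<bullet> b \<bullet> c) t \<longleftrightarrow> t = a \<bullet> c \<bullet> (b \<bullet> c)"
  by (subst step.simps, force)+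

lemma step_det: "step s t \<Longrightarrow> step s t' \<Longrightarrow> t = t'"
proof (induction arbitrary: t' rule: step.induct)
  case (step_Ap s t u)
  from step_Ap.prems show ?case
    by (cases rule: step.cases) (use step_Ap in auto)
qed simp_all

text \<open>The head constant and the number of its arguments determine the applicable rule, except
  for the two recursor rules; these are separated by the value of the recursion argument, unique by
  induction.\<close>

lemma ev_det: "ev s n \<Longrightarrow> ev s n' \<Longrightarrow> n = n'"
proof (induction arbitrary: n' rule: ev.induct)
  case (ev_Num n)
  from ev_Num.prems show ?case by (cases rule: ev.cases) simp_all
next
  case (ev_Fn t n f)
  from ev_Fn.prems show ?case by (cases rule: ev.cases) (simp_all add: ev_Fn.IH)
next
  case (ev_Fun2 t h F)
  from ev_Fun2.prems show ?case
  proof (cases rule: ev.cases)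
    case (ev_Fun2 h')
    then have "h m = h' m" for m using ev_Fun2.IH[of m "h' m"] by simp
    then have "h = h'" by blast
    then show ?thesis using ev_Fun2 by simp
  qed simp_all
next
  case (ev_RR_0 m a n g)
  from ev_RR_0.prems show ?case
  proof (cases rule: ev.cases)
    case (ev_RR_Suc k)
    then show ?thesis using ev_RR_0.IH(1)[of "Suc k"] by simp
  qed (simp_all add: ev_RR_0.IH)
next
  case (ev_RR_Suc m k g a n)
  from ev_RR_Suc.prems show ?case
  proof (cases rule: ev.cases)
    case ev_RR_0
    then show ?thesis using ev_RR_Suc.IH(1)[of 0] by simp
  next
    case (ev_RR_Suc k')
    then show ?thesis using ev_RR_Suc.IH(1)[of "Suc k'"] ev_RR_Suc.IH(2)[of n'] by simp
  qed simp_all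
next
  case (ev_step s t n)
  have s: "step s t' \<Longrightarrow> t' = t" for t' using ev_step.hyps(1) step_det by blast
  from ev_step.prems show ?case
    by (cases rule: ev.cases) (use ev_step.hyps(1) ev_step.IH s in auto)
qed

section \<open>Plots and their extensional equality\<close>

context arith_closed
begin

text \<open>A plot of type \<open>\<sigma>\<close> is a sequence of terms that is uniformly represented in \<open>M\<close>; \<open>rel \<sigma>\<close> is
  extensional equality of plots. Requiring uniformity, rather than only that each single term
  represents an element of \<open>M\<close>, is what makes functionals of type 2 closed under parameters.\<close>

fun rel :: "ftype \<Rightarrow> (nat \<Rightarrow> tm) \<Rightarrow> (nat \<Rightarrow> tm) \<Rightarrow> bool" where
  "rel Base q r \<longleftrightarrow> (\<exists>g\<in>M. \<forall>n. ev (q n) (g n) \<and> ev (r n) (g n))"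
| "rel (\<sigma> \<Rrightarrow> \<tau>) q r \<longleftrightarrow> (\<forall>h\<in>M. \<forall>p s. rel \<sigma> p s \<longrightarrow> rel \<tau> (\<lambda>n. q (h n) \<bullet> p n) (\<lambda>n. r (h n) \<bullet> s n))"

lemma rel_ApD: "rel (\<sigma> \<Rrightarrow> \<tau>) q r \<Longrightarrow> rel \<sigma> p s \<Longrightarrow> rel \<tau> (\<lambda>n. q n \<bullet> p n) (\<lambda>n. r n \<bullet> s n)"
  using M_id by fastforce

text \<open>At type 0 this is closure of \<open>M\<close> under composition; at arrow types it is
  built into \<open>rel\<close> by the quantifier over \<open>h\<close>.\<close>

lemma rel_reindex: "rel \<sigma> q r \<Longrightarrow> h \<in> M \<Longrightarrow> rel \<sigma> (\<lambda>n. q (h n)) (\<lambda>n. r (h n))"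
proof (cases \<sigma>)
  case Base
  assume "rel \<sigma> q r" "h \<in> M"
  then show ?thesis using M_comp[of _ h] Base by fastforce
next
  case (Arr \<rho> \<tau>)
  assume "rel \<sigma> q r" "h \<in> M"
  then show ?thesis using M_comp[of h] Arr by fastforce
qed

text \<open>Both laws are proved together: transitivity at an arrow type applies the middle
  functional to \<open>p'\<close> on both sides, and \<open>rel \<sigma> p' p'\<close> needs
  symmetry and transitivity at the argument type.\<close>

lemma rel_sym_trans:
  "(rel \<sigma> q r \<longrightarrow> rel \<sigma> r q) \<and> (rel \<sigma> q r \<longrightarrow> rel \<sigma> r s \<longrightarrow> rel \<sigma> q s)"
proof (induction \<sigma> arbitrary: q r s)
  case Base
  have "g = g'" if "\<forall>n. ev (q n) (g n) \<and> ev (r n) (g n)" "\<forall>n. ev (r n) (g' n) \<and> ev (s n) (g' n)" for g g'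
    using that ev_det by blast
  then show ?case unfolding rel.simps by metis
next
  case (Arr \<sigma> \<tau>)
  have sym: "rel (\<sigma> \<Rrightarrow> \<tau>) r q" if "rel (\<sigma> \<Rrightarrow> \<tau>) q r" for q r
    using that Arr unfolding rel.simps by blast
  have "rel (\<sigma> \<Rrightarrow> \<tau>) q s" if "rel (\<sigma> \<Rrightarrow> \<tau>) q r" "rel (\<sigma> \<Rrightarrow> \<tau>) r s"
    unfolding rel.simps
  proof (intro ballI allI impI)
    fix h p p' assume h: "h \<in> M" and p: "rel \<sigma> p p'"
    have "rel \<sigma> p' p'" using p Arr(1) by blast
    then have "rel \<tau> (\<lambda>n. r (h n) \<bullet> p' n) (\<lambda>n. s (h n) \<bullet> p' n)" using that(2) h by simp
    moreover have "rel \<tau> (\<lambda>n. q (h n) \<bullet> p n) (\<lambda>n. r (h n) \<bullet> p' n)" using that(1) h p by simp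
    ultimately show "rel \<tau> (\<lambda>n. q (h n) \<bullet> p n) (\<lambda>n. s (h n) \<bullet> p' n)" using Arr(2) by blast
  qed
  with sym show ?case by blast
qed

lemma rel_sym: "rel \<sigma> q r \<Longrightarrow> rel \<sigma> r q"
  and rel_trans: "rel \<sigma> q r \<Longrightarrow> rel \<sigma> r s \<Longrightarrow> rel \<sigma> q s"
  using rel_sym_trans by blast+

lemma rel_left: "rel \<sigma> q r \<Longrightarrow> rel \<sigma> q q"
  and rel_right: "rel \<sigma> q r \<Longrightarrow> rel \<sigma> r r"
  using rel_sym rel_trans by blast+

text \<open>Closure under head expansion. Applying both sides to arguments keeps the redex at the
  head, until \<open>ev_step\<close> absorbs it at type 0.\<close>

lemma rel_step:
  "(\<And>n. step (q n) (q' n)) \<Longrightarrow> rel \<sigma> q' r \<Longrightarrow> rel \<sigma> q r"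
proof (induction \<sigma> arbitrary: q q' r)
  case Base
  then show ?case by (auto intro: ev_step)
next
  case (Arr \<sigma> \<tau>)
  show ?case unfolding rel.simps
  proof (intro ballI allI impI)
    fix h p s assume h: "h \<in> M" "rel \<sigma> p s"
    have "rel \<tau> (\<lambda>n. q' (h n) \<bullet> p n) (\<lambda>n. r (h n) \<bullet> s n)" using Arr.prems(2) h by simp
    then show "rel \<tau> (\<lambda>n. q (h n) \<bullet> p n) (\<lambda>n. r (h n) \<bullet> s n)"
      by (rule Arr.IH(2)[rotated]) (intro step_Ap Arr.prems)
  qed
qed

lemma rel_step2:
  assumes "\<And>n. step (q n) (q' n)" "\<And>n. step (r n) (r' n)" "rel \<sigma> q' r'"
  shows "rel \<sigma> q r"
  using rel_step[OF assms(1) rel_sym[OF rel_step[OF assms(2) rel_sym[OF assms(3)]]]] .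

abbreviation eqv :: "ftype \<Rightarrow> tm \<Rightarrow> tm \<Rightarrow> bool" where
  "eqv \<sigma> a b \<equiv> rel \<sigma> (\<lambda>_. a) (\<lambda>_. b)"

abbreviation El :: "ftype \<Rightarrow> tm set" where
  "El \<sigma> \<equiv> {a. eqv \<sigma> a a}"

lemma rel_at: "rel \<sigma> q r \<Longrightarrow> eqv \<sigma> (q n) (r n)"
  using rel_reindex[OF _ M_const[of n]] .

lemma rel_const: "eqv \<sigma> a b \<Longrightarrow> rel \<sigma> (\<lambda>_. a) (\<lambda>_. b)" .

text \<open>Equality of two plots needs no uniformity of its own: at type 0 each plot already has a
  presenting function in \<open>M\<close>, and pointwise equality makes these functions
  coincide.\<close>

lemma rel_pointwise:
  "rel \<sigma> q q \<Longrightarrow> rel \<sigma> r r \<Longrightarrow> (\<And>n. eqv \<sigma> (q n) (r n)) \<Longrightarrow> rel \<sigma> q r"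
proof (induction \<sigma> arbitrary: q r)
  case Base
  then obtain g g' where *: "g \<in> M" "\<And>n. ev (q n) (g n)" "\<And>n. ev (r n) (g' n)" by auto
  moreover have "g n = g' n" for n using Base(3)[of n] *(2,3)[of n] ev_det unfolding rel.simps by metis
  ultimately show ?case unfolding rel.simps by metis
next
  case (Arr \<sigma> \<tau>)
  show ?case unfolding rel.simps
  proof (intro ballI allI impI)
    fix h p s assume h: "h \<in> M" and p: "rel \<sigma> p s"
    show "rel \<tau> (\<lambda>n. q (h n) \<bullet> p n) (\<lambda>n. r (h n) \<bullet> s n)"
    proof (rule Arr.IH(2))
      show "rel \<tau> (\<lambda>n. q (h n) \<bullet> p n) (\<lambda>n. q (h n) \<bullet> p n)"
        using Arr.prems(1) h rel_left[OF p] by simp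
      show "rel \<tau> (\<lambda>n. r (h n) \<bullet> s n) (\<lambda>n. r (h n) \<bullet> s n)"
        using Arr.prems(2) h rel_right[OF p] by simp
      show "eqv \<tau> (q (h n) \<bullet> p n) (r (h n) \<bullet> s n)" for n
        using rel_ApD[OF Arr.prems(3)[of "h n"] rel_at[OF p, of n]] .
    qed
  qed
qed

text \<open>Testing on single elements suffices, although \<open>rel\<close> at arrow types
  quantifies over plots. This is what lets the formula \<open>eq_at\<close> express
  \<open>eqv\<close>.\<close>

lemma eqv_extensional:
  assumes "a \<in> El (\<sigma> \<Rrightarrow> \<tau>)" "b \<in> El (\<sigma> \<Rrightarrow> \<tau>)" "\<And>d. d \<in> El \<sigma> \<Longrightarrow> eqv \<tau> (a \<bullet> d) (b \<bullet> d)"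
  shows "eqv (\<sigma> \<Rrightarrow> \<tau>) a b"
  unfolding rel.simps
proof (intro ballI allI impI)
  fix h p s assume h: "h \<in> M" and p: "rel \<sigma> p s"
  show "rel \<tau> (\<lambda>n. a \<bullet> p n) (\<lambda>n. b \<bullet> s n)"
  proof (rule rel_pointwise)
    show "rel \<tau> (\<lambda>n. a \<bullet> p n) (\<lambda>n. a \<bullet> p n)" using rel_ApD assms(1) rel_left[OF p] by fast
    show "rel \<tau> (\<lambda>n. b \<bullet> s n) (\<lambda>n. b \<bullet> s n)" using rel_ApD assms(2) rel_right[OF p] by fast
    fix n
    have "eqv \<tau> (a \<bullet> p n) (b \<bullet> p n)" using assms(3) rel_at[OF rel_left[OF p]] by simp
    moreover have "eqv \<tau> (b \<bullet> p n) (b \<bullet> s n)" using assms(2) rel_ApD rel_at[OF p] by fast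
    ultimately show "eqv \<tau> (a \<bullet> p n) (b \<bullet> s n)" by (rule rel_trans)
  qed
qed

section \<open>The constants as elements of the type structure\<close>

lemma rel_KK: "eqv (\<sigma> \<Rrightarrow> \<tau> \<Rrightarrow> \<sigma>) KK KK"
  unfolding rel.simps
proof (intro ballI allI impI)
  fix h h' p p' q q' assume *: "h \<in> M" "h' \<in> M" "rel \<sigma> p p'" "rel \<tau> q q'"
  show "rel \<sigma> (\<lambda>n. KK \<bullet> p (h' n) \<bullet> q n) (\<lambda>n. KK \<bullet> p' (h' n) \<bullet> q' n)"
    by (rule rel_step2[OF step_K step_K rel_reindex]) fact+
qed

lemma rel_SS: "eqv ((\<rho> \<Rrightarrow> \<sigma> \<Rrightarrow> \<tau>) \<Rrightarrow> (\<rho> \<Rrightarrow> \<sigma>) \<Rrightarrow> \<rho> \<Rrightarrow> \<tau>) SS SS"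
proof -
  have "rel \<tau> (\<lambda>n. SS \<bullet> a (h (k n)) \<bullet> b (k n) \<bullet> c n) (\<lambda>n. SS \<bullet> a' (h (k n)) \<bullet> b' (k n) \<bullet> c' n)"
    if "h \<in> M" "k \<in> M" "rel (\<rho> \<Rrightarrow> \<sigma> \<Rrightarrow> \<tau>) a a'" "rel (\<rho> \<Rrightarrow> \<sigma>) b b'" "rel \<rho> c c'" for h k a a' b b' c c'
  proof -
    have 1: "rel (\<sigma> \<Rrightarrow> \<tau>) (\<lambda>n. a (h (k n)) \<bullet> c n) (\<lambda>n. a' (h (k n)) \<bullet> c' n)"
      using rel_ApD[OF rel_reindex[OF that(3) M_comp[OF that(1,2)]] that(5)] .
    have 2: "rel \<sigma> (\<lambda>n. b (k n) \<bullet> c n) (\<lambda>n. b' (k n) \<bullet> c' n)"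
      using rel_ApD[OF rel_reindex[OF that(4,2)] that(5)] .
    show ?thesis using rel_step2[OF step_S step_S rel_ApD[OF 1 2]] .
  qed
  then show ?thesis unfolding rel.simps(2)[of "\<rho> \<Rrightarrow> \<sigma> \<Rrightarrow> \<tau>"] rel.simps(2)[of "\<rho> \<Rrightarrow> \<sigma>"] rel.simps(2)[of \<rho> \<tau>]
    by (auto simp del: rel.simps)
qed

lemma rel_Num: "g \<in> M \<Longrightarrow> rel Base (\<lambda>n. Num (g n)) (\<lambda>n. Num (g n))"
  by (auto intro: ev_Num)

lemma eqv_Base: "eqv Base a b \<longleftrightarrow> (\<exists>n. ev a n \<and> ev b n)"
  using M_const by force

declare rel.simps [simp del]

text \<open>Feeding the numeral \<open>p2 z\<close> to the entry with index \<open>p1 z\<close>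
  gives a plot of type 0, whose presenting function records the whole sequence of functions at once.
  Extensionality extends this from numerals to all terms with the same value.\<close>

lemma rel_type1: 
  assumes "rel type1 q r"
  obtains g where "g \<in> M" "\<And>n m t. ev t m \<Longrightarrow> ev (q n \<bullet> t) (g (pe n m)) \<and> ev (r n \<bullet> t) (g (pe n m))"
proof -
  have "rel Base (\<lambda>z. q (p1 z) \<bullet> Num (p2 z)) (\<lambda>z. r (p1 z) \<bullet> Num (p2 z))"
    using assms[unfolded rel.simps(2)[of Base Base], rule_format, OF M_fst rel_Num[OF M_snd]] .
  then obtain g where g: "g \<in> M" "\<And>z. ev (q (p1 z) \<bullet> Num (p2 z)) (g z) \<and> ev (r (p1 z) \<bullet> Num (p2 z)) (g z)"
    unfolding rel.simps by blast
  have "ev (q n \<bullet> t) (g (pe n m)) \<and> ev (r n \<bullet> t) (g (pe n m))" if "ev t m" for n m t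
  proof -
    have "eqv Base (q n \<bullet> t) (r n \<bullet> Num m)" "eqv Base (q n \<bullet> Num m) (r n \<bullet> t)"
      by (intro rel_ApD[OF rel_at[OF assms, of n]]; use that in \<open>auto simp: eqv_Base intro: ev_Num\<close>)+
    then show ?thesis using g(2)[of "pe n m"] ev_det unfolding eqv_Base by (metis fst_conv prod_encode_inverse snd_conv)
  qed
  with g(1) show ?thesis using that by blast
qed

lemma rel_Fn: "f \<in> M \<Longrightarrow> eqv type1 (Fn f) (Fn f)"
  unfolding rel.simps
proof (intro ballI allI impI)
  fix h p s assume f: "f \<in> M" and "\<exists>g\<in>M. \<forall>n. ev (p n) (g n) \<and> ev (s n) (g n)"
  then obtain g where "g \<in> M" "\<And>n. ev (p n) (g n) \<and> ev (s n) (g n)" by blast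
  with f show "\<exists>g\<in>M. \<forall>n. ev (Fn f \<bullet> p n) (g n) \<and> ev (Fn f \<bullet> s n) (g n)"
    by (intro bexI[of _ "\<lambda>n. f (g n)"]) (auto intro: ev_Fn M_comp)
qed

text \<open>By \<open>rel_type1\<close> a plot of type 1 is the sequence of rows of some
  \<open>g\<close> in \<open>M\<close>, which is the situation covered by
  \<open>closed2\<close>.\<close>

lemma rel_Fun2:
  assumes "closed2 F"
  shows "eqv type2 (Fun2 F) (Fun2 F)"
proof -
  have "rel Base (\<lambda>n. Fun2 F \<bullet> q n) (\<lambda>n. Fun2 F \<bullet> r n)" if "rel type1 q r" for q r
  proof -
    from rel_type1[OF that] obtain g where g: "g \<in> M"
      "\<And>n m t. ev t m \<Longrightarrow> ev (q n \<bullet> t) (g (pe n m)) \<and> ev (r n \<bullet> t) (g (pe n m))" by blast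
    then have "ev (Fun2 F \<bullet> q n) (F (\<lambda>m. g (pe n m)))" "ev (Fun2 F \<bullet> r n) (F (\<lambda>m. g (pe n m)))" for n
      by (auto intro!: ev_Fun2 ev_Num)
    moreover have "(\<lambda>n. F (\<lambda>m. g (pe n m))) \<in> M" using assms g(1) unfolding closed2_def by blast
    ultimately show ?thesis unfolding rel.simps(1)
      by (intro bexI[of _ "\<lambda>n. F (\<lambda>m. g (pe n m))"]) auto
  qed
  then show ?thesis unfolding rel.simps(2)[of type1] by blast
qed

lemma ev_RR:
  assumes "ev a m0" "\<And>s k r. ev s r \<Longrightarrow> ev (g \<bullet> s \<bullet> Num k) (G r k)" "ev t n"
  shows "ev (RR \<bullet> a \<bullet> g \<bullet> t) (rec_nat m0 (\<lambda>k r. G r k) n)"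
  using assms(3)
proof (induction n arbitrary: t rule: nat_induct)
  case 0
  then show ?case using assms(1) by (auto intro: ev_RR_0)
next
  case (Suc n)
  then show ?case using ev_RR_Suc[OF Suc.prems assms(2)[OF Suc.IH[OF ev_Num]]] by simp
qed

text \<open>Along plots the recursor becomes primitive recursion with the index of the plot as a
  parameter, under which \<open>M\<close> is closed.\<close>

lemma rel_RR: "eqv (Base \<Rrightarrow> (Base \<Rrightarrow> Base \<Rrightarrow> Base) \<Rrightarrow> Base \<Rrightarrow> Base) RR RR"
proof -
  let ?\<tau> = "Base \<Rrightarrow> Base \<Rrightarrow> Base"
  have "rel Base (\<lambda>n. RR \<bullet> a n \<bullet> g n \<bullet> t n) (\<lambda>n. RR \<bullet> a' n \<bullet> g' n \<bullet> t' n)"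
    if a: "rel Base a a'" and g: "rel ?\<tau> g g'" and t: "rel Base t t'" for a a' g g' t t'
  proof -
    have "rel Base (\<lambda>z. g (p2 (p2 z)) \<bullet> Num (p1 z) \<bullet> Num (p1 (p2 z))) (\<lambda>z. g' (p2 (p2 z)) \<bullet> Num (p1 z) \<bullet> Num (p1 (p2 z)))"
      by (intro rel_ApD[of Base] rel_Num rel_reindex[OF g, of "\<lambda>z. p2 (p2 z)"] M_fst' M_snd' M_id)
    then obtain G where G: "G \<in> M"
      "\<And>z. ev (g (p2 (p2 z)) \<bullet> Num (p1 z) \<bullet> Num (p1 (p2 z))) (G z)"
      "\<And>z. ev (g' (p2 (p2 z)) \<bullet> Num (p1 z) \<bullet> Num (p1 (p2 z))) (G z)"
      unfolding rel.simps by blast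
    obtain A where A: "A \<in> M" "\<And>n. ev (a n) (A n)" "\<And>n. ev (a' n) (A n)" using a unfolding rel.simps by blast
    obtain T where T: "T \<in> M" "\<And>n. ev (t n) (T n)" "\<And>n. ev (t' n) (T n)" using t unfolding rel.simps by blast
    \<comment> \<open>\<open>G\<close> is obtained from numeral arguments, whereas the recursor
      hands the unevaluated recursive call to the step functional; extensionality bridges the
      two.\<close>
    have cong: "ev (f n \<bullet> s \<bullet> Num k) (G (pe r (pe k n)))"
      if f: "rel ?\<tau> f f" "\<And>z. ev (f (p2 (p2 z)) \<bullet> Num (p1 z) \<bullet> Num (p1 (p2 z))) (G z)" and s: "ev s r" for f n s k r
    proof -
      have "eqv Base s (Num r)" "eqv Base (Num k) (Num k)" using s by (auto simp: eqv_Base intro: ev_Num)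
      then have "eqv Base (f n \<bullet> s \<bullet> Num k) (f n \<bullet> Num r \<bullet> Num k)"
        using rel_ApD[OF rel_ApD[OF rel_at[OF f(1), of n]]] by blast
      moreover have "ev (f n \<bullet> Num r \<bullet> Num k) (G (pe r (pe k n)))" using f(2)[of "pe r (pe k n)"] by simp
      ultimately show ?thesis using ev_det unfolding eqv_Base by metis
    qed
    let ?h = "\<lambda>n. rec_nat (A n) (\<lambda>k r. G (pe r (pe k n))) (T n)"
    have "?h \<in> M" by (intro M_rec' A G T)
    moreover have "ev (RR \<bullet> a n \<bullet> g n \<bullet> t n) (?h n)" for n
      using ev_RR[where G="\<lambda>r k. G (pe r (pe k n))", OF A(2) cong[OF rel_left[OF g] G(2)] T(2)] .
    moreover have "ev (RR \<bullet> a' n \<bullet> g' n \<bullet> t' n) (?h n)" for n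
      using ev_RR[where G="\<lambda>r k. G (pe r (pe k n))", OF A(3) cong[OF rel_right[OF g] G(3)] T(3)] .
    ultimately show ?thesis unfolding rel.simps(1) by (intro bexI[of _ ?h]) auto
  qed
  then have *: "rel Base (\<lambda>n. RR \<bullet> a (h (k n)) \<bullet> g (k n) \<bullet> t n) (\<lambda>n. RR \<bullet> a' (h (k n)) \<bullet> g' (k n) \<bullet> t' n)"
    if "h \<in> M" "k \<in> M" "rel Base a a'" "rel ?\<tau> g g'" "rel Base t t'" for h k a a' g g' t t'
    using that rel_reindex[OF that(3), of "\<lambda>n. h (k n)"] rel_reindex[OF that(4,2)] M_comp[OF that(1,2)] by blast
  show ?thesis unfolding rel.simps(2)[of _ "?\<tau> \<Rrightarrow> type1"] rel.simps(2)[of "?\<tau>"] rel.simps(2)[of _ Base]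
    by (intro ballI allI impI) (rule *)
qed

text \<open>Constant zero functionals show that each \<open>El \<sigma>\<close> is inhabited, so
  that a good environment exists.\<close>

fun dflt :: "ftype \<Rightarrow> tm" where
  "dflt Base = Num 0"
| "dflt (\<sigma> \<Rrightarrow> \<tau>) = KK \<bullet> dflt \<tau>"

lemma dflt_dom: "dflt \<sigma> \<in> El \<sigma>"
proof (induction \<sigma>)
  case Base
  then show ?case using rel_Num[OF M_const] by simp
next
  case (Arr \<sigma> \<tau>)
  then show ?case using rel_ApD[OF rel_KK[of \<tau> \<sigma>]] by simp
qed

end

section \<open>Soundness\<close>

fun den :: "(var \<Rightarrow> tm) \<Rightarrow> trm \<Rightarrow> tm" where
  "den E (Var x) = E x"
| "den E Zero = Num 0"
| "den E Succ = Fn Suc"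
| "den E (CombK _ _) = KK"
| "den E (CombS _ _ _) = SS"
| "den E Rec0 = RR"
| "den E (s \<cdot> t) = den E s \<bullet> den E t"

lemma den_fresh: "(\<And>x. x \<in> fv_trm t \<Longrightarrow> E x = E' x) \<Longrightarrow> den E t = den E' t"
  by (induction t) auto

lemma den_subst: "den E (subst_trm x r t) = den (E(x := den E r)) t"
  by (induction t) auto

lemma fresh_index: "x \<in> fv_trm t \<Longrightarrow> fst x < fresh_index t"
  by (induction t) auto

lemma subst_trm_fresh: "x \<notin> fv_trm t \<Longrightarrow> subst_trm x r t = t"
  by (induction t) auto

lemma subst_fresh: "x \<notin> fv \<phi> \<Longrightarrow> subst x r \<phi> = \<phi>"
  by (induction \<phi>) (auto simp: subst_trm_fresh)

lemma qf_free_for: "qf \<phi> \<Longrightarrow> free_for r x \<phi>"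
  by (induction \<phi>) auto

section \<open>Satisfaction and soundness of the calculus\<close>

context arith_closed
begin

definition good :: "(var \<Rightarrow> tm) \<Rightarrow> bool" where
  "good E \<longleftrightarrow> (\<forall>x. E x \<in> El (snd x))"

fun sat :: "(var \<Rightarrow> tm) \<Rightarrow> fm \<Rightarrow> bool" where
  "sat E (Eq s t) \<longleftrightarrow> (\<exists>n. ev (den E s) n \<and> ev (den E t) n)"
| "sat E Falsum \<longleftrightarrow> False"
| "sat E (Imp \<phi> \<psi>) \<longleftrightarrow> (sat E \<phi> \<longrightarrow> sat E \<psi>)"
| "sat E (Forall x \<phi>) \<longleftrightarrow> (\<forall>d\<in>El (snd x). sat (E(x := d)) \<phi>)"

lemma good_upd: "good E \<Longrightarrow> d \<in> El (snd x) \<Longrightarrow> good (E(x := d))"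
  unfolding good_def by auto

lemma goodD: "good E \<Longrightarrow> eqv (snd x) (E x) (E x)"
  unfolding good_def by blast

lemma goodD': "good E \<Longrightarrow> eqv \<sigma> (E (k, \<sigma>)) (E (k, \<sigma>))"
  using goodD[of E "(k, \<sigma>)"] by simp

lemma good_dflt: "good (\<lambda>x. dflt (snd x))"
  unfolding good_def using dflt_dom by auto

lemma rel_den:
  assumes "\<And>x. rel (snd x) (\<lambda>n. E n x) (\<lambda>n. E' n x)"
  shows "wt t \<Longrightarrow> rel (typ_of t) (\<lambda>n. den (E n) t) (\<lambda>n. den (E' n) t)"
proof (induction t)
  case (App s t)
  then obtain \<tau> where "typ_of s = typ_of t \<Rrightarrow> \<tau>" by auto
  then show ?case using App rel_ApD[of "typ_of t" \<tau>] by auto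
next
  case Zero
  show ?case using rel_Num[OF M_const[of 0]] by simp
next
  case Succ
  show ?case using rel_Fn[OF M_Suc] by simp
next
  case (CombK \<sigma> \<tau>)
  show ?case using rel_KK by simp
next
  case (CombS \<rho> \<sigma> \<tau>)
  show ?case using rel_SS by simp
next
  case Rec0
  show ?case using rel_RR by simp
qed (simp add: assms)

lemma den_El: "good E \<Longrightarrow> wt t \<Longrightarrow> den E t \<in> El (typ_of t)"
  using rel_den[of "\<lambda>_. E" "\<lambda>_. E"] unfolding good_def by auto

lemma sat_fresh: "(\<And>x. x \<in> fv \<phi> \<Longrightarrow> E x = E' x) \<Longrightarrow> sat E \<phi> \<longleftrightarrow> sat E' \<phi>"
proof (induction \<phi> arbitrary: E E')
  case (Eq s t)
  then show ?case using den_fresh[of s E E'] den_fresh[of t E E'] by auto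
next
  case (Imp \<phi> \<psi>)
  then show ?case by (metis UnCI fv.simps(3) sat.simps(3))
next
  case (Forall x \<phi>)
  have "sat (E(x := d)) \<phi> = sat (E'(x := d)) \<phi>" for d
    by (rule Forall.IH) (use Forall.prems in auto)
  then show ?case by simp
qed simp

text \<open>Elements are terms, not classes modulo \<open>eqv\<close>. Invariance of truth permits
  replacing them by canonical representatives such as \<open>Num n\<close> and
  \<open>Fn f\<close>.\<close>

lemma sat_cong:
  "(\<And>x. eqv (snd x) (E x) (E' x)) \<Longrightarrow> wff \<phi> \<Longrightarrow> sat E \<phi> \<longleftrightarrow> sat E' \<phi>"
proof (induction \<phi> arbitrary: E E')
  case (Eq s t)
  have "eqv Base (den E s) (den E' s)" "eqv Base (den E t) (den E' t)"
    using rel_den[of "\<lambda>_. E" "\<lambda>_. E'", OF Eq.prems(1)] Eq.prems(2) by fastforce+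
  then show ?case using ev_det unfolding eqv_Base sat.simps by metis
next
  case (Imp \<phi> \<psi>)
  then show ?case by (metis sat.simps(3) wff.simps(3))
next
  case (Forall x \<phi>)
  have "sat (E(x := d)) \<phi> = sat (E'(x := d)) \<phi>" if "d \<in> El (snd x)" for d
    by (rule Forall.IH) (use Forall.prems that in auto)
  then show ?case by simp
qed simp

lemma sat_upd_cong:
  assumes "good E" "eqv (snd x) d d'" "wff \<phi>"
  shows "sat (E(x := d)) \<phi> \<longleftrightarrow> sat (E(x := d')) \<phi>"
  by (rule sat_cong) (use assms in \<open>auto simp: good_def\<close>)

lemma sat_subst: "free_for r x \<phi> \<Longrightarrow> sat E (subst x r \<phi>) \<longleftrightarrow> sat (E(x := den E r)) \<phi>"
proof (induction \<phi> arbitrary: E)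
  case (Forall y \<phi>)
  show ?case
  proof (cases "x \<in> fv (Forall y \<phi>)")
    case False
    then have "subst x r (Forall y \<phi>) = Forall y \<phi>" by (rule subst_fresh)
    moreover have "sat E (Forall y \<phi>) \<longleftrightarrow> sat (E(x := den E r)) (Forall y \<phi>)"
      by (rule sat_fresh) (use False in auto)
    ultimately show ?thesis by (simp only:)
  next
    case True
    then have y: "y \<noteq> x" "y \<notin> fv_trm r" "free_for r x \<phi>" using Forall.prems by auto
    have den: "den (E(y := d)) r = den E r" for d
      by (rule den_fresh) (use y in auto)
    have "sat E (subst x r (Forall y \<phi>)) \<longleftrightarrow> (\<forall>d\<in>El (snd y). sat (E(y := d)) (subst x r \<phi>))"
      using y(1) by simp
    also have "\<dots> \<longleftrightarrow> (\<forall>d\<in>El (snd y). sat (E(y := d, x := den (E(y := d)) r)) \<phi>)"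
      by (simp only: Forall.IH[OF y(3)])
    also have "\<dots> \<longleftrightarrow> (\<forall>d\<in>El (snd y). sat (E(x := den E r, y := d)) \<phi>)"
      by (simp only: den fun_upd_twist[OF y(1)])
    finally show ?thesis by (simp only: sat.simps)
  qed
qed (auto simp: den_subst)

lemma El_Base_iff: "a \<in> El Base \<longleftrightarrow> (\<exists>n. ev a n)"
  by (auto simp: eqv_Base)

lemma eqv_Num: "ev a n \<Longrightarrow> eqv Base a (Num n)"
  by (auto simp: eqv_Base intro: ev_Num)

lemma Num_El: "Num n \<in> El Base"
  by (auto simp: eqv_Base intro: ev_Num)

lemma Fn_El: "f \<in> M \<Longrightarrow> Fn f \<in> El type1"
  using rel_Fn by simp

text \<open>Together with \<open>Fn_El\<close> this identifies the type-1 part with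
  \<open>M\<close>. The constant plot with value \<open>d\<close> is presented by some
  \<open>g\<close>, whose row 0 is taken.\<close>

lemma type1_repr:
  assumes "d \<in> El type1"
  obtains f where "f \<in> M" "eqv type1 d (Fn f)" "\<And>t m. ev t m \<Longrightarrow> ev (d \<bullet> t) (f m)"
proof -
  have "rel type1 (\<lambda>_. d) (\<lambda>_. d)" using assms by simp
  then have "\<exists>g\<in>M. \<forall>n m t. ev t m \<longrightarrow> ev (d \<bullet> t) (g (pe n m))" by (rule rel_type1) blast
  then obtain g where g: "g \<in> M" "\<And>m t. ev t m \<Longrightarrow> ev (d \<bullet> t) (g (pe 0 m))" by blast
  let ?f = "\<lambda>m. g (pe 0 m)"
  have f: "?f \<in> M" by (intro M_comp[OF g(1)] M_pair M_const M_id)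
  have "eqv type1 d (Fn ?f)"
  proof (rule eqv_extensional[OF assms Fn_El[OF f]])
    fix t assume "t \<in> El Base"
    then obtain m where "ev t m" by (auto simp: eqv_Base)
    then show "eqv Base (d \<bullet> t) (Fn ?f \<bullet> t)" using g(2) ev_Fn[of t m ?f] by (auto simp: eqv_Base)
  qed
  with f g(2) show ?thesis using that by blast
qed

lemma sat_Forall_Base:
  assumes "good E" "wff \<phi>"
  shows "sat E (Forall (k, Base) \<phi>) \<longleftrightarrow> (\<forall>n. sat (E((k, Base) := Num n)) \<phi>)"
proof
  assume "sat E (Forall (k, Base) \<phi>)"
  then show "\<forall>n. sat (E((k, Base) := Num n)) \<phi>" using Num_El by simp
next
  assume *: "\<forall>n. sat (E((k, Base) := Num n)) \<phi>"
  show "sat E (Forall (k, Base) \<phi>)" unfolding sat.simps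
  proof
    fix d assume "d \<in> El (snd (k, Base))"
    then obtain n where "ev d n" by (auto simp: eqv_Base)
    then show "sat (E((k, Base) := d)) \<phi>"
      using * sat_upd_cong[OF assms(1) _ assms(2), of "(k, Base)" d "Num n"] eqv_Num by simp
  qed
qed

lemma sat_Forall_type1:
  assumes "good E" "wff \<phi>"
  shows "sat E (Forall (k, type1) \<phi>) \<longleftrightarrow> (\<forall>f\<in>M. sat (E((k, type1) := Fn f)) \<phi>)"
proof
  assume "sat E (Forall (k, type1) \<phi>)"
  then show "\<forall>f\<in>M. sat (E((k, type1) := Fn f)) \<phi>" using Fn_El by simp
next
  assume *: "\<forall>f\<in>M. sat (E((k, type1) := Fn f)) \<phi>"
  show "sat E (Forall (k, type1) \<phi>)" unfolding sat.simps
  proof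
    fix d assume "d \<in> El (snd (k, type1))"
    then have "d \<in> El type1" by simp
    then obtain f where "f \<in> M" "eqv type1 d (Fn f)" by (rule type1_repr)
    then show "sat (E((k, type1) := d)) \<phi>"
      using * sat_upd_cong[OF assms(1) _ assms(2), of "(k, type1)" d "Fn f"] by simp
  qed
qed

text \<open>The variable introduced by \<open>eq_at\<close> has an index above all those in
  \<open>s\<close> and \<open>t\<close>, so updating it does not change their denotations; the rest
  is extensionality.\<close>

lemma sat_eq_at:
  "good E \<Longrightarrow> wt s \<Longrightarrow> wt t \<Longrightarrow> typ_of s = \<sigma> \<Longrightarrow> typ_of t = \<sigma> \<Longrightarrow>
    sat E (eq_at \<sigma> s t) \<longleftrightarrow> eqv \<sigma> (den E s) (den E t)"
proof (induction \<sigma> arbitrary: s t E)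
  case Base
  then show ?case by (simp add: eqv_Base)
next
  case (Arr \<sigma> \<tau>)
  define x where "x = (max (fresh_index s) (fresh_index t), \<sigma>)"
  have den: "den (E(x := d)) s = den E s" "den (E(x := d)) t = den E t" for d
    by (rule den_fresh; use fresh_index in \<open>force simp: x_def\<close>)+
  have "sat E (eq_at (\<sigma> \<Rrightarrow> \<tau>) s t) \<longleftrightarrow>
      (\<forall>d\<in>El \<sigma>. sat (E(x := d)) (eq_at \<tau> (s \<cdot> Var x) (t \<cdot> Var x)))"
    by (simp add: x_def Let_def)
  also have "\<dots> \<longleftrightarrow> (\<forall>d\<in>El \<sigma>. eqv \<tau> (den E s \<bullet> d) (den E t \<bullet> d))"
  proof (rule ball_cong[OF HOL.refl])
    fix d assume "d \<in> El \<sigma>"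
    then have "good (E(x := d))" using good_upd[OF Arr.prems(1), of d x] by (simp add: x_def)
    then have "sat (E(x := d)) (eq_at \<tau> (s \<cdot> Var x) (t \<cdot> Var x)) \<longleftrightarrow>
        eqv \<tau> (den (E(x := d)) (s \<cdot> Var x)) (den (E(x := d)) (t \<cdot> Var x))"
      by (rule Arr.IH(2)) (use Arr.prems in \<open>auto simp: x_def\<close>)
    then show "sat (E(x := d)) (eq_at \<tau> (s \<cdot> Var x) (t \<cdot> Var x)) \<longleftrightarrow> eqv \<tau> (den E s \<bullet> d) (den E t \<bullet> d)"
      by (simp add: den)
  qed
  also have "\<dots> \<longleftrightarrow> eqv (\<sigma> \<Rrightarrow> \<tau>) (den E s) (den E t)"
  proof
    assume *: "\<forall>d\<in>El \<sigma>. eqv \<tau> (den E s \<bullet> d) (den E t \<bullet> d)"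
    show "eqv (\<sigma> \<Rrightarrow> \<tau>) (den E s) (den E t)"
      by (rule eqv_extensional) (use * den_El[OF Arr.prems(1)] Arr.prems in fastforce)+
  next
    assume "eqv (\<sigma> \<Rrightarrow> \<tau>) (den E s) (den E t)"
    then show "\<forall>d\<in>El \<sigma>. eqv \<tau> (den E s \<bullet> d) (den E t \<bullet> d)"
      using rel_ApD[of \<sigma> \<tau> "\<lambda>_. den E s" "\<lambda>_. den E t"] by fastforce
  qed
  finally show ?case .
qed

lemma soundness:
  assumes "T \<turnstile> \<phi>" "\<And>\<psi> E. \<psi> \<in> T \<Longrightarrow> good E \<Longrightarrow> sat E \<psi>" "good E"
  shows "sat E \<phi>"
  using assms(1,3)
proof (induction arbitrary: E rule: provable.induct)
  case (axm \<phi>)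
  then show ?case using assms(2) by blast
next
  case (all_inst \<phi> t x)
  then have "den E t \<in> El (snd x)" using den_El by metis
  then show ?case using sat_subst[OF all_inst(4)] by auto
next
  case (all_distrib \<phi> \<psi> x)
  have "sat (E(x := d)) \<phi> \<longleftrightarrow> sat E \<phi>" for d
    by (rule sat_fresh) (use all_distrib in auto)
  then show ?case by auto
next
  case (mp \<phi> \<psi>)
  then show ?case by auto
next
  case (gen \<phi> x)
  then show ?case using good_upd unfolding sat.simps by blast
qed auto

section \<open>Choice, induction and the remaining axioms\<close>

text \<open>A converse to \<open>rel_type1\<close>: the rows of a function in \<open>M\<close> form
  a plot.\<close>

lemma rel_Fn_family:
  assumes "g \<in> M"
  shows "rel type1 (\<lambda>z. Fn (\<lambda>m. g (pe z m))) (\<lambda>z. Fn (\<lambda>m. g (pe z m)))"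
  unfolding rel.simps
proof (intro ballI allI impI)
  fix h p s assume h: "h \<in> M" and "\<exists>g\<in>M. \<forall>n. ev (p n) (g n) \<and> ev (s n) (g n)"
  then obtain k where k: "k \<in> M" "\<And>n. ev (p n) (k n)" "\<And>n. ev (s n) (k n)" by blast
  have "(\<lambda>n. g (pe (h n) (k n))) \<in> M" by (intro M_comp[OF assms] M_pair h k)
  then show "\<exists>k\<in>M. \<forall>n. ev (Fn (\<lambda>m. g (pe (h n) m)) \<bullet> p n) (k n) \<and> ev (Fn (\<lambda>m. g (pe (h n) m)) \<bullet> s n) (k n)"
    by (rule rev_bexI) (intro allI conjI ev_Fn k)
qed

text \<open>When the environment varies along a plot, both sides of an equation are computed by
  functions in \<open>M\<close>. Equality tests and case distinctions then handle all
  quantifier-free formulas.\<close>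

lemma qf_decidable:
  assumes "\<And>x. rel (snd x) (\<lambda>n. E n x) (\<lambda>n. E n x)"
  shows "qf \<phi> \<Longrightarrow> wff \<phi> \<Longrightarrow> (\<lambda>n. if sat (E n) \<phi> then 0 else 1) \<in> M"
proof (induction \<phi>)
  case (Eq s t)
  have "rel Base (\<lambda>n. den (E n) s) (\<lambda>n. den (E n) s)" "rel Base (\<lambda>n. den (E n) t) (\<lambda>n. den (E n) t)"
    using rel_den[of E E, OF assms] Eq.prems by fastforce+
  then obtain f g where fg: "f \<in> M" "g \<in> M" "\<And>n. ev (den (E n) s) (f n)" "\<And>n. ev (den (E n) t) (g n)"
    unfolding rel.simps by blast
  then have "sat (E n) (Eq s t) \<longleftrightarrow> f n = g n" for n using ev_det by (metis sat.simps(1))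
  then show ?case using M_if_eq[OF fg(1,2) M_const[of 0] M_const[of 1]] by simp
next
  case (Imp \<phi> \<psi>)
  then have "(\<lambda>n. if sat (E n) \<phi> then 0 else 1) \<in> M" "(\<lambda>n. if sat (E n) \<psi> then 0 else 1) \<in> M" by auto
  from M_if_zero[OF this M_const[of 0]] have
    "(\<lambda>n. if sat (E n) \<phi> then if sat (E n) \<psi> then 0 else 1 else 0) \<in> M" by (simp cong: if_cong)
  moreover have "(\<lambda>n. if sat (E n) \<phi> then if sat (E n) \<psi> then 0 else 1 else 0)
      = (\<lambda>n. if sat (E n) (Imp \<phi> \<psi>) then 0 else 1 :: nat)"
    by (rule HOL.ext) simp
  ultimately show ?case by simp
qed (simp_all add: M_const)

text \<open>The choice functional returns the least witness. Truth of \<open>\<phi>\<close> is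
  decidable in \<open>M\<close> uniformly along rows, so the search for this witness satisfies
  \<open>closed2\<close>.\<close>

lemma sat_qf_choice:
  assumes E: "good E" and \<phi>: "qf \<phi>" "wff \<phi>" and types: "snd f = type1" "snd n = Base" "snd F = type2"
    and F: "F \<notin> fv \<phi>"
  shows "sat E (Imp (Forall f (Exists n \<phi>)) (Exists F (Forall f (subst n (Var F \<cdot> Var f) \<phi>))))"
proof -
  have neq: "n \<noteq> f" "F \<noteq> f" "F \<noteq> n" using types by auto
  define P where "P h m \<longleftrightarrow> sat (E(f := Fn h, n := Num m)) \<phi>" for h m
  define G where "G h = mu (\<lambda>m. if P h m then 0 else 1)" for h
  have "closed2 G" unfolding closed2_def
  proof
    fix g assume g: "g \<in> M"
    \<comment> \<open>The index \<open>z\<close> codes a row of \<open>g\<close> as the value of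
      \<open>f\<close> together with a candidate for \<open>n\<close>, so that \<open>M_mu\<close>
      can search through the candidates.\<close>
    let ?E = "\<lambda>z. E(f := Fn (\<lambda>m. g (pe (p1 z) m)), n := Num (p2 z))"
    have "rel type1 (\<lambda>z. Fn (\<lambda>m. g (pe (p1 z) m))) (\<lambda>z. Fn (\<lambda>m. g (pe (p1 z) m)))"
      using rel_reindex[OF rel_Fn_family[OF g] M_fst] .
    moreover have "rel (snd x) (\<lambda>z. E x) (\<lambda>z. E x)" for x using goodD[OF E] .
    ultimately have "rel (snd x) (\<lambda>z. ?E z x) (\<lambda>z. ?E z x)" for x
      using rel_Num[OF M_snd] types by (cases "x = n"; cases "x = f"; simp)
    from qf_decidable[of ?E, OF this \<phi>]
    have "(\<lambda>z. if P (\<lambda>m. g (pe (p1 z) m)) (p2 z) then 0 else 1) \<in> M" unfolding P_def .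
    from M_mu[OF this] show "(\<lambda>x. G (\<lambda>m. g (pe x m))) \<in> M" by (simp add: G_def)
  qed
  then have Fun2: "Fun2 G \<in> El type2" using rel_Fun2 by simp
  have "sat (E(F := Fun2 G)) (Forall f (subst n (Var F \<cdot> Var f) \<phi>))"
    if *: "sat E (Forall f (Exists n \<phi>))"
    unfolding sat.simps
  proof
    fix d assume d: "d \<in> El (snd f)"
    then obtain h where h: "h \<in> M" "eqv type1 d (Fn h)" "\<And>t m. ev t m \<Longrightarrow> ev (d \<bullet> t) (h m)"
      using type1_repr[of d] types by auto
    have cong: "sat (E(f := d, n := m)) \<phi> \<longleftrightarrow> P h k" if "ev m k" for m k
      unfolding P_def
      by (rule sat_cong[OF _ \<phi>(2)]) (use E h(2) types eqv_Num[OF that] in \<open>auto simp: good_def\<close>)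
    from * d obtain m where m: "m \<in> El Base" "sat (E(f := d, n := m)) \<phi>" using types by auto
    then obtain k where "ev m k" by (auto simp: eqv_Base)
    with m cong have "P h k" by blast
    then have "P h (G h)" unfolding G_def using mu_zero[of "\<lambda>m. if P h m then 0 else 1" k]
      by (simp split: if_splits)
    moreover have "ev (Fun2 G \<bullet> d) (G h)" by (intro ev_Fun2 h ev_Num)
    ultimately have "sat (E(f := d, n := Fun2 G \<bullet> d)) \<phi>" using cong by blast
    moreover have "sat (E(f := d, n := Fun2 G \<bullet> d)) \<phi> \<longleftrightarrow> sat (E(F := Fun2 G, f := d, n := Fun2 G \<bullet> d)) \<phi>"
      by (rule sat_fresh) (use F in auto)
    ultimately show "sat (E(F := Fun2 G, f := d)) (subst n (Var F \<cdot> Var f) \<phi>)"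
      using sat_subst[OF qf_free_for[OF \<phi>(1)]] neq by simp
  qed
  with Fun2 types show ?thesis by auto
qed

text \<open>Every element of type 0 evaluates to a standard number, so induction on
  \<open>nat\<close> applies. Quantifier-freeness ensures that the two substitutions capture no
  variable.\<close>

lemma sat_induction:
  assumes E: "good E" and \<phi>: "wff \<phi>" "qf \<phi>" "snd x = Base"
  shows "sat E (Imp (subst x Zero \<phi>) (Imp (Forall x (Imp \<phi> (subst x (Succ \<cdot> Var x) \<phi>))) (Forall x \<phi>)))"
proof -
  have *: "sat E (Forall x \<phi>)" if 0: "sat E (subst x Zero \<phi>)"
    and S: "sat E (Forall x (Imp \<phi> (subst x (Succ \<cdot> Var x) \<phi>)))"
  proof -
    have cong: "sat (E(x := d)) \<phi> \<longleftrightarrow> sat (E(x := Num n)) \<phi>" if "ev d n" for d n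
      using sat_upd_cong[OF E _ \<phi>(1), of x d "Num n"] eqv_Num[OF that] \<phi>(3) by simp
    have "sat (E(x := Num n)) \<phi>" for n
    proof (induction n)
      case 0
      show ?case using \<open>sat E (subst x Zero \<phi>)\<close> sat_subst[OF qf_free_for[OF \<phi>(2)]]
        by (simp add: fun_upd_def)
    next
      case (Suc n)
      have "sat (E(x := Num n)) (Imp \<phi> (subst x (Succ \<cdot> Var x) \<phi>))"
        by (rule bspec[OF S[unfolded sat.simps(4)]]) (use Num_El \<phi>(3) in \<open>simp only:\<close>)
      then have "sat (E(x := Num n)) (subst x (Succ \<cdot> Var x) \<phi>)" using Suc unfolding sat.simps by blast
      then have "sat (E(x := Fn Suc \<bullet> Num n)) \<phi>" using sat_subst[OF qf_free_for[OF \<phi>(2)]] by simp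
      then show ?case using cong[OF ev_Fn[OF ev_Num]] by blast
    qed
    then show ?thesis using cong \<phi>(3) by (auto simp: eqv_Base)
  qed
  show ?thesis unfolding sat.simps(3) by (intro impI *)
qed

text \<open>The evaluation rule recurs at \<open>Num k\<close>, the axiom at the term
  \<open>t\<close> with value \<open>k\<close>; the two are related by extensionality of
  \<open>RR\<close> and \<open>g\<close>.\<close>

lemma sat_rec_succ:
  assumes "a \<in> El Base" "g \<in> El (Base \<Rrightarrow> Base \<Rrightarrow> Base)" "t \<in> El Base"
  shows "\<exists>n. ev (RR \<bullet> a \<bullet> g \<bullet> (Fn Suc \<bullet> t)) n \<and> ev (g \<bullet> (RR \<bullet> a \<bullet> g \<bullet> t) \<bullet> t) n"
proof -
  obtain k where k: "ev t k" using assms(3) by (auto simp: eqv_Base)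
  have "eqv (Base \<Rrightarrow> Base) (RR \<bullet> a \<bullet> g) (RR \<bullet> a \<bullet> g)"
    using rel_ApD[OF rel_ApD[OF rel_RR]] assms by blast
  then have "eqv Base (RR \<bullet> a \<bullet> g \<bullet> Num k) (RR \<bullet> a \<bullet> g \<bullet> t)"
    using rel_ApD eqv_Num[OF k] rel_sym by fast
  then have "eqv Base (g \<bullet> (RR \<bullet> a \<bullet> g \<bullet> Num k) \<bullet> Num k) (g \<bullet> (RR \<bullet> a \<bullet> g \<bullet> t) \<bullet> t)"
    using rel_ApD[OF rel_ApD] assms(2) rel_sym[OF eqv_Num[OF k]] by blast
  then show ?thesis unfolding eqv_Base using ev_RR_Suc[OF ev_Fn[OF k, of Suc]] by blast
qed

lemma sat_RCA0w: "\<phi> \<in> RCA0w \<Longrightarrow> good E \<Longrightarrow> sat E \<phi>"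
proof (induction rule: RCA0w.induct)
  case refl
  then have "E (0, Base) \<in> El Base" by (auto simp: good_def)
  then show ?case by (simp add: eqv_Base)
next
  case sym
  then show ?case by auto
next
  case trans
  then show ?case using ev_det by simp metis
next
  case (ext \<rho> \<tau>)
  have "eqv (\<rho> \<Rrightarrow> \<tau>) (E (2, \<rho> \<Rrightarrow> \<tau>)) (E (2, \<rho> \<Rrightarrow> \<tau>))"
    using goodD'[OF ext] .
  then show ?case using rel_ApD by (auto simp: sat_eq_at[OF ext])
next
  case succ_nonzero
  show ?case
  proof -
    have False if "ev (Fn Suc \<bullet> t) 0" "ev t n" for t n
      using ev_det[OF that(1) ev_Fn[OF that(2)]] by simp
    moreover have "\<exists>n. ev (E (0, Base)) n" using succ_nonzero unfolding good_def by (metis El_Base_iff snd_conv)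
    ultimately show ?thesis using ev_det[OF _ ev_Num] by auto
  qed
next
  case succ_inj
  then obtain n m where "ev (E (0, Base)) n" "ev (E (1, Base)) m"
    unfolding good_def El_Base_iff[symmetric] by (metis El_Base_iff snd_conv)
  then show ?case using ev_Fn[of _ n Suc] ev_Fn[of _ m Suc] ev_det by simp (metis nat.inject)
next
  case (comb_K \<sigma> \<tau>)
  have "eqv \<sigma> (E (0, \<sigma>)) (E (0, \<sigma>))" using goodD'[OF comb_K] .
  then show ?case by (simp add: sat_eq_at[OF comb_K] rel_step[OF step_K])
next
  case (comb_S \<tau> \<rho> \<sigma>)
  have "eqv (\<rho> \<Rrightarrow> \<sigma> \<Rrightarrow> \<tau>) (E (0, \<rho> \<Rrightarrow> \<sigma> \<Rrightarrow> \<tau>)) (E (0, \<rho> \<Rrightarrow> \<sigma> \<Rrightarrow> \<tau>))"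
    "eqv (\<rho> \<Rrightarrow> \<sigma>) (E (1, \<rho> \<Rrightarrow> \<sigma>)) (E (1, \<rho> \<Rrightarrow> \<sigma>))" "eqv \<rho> (E (2, \<rho>)) (E (2, \<rho>))"
    using goodD'[OF comb_S] by blast+
  from rel_ApD[OF rel_ApD[OF this(1,3)] rel_ApD[OF this(2,3)]]
  show ?case by (simp add: sat_eq_at[OF comb_S] rel_step[OF step_S])
next
  case rec_zero
  then obtain n where "ev (E (0, Base)) n"
    unfolding good_def by (metis El_Base_iff snd_conv)
  then show ?case using ev_RR_0[OF ev_Num] by auto
next
  case rec_succ
  then show ?case using sat_rec_succ by (simp add: good_def)
next
  case (qf_induction \<phi> x)
  then show ?case using sat_induction by blast
next
  case (qf_choice \<phi> f n F)
  then show ?case using sat_qf_choice by blast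
qed

text \<open>\<open>M_search\<close> decides, uniformly along the rows of any \<open>g\<close> in
  \<open>M\<close>, whether a row has a zero. This is \<open>closed2\<close> for the required
  functional.\<close>

lemma sat_exists2:
  assumes "good E"
  shows "sat E exists2"
proof -
  define F where "F h = (if \<exists>n. h n = 0 then 0 else 1 :: nat)" for h :: "nat \<Rightarrow> nat"
  have "closed2 F" unfolding closed2_def F_def using M_search[OF _ M_const[of 0] M_const[of 1]] by blast
  then have F_El: "Fun2 F \<in> El type2" using rel_Fun2 by simp
  have "ev (Fun2 F \<bullet> d) (F h) \<and> (F h = 0 \<longleftrightarrow> (\<exists>m\<in>El Base. \<exists>n. ev (d \<bullet> m) n \<and> ev (Num 0) n))"
    if h: "\<And>t m. ev t m \<Longrightarrow> ev (d \<bullet> t) (h m)" for d h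
  proof -
    have "(\<exists>m\<in>El Base. \<exists>n. ev (d \<bullet> m) n \<and> ev (Num 0) n) \<longleftrightarrow> (\<exists>m. h m = 0)"
    proof
      assume "\<exists>m\<in>El Base. \<exists>n. ev (d \<bullet> m) n \<and> ev (Num 0) n"
      then obtain m n k where "ev (d \<bullet> m) n" "ev (Num 0) n" "ev m k" by (auto simp: eqv_Base)
      then have "h k = 0" using ev_det[OF h] ev_det[OF ev_Num] by metis
      then show "\<exists>m. h m = 0" ..
    next
      assume "\<exists>m. h m = 0"
      then obtain m where "h m = 0" by blast
      then have "ev (d \<bullet> Num m) 0" using h[OF ev_Num[of m]] by simp
      then show "\<exists>m\<in>El Base. \<exists>n. ev (d \<bullet> m) n \<and> ev (Num 0) n" using Num_El ev_Num by blast
    qed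
    moreover have "F h = 0 \<longleftrightarrow> (\<exists>m. h m = 0)" by (simp add: F_def)
    moreover have "ev (Fun2 F \<bullet> d) (F h)" by (intro ev_Fun2 h ev_Num)
    ultimately show ?thesis by blast
  qed
  note * = this
  have "\<forall>d\<in>El type1. (\<exists>v. ev (Fun2 F \<bullet> d) v \<and> (v = 0 \<or> v = 1) \<and> (v = 0 \<longleftrightarrow> (\<exists>m\<in>El Base. \<exists>n. ev (d \<bullet> m) n \<and> ev (Num 0) n)))"
  proof (intro ballI)
    fix d assume "d \<in> El type1"
    then have "\<exists>h. \<forall>t m. ev t m \<longrightarrow> ev (d \<bullet> t) (h m)" by (rule type1_repr) blast
    then obtain h where h: "\<And>t m. ev t m \<Longrightarrow> ev (d \<bullet> t) (h m)" by blast
    have a: "F h = 0 \<or> F h = 1" by (simp add: F_def)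
    have b: "ev (Fun2 F \<bullet> d) (F h) \<and> (F h = 0 \<longleftrightarrow> (\<exists>m\<in>El Base. \<exists>n. ev (d \<bullet> m) n \<and> ev (Num 0) n))"
      by (rule *) (rule h)
    show "\<exists>v. ev (Fun2 F \<bullet> d) v \<and> (v = 0 \<or> v = 1) \<and> (v = 0 \<longleftrightarrow> (\<exists>m\<in>El Base. \<exists>n. ev (d \<bullet> m) n \<and> ev (Num 0) n))"
      by (intro exI[of _ "F h"] conjI a b[THEN conjunct1] b[THEN conjunct2])
  qed
  note ** = this
  have "ev (Fn Suc \<bullet> Num 0) n \<longleftrightarrow> n = 1" "ev (Num 0) n \<longleftrightarrow> n = 0" for n
    using ev_det ev_Num[of 0] ev_Fn[OF ev_Num, of Suc 0] by auto
  note num = this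
  have "\<forall>d\<in>El type1. ((\<exists>v. ev (Fun2 F \<bullet> d) v \<and> v = 0) \<or> (\<exists>v. ev (Fun2 F \<bullet> d) v \<and> v = 1))
      \<and> ((\<exists>v. ev (Fun2 F \<bullet> d) v \<and> v = 0) \<longleftrightarrow> (\<exists>m\<in>El Base. \<exists>n. ev (d \<bullet> m) n \<and> ev (Num 0) n))"
  proof (intro ballI)
    fix d assume "d \<in> El type1"
    with ** obtain v where v: "ev (Fun2 F \<bullet> d) v" "v = 0 \<or> v = 1"
      "v = 0 \<longleftrightarrow> (\<exists>m\<in>El Base. \<exists>n. ev (d \<bullet> m) n \<and> ev (Num 0) n)" by blast
    have "ev (Fun2 F \<bullet> d) w \<longleftrightarrow> w = v" for w using ev_det[OF v(1)] v(1) by blast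
    with v(2,3) show "((\<exists>v. ev (Fun2 F \<bullet> d) v \<and> v = 0) \<or> (\<exists>v. ev (Fun2 F \<bullet> d) v \<and> v = 1))
      \<and> ((\<exists>v. ev (Fun2 F \<bullet> d) v \<and> v = 0) \<longleftrightarrow> (\<exists>m\<in>El Base. \<exists>n. ev (d \<bullet> m) n \<and> ev (Num 0) n))"
      by simp
  qed
  with F_El show ?thesis
    unfolding exists2_def Let_def sat.simps
    by (simp add: num, intro exI[of _ "Fun2 F"]) auto
qed

end

section \<open>Primitive recursive terms and second-order formulas in the model\<close>

lemma wt_lam: "wt t \<Longrightarrow> wt (lam x t) \<and> typ_of (lam x t) = snd x \<Rrightarrow> typ_of t"
  by (induction t) auto

lemma wt_arith [simp]:
  "wt plusC" "wt timesC" "wt predC" "wt minusC" "wt pow2C"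
  by (simp_all add: plusC_def timesC_def predC_def minusC_def pow2C_def Let_def)

lemma typ_of_arith [simp]:
  "typ_of plusC = Base \<Rrightarrow> Base \<Rrightarrow> Base" "typ_of timesC = Base \<Rrightarrow> Base \<Rrightarrow> Base"
  "typ_of predC = Base \<Rrightarrow> Base" "typ_of minusC = Base \<Rrightarrow> Base \<Rrightarrow> Base" "typ_of pow2C = Base \<Rrightarrow> Base"
  by (simp_all add: plusC_def timesC_def predC_def minusC_def pow2C_def Let_def)

lemma fv_arith [simp]:
  "fv_trm plusC = {}" "fv_trm timesC = {}" "fv_trm predC = {}" "fv_trm minusC = {}" "fv_trm pow2C = {}"
  by (simp_all add: plusC_def timesC_def predC_def minusC_def pow2C_def Let_def)

definition pairq :: "nat \<Rightarrow> nat \<Rightarrow> nat" where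
  "pairq i j = (i + j) * (i + j) + i"

text \<open>With \<open>s = i + j\<close>, the code lies between the square of \<open>s\<close> and
  the square of \<open>Suc s\<close>, the latter excluded. Hence it determines \<open>s\<close>, and
  then \<open>i\<close>.\<close>

lemma pairq_inj [simp]: "pairq i j = pairq i' j' \<longleftrightarrow> i = i' \<and> j = j'"
proof
  assume eq: "pairq i j = pairq i' j'"
  have lt: "(a + b) * (a + b) + a < (c + d) * (c + d) + c" if "a + b < c + d" for a b c d :: nat
  proof -
    have "(a + b) * (a + b) + a < Suc (a + b) * Suc (a + b)" by simp
    also have "\<dots> \<le> (c + d) * (c + d)" using that by (intro mult_le_mono) auto
    finally show ?thesis by simp
  qed
  have "i + j = i' + j'"
    using lt[of i j i' j'] lt[of i' j' i j] eq unfolding pairq_def by (metis less_irrefl linorder_neqE_nat)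
  with eq show "i = i' \<and> j = j'" unfolding pairq_def by auto
qed simp

fun tv2 :: "(nat \<Rightarrow> nat) \<Rightarrow> trm2 \<Rightarrow> nat" where
  "tv2 \<nu> (NVar n) = \<nu> n"
| "tv2 \<nu> Zero2 = 0"
| "tv2 \<nu> One2 = 1"
| "tv2 \<nu> (Plus2 s t) = tv2 \<nu> s + tv2 \<nu> t"
| "tv2 \<nu> (Times2 s t) = tv2 \<nu> s * tv2 \<nu> t"

text \<open>Truth in the omega-model with set part \<open>S\<close>: numbers are standard and set
  quantifiers range over \<open>S\<close>.\<close>

fun sat2 :: "nat set set \<Rightarrow> (nat \<Rightarrow> nat) \<Rightarrow> (nat \<Rightarrow> nat set) \<Rightarrow> fm2 \<Rightarrow> bool" where
  "sat2 S \<nu> \<sigma> (Eq2 s t) \<longleftrightarrow> tv2 \<nu> s = tv2 \<nu> t"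
| "sat2 S \<nu> \<sigma> (Less2 s t) \<longleftrightarrow> tv2 \<nu> s < tv2 \<nu> t"
| "sat2 S \<nu> \<sigma> (Mem2 t X) \<longleftrightarrow> tv2 \<nu> t \<in> \<sigma> X"
| "sat2 S \<nu> \<sigma> Falsum2 \<longleftrightarrow> False"
| "sat2 S \<nu> \<sigma> (Imp2 \<phi> \<psi>) \<longleftrightarrow> (sat2 S \<nu> \<sigma> \<phi> \<longrightarrow> sat2 S \<nu> \<sigma> \<psi>)"
| "sat2 S \<nu> \<sigma> (AllN n \<phi>) \<longleftrightarrow> (\<forall>k. sat2 S (\<nu>(n := k)) \<sigma> \<phi>)"
| "sat2 S \<nu> \<sigma> (AllS X \<phi>) \<longleftrightarrow> (\<forall>A\<in>S. sat2 S \<nu> (\<sigma>(X := A)) \<phi>)"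

abbreviation chi :: "nat set \<Rightarrow> nat \<Rightarrow> nat" where
  "chi A n \<equiv> if n \<in> A then 1 else 0"

section \<open>Bracket abstraction and the values of the arithmetical terms\<close>

context arith_closed
begin

lemma sat_Eq_ev: "ev (den E s) a \<Longrightarrow> ev (den E t) b \<Longrightarrow> sat E (Eq s t) \<longleftrightarrow> a = b"
  using ev_det unfolding sat.simps by blast

text \<open>The beta law holds up to \<open>eqv\<close> and not as a reduction, since head reduction
  does not reach the argument copies that \<open>SS\<close> creates.\<close>

lemma eqv_lam:
  assumes "good E" "d \<in> El (snd x)"
  shows "wt t \<Longrightarrow> eqv (typ_of t) (den E (lam x t) \<bullet> d) (den (E(x := d)) t)"
proof (induction t)
  case (App s t)
  show ?case
  proof (cases "x \<in> fv_trm (s \<cdot> t)")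
    case False
    have "den E (s \<cdot> t) = den (E(x := d)) (s \<cdot> t)"
      by (rule den_fresh) (use False in auto)
    moreover have "eqv (typ_of (s \<cdot> t)) (den E (s \<cdot> t)) (den E (s \<cdot> t))"
      using den_El[OF assms(1) App.prems] by simp
    ultimately show ?thesis using False rel_step[OF step_K] by (simp add: fun_upd_def)
  next
    case True
    obtain \<tau> where \<tau>: "typ_of s = typ_of t \<Rrightarrow> \<tau>" using App.prems by auto
    have "eqv (typ_of t \<Rrightarrow> \<tau>) (den E (lam x s) \<bullet> d) (den (E(x := d)) s)"
      "eqv (typ_of t) (den E (lam x t) \<bullet> d) (den (E(x := d)) t)"
      using App \<tau> by (auto simp: fun_upd_def)
    from rel_ApD[OF this] show ?thesis using True \<tau> rel_step[OF step_S]
      by (simp add: fun_upd_def)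
  qed
next
  case (Var y)
  show ?case
  proof (cases "y = x")
    case True
    have "eqv (snd x) (SS \<bullet> KK \<bullet> KK \<bullet> d) d"
      by (rule rel_step[OF step_S], rule rel_step[OF step_K]) (use assms(2) in simp)
    then show ?thesis using True by simp
  next
    case False
    then show ?thesis using goodD[OF assms(1), of y] rel_step[OF step_K] by simp
  qed
next
  case Zero
  show ?case using rel_step[OF step_K] Num_El by simp
next
  case Succ
  show ?case using rel_step[OF step_K] rel_Fn[OF M_Suc] by simp
next
  case (CombK \<sigma> \<tau>)
  show ?case using rel_step[OF step_K] rel_KK by simp
next
  case (CombS \<rho> \<sigma> \<tau>)
  show ?case using rel_step[OF step_K] rel_SS by simp
next
  case Rec0
  show ?case using rel_step[OF step_K] rel_RR by simp
qed

lemma ev_lam: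
  assumes "good E" "d \<in> El (snd x)" "wt t" "typ_of t = Base" "ev (den (E(x := d)) t) n"
  shows "ev (den E (lam x t) \<bullet> d) n"
  using eqv_lam[OF assms(1-3)] assms(4,5) ev_det by (fastforce simp: eqv_Base)

lemma ev_lam2:
  assumes "good E" "d \<in> El (snd x)" "e \<in> El (snd y)" "wt t" "typ_of t = Base"
    and "ev (den (E(x := d, y := e)) t) n"
  shows "ev (den E (lam x (lam y t)) \<bullet> d \<bullet> e) n"
proof -
  have "eqv (snd y \<Rrightarrow> Base) (den E (lam x (lam y t)) \<bullet> d) (den (E(x := d)) (lam y t))"
    using eqv_lam[OF assms(1,2), of "lam y t"] wt_lam[OF assms(4), of y] assms(5) by simp
  from rel_ApD[OF this rel_const[of "snd y" e e]]
  have "eqv Base (den E (lam x (lam y t)) \<bullet> d \<bullet> e) (den (E(x := d)) (lam y t) \<bullet> e)"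
    using assms(3) by simp
  moreover have "ev (den (E(x := d)) (lam y t) \<bullet> e) n"
    by (rule ev_lam[OF good_upd[OF assms(1,2)] assms(3-6)])
  ultimately show ?thesis using ev_det by (fastforce simp: eqv_Base)
qed

lemma ev_El: "ev a n \<Longrightarrow> a \<in> El Base"
  by (auto simp: eqv_Base)

lemma good_updB: "good E \<Longrightarrow> ev a n \<Longrightarrow> good (E((k, Base) := a))"
  using good_upd[of E a "(k, Base)"] ev_El by simp

lemma ev_plus:
  assumes "good E" "ev a n" "ev b m"
  shows "ev (den E plusC \<bullet> a \<bullet> b) (n + m)"
proof -
  let ?E = "E((0, Base) := a, (1, Base) := b)"
  let ?g = "den ?E (lam (2, Base) (lam (3, Base) (Succ \<cdot> Var (2, Base))))"
  have E: "good ?E" using good_updB[OF good_updB[OF assms(1,2)] assms(3)] .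
  have "ev (RR \<bullet> a \<bullet> ?g \<bullet> b) (rec_nat n (\<lambda>k r. Suc r) m)"
  proof (rule ev_RR[OF assms(2) _ assms(3)])
    fix s k r assume s: "ev s r"
    show "ev (?g \<bullet> s \<bullet> Num k) (Suc r)"
      by (rule ev_lam2[OF E]) (use ev_El[OF s] Num_El[of k] ev_Fn[OF s, of Suc] in simp_all)
  qed
  moreover have "rec_nat n (\<lambda>k r. Suc r) m = n + m" by (induction m) auto
  ultimately show ?thesis unfolding plusC_def Let_def
    by (intro ev_lam2 assms) (use ev_El[OF assms(2)] ev_El[OF assms(3)] in \<open>simp_all add: wt_lam\<close>)
qed

lemma ev_times:
  assumes "good E" "ev a n" "ev b m"
  shows "ev (den E timesC \<bullet> a \<bullet> b) (n * m)"
proof -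
  let ?E = "E((0, Base) := a, (1, Base) := b)"
  let ?g = "den ?E (lam (2, Base) (lam (3, Base) (plusC \<cdot> Var (2, Base) \<cdot> Var (0, Base))))"
  have E: "good ?E" using good_updB[OF good_updB[OF assms(1,2)] assms(3)] .
  have "ev (RR \<bullet> Num 0 \<bullet> ?g \<bullet> b) (rec_nat 0 (\<lambda>k r. r + n) m)"
  proof (rule ev_RR[OF ev_Num _ assms(3)])
    fix s k r assume s: "ev s r"
    have "good (?E((2, Base) := s, (3, Base) := Num k))" by (intro good_updB[OF good_updB[OF E s] ev_Num])
    from ev_plus[OF this s assms(2)]
    show "ev (?g \<bullet> s \<bullet> Num k) (r + n)"
      by (intro ev_lam2[OF E]) (use ev_El[OF s] Num_El[of k] in simp_all)
  qed
  moreover have "rec_nat 0 (\<lambda>k r. r + n) m = n * m" by (induction m) auto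
  ultimately show ?thesis unfolding timesC_def Let_def
    by (intro ev_lam2 assms) (use ev_El[OF assms(2)] ev_El[OF assms(3)] in \<open>simp_all add: wt_lam\<close>)
qed

lemma ev_pred:
  assumes "good E" "ev b m"
  shows "ev (den E predC \<bullet> b) (m - 1)"
proof -
  let ?E = "E((1, Base) := b)"
  let ?g = "den ?E (lam (2, Base) (lam (3, Base) (Var (3, Base))))"
  have E: "good ?E" using good_updB[OF assms] .
  have "ev (RR \<bullet> Num 0 \<bullet> ?g \<bullet> b) (rec_nat 0 (\<lambda>k r. k) m)"
  proof (rule ev_RR[OF ev_Num _ assms(2)])
    fix s k r assume s: "ev s r"
    show "ev (?g \<bullet> s \<bullet> Num k) k"
      by (rule ev_lam2[OF E]) (use ev_El[OF s] Num_El[of k] ev_Num[of k] in simp_all)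
  qed
  moreover have "rec_nat 0 (\<lambda>k r. k) m = m - 1" by (cases m) auto
  ultimately show ?thesis unfolding predC_def Let_def
    by (intro ev_lam assms) (use ev_El[OF assms(2)] in \<open>simp_all add: wt_lam\<close>)
qed

lemma ev_minus:
  assumes "good E" "ev a n" "ev b m"
  shows "ev (den E minusC \<bullet> a \<bullet> b) (n - m)"
proof -
  let ?E = "E((0, Base) := a, (1, Base) := b)"
  let ?g = "den ?E (lam (2, Base) (lam (3, Base) (predC \<cdot> Var (2, Base))))"
  have E: "good ?E" using good_updB[OF good_updB[OF assms(1,2)] assms(3)] .
  have "ev (RR \<bullet> a \<bullet> ?g \<bullet> b) (rec_nat n (\<lambda>k r. r - 1) m)"
  proof (rule ev_RR[OF assms(2) _ assms(3)])
    fix s k r assume s: "ev s r"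
    have "good (?E((2, Base) := s, (3, Base) := Num k))" by (intro good_updB[OF good_updB[OF E s] ev_Num])
    from ev_pred[OF this s]
    show "ev (?g \<bullet> s \<bullet> Num k) (r - 1)"
      by (intro ev_lam2[OF E]) (use ev_El[OF s] Num_El[of k] in simp_all)
  qed
  moreover have "rec_nat n (\<lambda>k r. r - 1) m = n - m" by (induction m) auto
  ultimately show ?thesis unfolding minusC_def Let_def
    by (intro ev_lam2 assms) (use ev_El[OF assms(2)] ev_El[OF assms(3)] in \<open>simp_all add: wt_lam\<close>)
qed

lemma ev_pow2:
  assumes "good E" "ev b m"
  shows "ev (den E pow2C \<bullet> b) (2 ^ m)"
proof -
  let ?E = "E((1, Base) := b)"
  let ?g = "den ?E (lam (2, Base) (lam (3, Base) (plusC \<cdot> Var (2, Base) \<cdot> Var (2, Base))))"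
  have E: "good ?E" using good_updB[OF assms] .
  have "ev (RR \<bullet> (Fn Suc \<bullet> Num 0) \<bullet> ?g \<bullet> b) (rec_nat (Suc 0) (\<lambda>k r. r + r) m)"
  proof (rule ev_RR[OF ev_Fn[OF ev_Num] _ assms(2)])
    fix s k r assume s: "ev s r"
    have "good (?E((2, Base) := s, (3, Base) := Num k))" by (intro good_updB[OF good_updB[OF E s] ev_Num])
    from ev_plus[OF this s s]
    show "ev (?g \<bullet> s \<bullet> Num k) (r + r)"
      by (intro ev_lam2[OF E]) (use ev_El[OF s] Num_El[of k] in simp_all)
  qed
  moreover have "rec_nat (Suc 0) (\<lambda>k r. r + r) m = 2 ^ m" by (induction m) auto
  ultimately show ?thesis unfolding pow2C_def Let_def
    by (intro ev_lam assms) (use ev_El[OF assms(2)] in \<open>simp_all add: wt_lam\<close>)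
qed

section \<open>Truth of translated second-order formulas\<close>

definition sets :: "nat set set" where
  "sets = {A. chi A \<in> M}"

lemma ev_tr_trm:
  assumes "good E" "\<And>n. ev (E (n, Base)) (\<nu> n)"
  shows "ev (den E (tr_trm t)) (tv2 \<nu> t)"
proof (induction t)
  case One2
  show ?case using ev_Fn[OF ev_Num[of 0], of Suc] by simp
qed (simp_all add: assms(2) ev_Num ev_plus[OF assms(1)] ev_times[OF assms(1)])

text \<open>The type-1 elements passing \<open>is_set\<close> are exactly those with values 0 and 1
  only, that is, the characteristic functions in \<open>M\<close>. So the type structure induces the
  omega-model with set part \<open>sets\<close>.\<close>

lemma sat_tr:
  assumes "good E" "\<And>n. ev (E (n, Base)) (\<nu> n)"
    and "\<And>X t m. ev t m \<Longrightarrow> ev (E (X, type1) \<bullet> t) (chi (\<sigma> X) m)"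
  shows "sat E (tr \<phi>) \<longleftrightarrow> sat2 sets \<nu> \<sigma> \<phi>"
  using assms
proof (induction \<phi> arbitrary: E \<nu> \<sigma>)
  case (Eq2 s t)
  then show ?case
    using sat_Eq_ev[OF ev_tr_trm[OF Eq2(1,2)] ev_tr_trm[OF Eq2(1,2)], of s t] by simp
next
  case (Less2 s t)
  have 1: "ev (den E (minus_trm (Succ \<cdot> tr_trm s) (tr_trm t))) (Suc (tv2 \<nu> s) - tv2 \<nu> t)"
    using ev_minus[OF Less2(1) ev_Fn] ev_tr_trm[OF Less2(1,2)] by simp
  have "sat E (tr (Less2 s t)) \<longleftrightarrow> Suc (tv2 \<nu> s) - tv2 \<nu> t = 0"
    unfolding tr.simps Less_def Le_def by (rule sat_Eq_ev[OF 1]) (simp add: ev_Num)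
  then show ?case by auto
next
  case (Mem2 t X)
  have 1: "ev (E (X, type1) \<bullet> den E (tr_trm t)) (chi (\<sigma> X) (tv2 \<nu> t))"
    by (rule Mem2(3)) (rule ev_tr_trm[OF Mem2(1,2)])
  have "sat E (tr (Mem2 t X)) \<longleftrightarrow> chi (\<sigma> X) (tv2 \<nu> t) = Suc 0"
    unfolding tr.simps by (rule sat_Eq_ev) (use 1 ev_Fn[OF ev_Num[of 0], of Suc] in simp_all)
  then show ?case by simp
next
  case (Imp2 \<phi> \<psi>)
  have "sat E (tr \<phi>) \<longleftrightarrow> sat2 sets \<nu> \<sigma> \<phi>" "sat E (tr \<psi>) \<longleftrightarrow> sat2 sets \<nu> \<sigma> \<psi>"
    by (rule Imp2.IH; fact Imp2.prems)+
  then show ?case by simp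
next
  case (AllN n \<phi>)
  have IH: "sat (E((n, Base) := d)) (tr \<phi>) \<longleftrightarrow> sat2 sets (\<nu>(n := k)) \<sigma> \<phi>" if "ev d k" for d k
    by (rule AllN.IH[OF good_updB[OF AllN.prems(1) that]]) (use AllN.prems that in auto)
  show ?case
  proof
    assume "sat E (tr (AllN n \<phi>))"
    then show "sat2 sets \<nu> \<sigma> (AllN n \<phi>)" using IH[OF ev_Num] Num_El by simp
  next
    assume *: "sat2 sets \<nu> \<sigma> (AllN n \<phi>)"
    show "sat E (tr (AllN n \<phi>))" unfolding tr.simps sat.simps
    proof
      fix d assume "d \<in> El (snd (n, Base))"
      then obtain k where "ev d k" by (auto simp: eqv_Base)
      then show "sat (E((n, Base) := d)) (tr \<phi>)" using IH * by simp
    qed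
  qed
next
  case (AllS X \<phi>)
  have IH: "sat (E((X, type1) := d)) (tr \<phi>) \<longleftrightarrow> sat2 sets \<nu> (\<sigma>(X := A)) \<phi>"
    if d: "d \<in> El type1" "\<And>t m. ev t m \<Longrightarrow> ev (d \<bullet> t) (chi A m)" for d A
  proof (rule AllS.IH)
    show "good (E((X, type1) := d))"
      by (rule good_upd[OF AllS.prems(1)]) (use d(1) in simp)
    show "ev ((E((X, type1) := d)) (n, Base)) (\<nu> n)" for n
      using AllS.prems(2) by simp
    show "ev ((E((X, type1) := d)) (Y, type1) \<bullet> t) (chi ((\<sigma>(X := A)) Y) m)" if "ev t m" for Y t m
      using d(2)[OF that] AllS.prems(3)[OF that, of Y] by (cases "Y = X") simp_all
  qed
  have is_set: "sat (E((X, type1) := d)) (is_set X) \<longleftrightarrow> (\<forall>m. f m = 0 \<or> f m = 1)"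
    if "\<And>t m. ev t m \<Longrightarrow> ev (d \<bullet> t) (f m)" for d f
  proof -
    have one: "ev (Fn Suc \<bullet> Num 0) 1" using ev_Fn[OF ev_Num[of 0], of Suc] by simp
    have "(\<exists>n. ev (d \<bullet> t) n \<and> ev (Num 0) n) \<longleftrightarrow> f m = 0"
      "(\<exists>n. ev (d \<bullet> t) n \<and> ev (Fn Suc \<bullet> Num 0) n) \<longleftrightarrow> f m = 1" if "ev t m" for t m
      using \<open>\<And>t m. ev t m \<Longrightarrow> ev (d \<bullet> t) (f m)\<close>[OF that] ev_det ev_Num[of 0] one by metis+
    note * = this
    have "sat (E((X, type1) := d)) (is_set X) \<longleftrightarrow>
      (\<forall>t\<in>El Base. (\<exists>n. ev (d \<bullet> t) n \<and> ev (Num 0) n) \<or> (\<exists>n. ev (d \<bullet> t) n \<and> ev (Fn Suc \<bullet> Num 0) n))"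
      unfolding is_set_def sat.simps by auto
    also have "\<dots> \<longleftrightarrow> (\<forall>m. f m = 0 \<or> f m = 1)"
    proof
      assume l: "\<forall>t\<in>El Base. (\<exists>n. ev (d \<bullet> t) n \<and> ev (Num 0) n) \<or> (\<exists>n. ev (d \<bullet> t) n \<and> ev (Fn Suc \<bullet> Num 0) n)"
      show "\<forall>m. f m = 0 \<or> f m = 1"
      proof
        fix m show "f m = 0 \<or> f m = 1" using bspec[OF l Num_El[of m]] unfolding *[OF ev_Num] .
      qed
    next
      assume r: "\<forall>m. f m = 0 \<or> f m = 1"
      show "\<forall>t\<in>El Base. (\<exists>n. ev (d \<bullet> t) n \<and> ev (Num 0) n) \<or> (\<exists>n. ev (d \<bullet> t) n \<and> ev (Fn Suc \<bullet> Num 0) n)"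
      proof
        fix t assume "t \<in> El Base"
        then obtain m where "ev t m" by (auto simp: eqv_Base)
        from *[OF this] r show "(\<exists>n. ev (d \<bullet> t) n \<and> ev (Num 0) n) \<or> (\<exists>n. ev (d \<bullet> t) n \<and> ev (Fn Suc \<bullet> Num 0) n)"
          by simp
      qed
    qed
    finally show ?thesis .
  qed
  show ?case
  proof
    assume *: "sat E (tr (AllS X \<phi>))"
    show "sat2 sets \<nu> \<sigma> (AllS X \<phi>)" unfolding sat2.simps
    proof
      fix A assume "A \<in> sets"
      then have A: "chi A \<in> M" by (simp add: sets_def)
      have c: "ev (Fn (chi A) \<bullet> t) (chi A m)" if "ev t m" for t m using ev_Fn[OF that, of "chi A"] .
      have "sat (E((X, type1) := Fn (chi A))) (is_set X)"
        using is_set[of "Fn (chi A)" "chi A", OF c] by simp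
      then have "sat (E((X, type1) := Fn (chi A))) (tr \<phi>)" using * Fn_El[OF A] by simp
      then show "sat2 sets \<nu> (\<sigma>(X := A)) \<phi>" using IH[OF Fn_El[OF A] c] by simp
    qed
  next
    assume *: "sat2 sets \<nu> \<sigma> (AllS X \<phi>)"
    show "sat E (tr (AllS X \<phi>))" unfolding tr.simps sat.simps(3,4)
    proof (intro ballI impI)
      fix d assume "d \<in> El (snd (X, type1))" and s: "sat (E((X, type1) := d)) (is_set X)"
      then have d: "d \<in> El type1" by simp
      then have "\<exists>f\<in>M. \<forall>t m. ev t m \<longrightarrow> ev (d \<bullet> t) (f m)" by (rule type1_repr) blast
      then obtain f where f: "f \<in> M" "\<And>t m. ev t m \<Longrightarrow> ev (d \<bullet> t) (f m)" by blast
      from s have 01: "\<forall>m. f m = 0 \<or> f m = 1" using is_set[of d f, OF f(2)] by simp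
      \<comment> \<open>A function with values 0 and 1 is the characteristic function of the set on
        which it is 1, so the induction hypothesis applies with this set as
        \<open>A\<close>.\<close>
      have chi: "f m = chi {m. f m = 1} m" for m using spec[OF 01, of m] by auto
      have chi_f: "chi {m. f m = 1} = f" by (rule HOL.ext) (rule chi[symmetric])
      then have A: "{m. f m = 1} \<in> sets" unfolding sets_def using f(1) by (simp only: mem_Collect_eq)
      have "ev (d \<bullet> t) (chi {m. f m = 1} m)" if "ev t m" for t m
        using f(2)[OF that] fun_cong[OF chi_f, of m] by (simp only:)
      from IH[OF d this] show "sat (E((X, type1) := d)) (tr \<phi>)"
        using bspec[OF *[unfolded sat2.simps(7)] A] by (simp only:)
    qed
  qed
qed simp_all

end

section \<open>An injection from the unit interval\<close>

definition ratc :: "nat \<Rightarrow> nat \<Rightarrow> nat \<Rightarrow> nat" where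
  "ratc a b d = pairq (pairq a b) d"

text \<open>The semantic counterpart of the formula \<open>with_rats\<close>.\<close>

definition wr :: "nat \<Rightarrow> nat \<Rightarrow> (nat \<Rightarrow> nat \<Rightarrow> nat \<Rightarrow> bool) \<Rightarrow> bool" where
  "wr s t \<Psi> \<longleftrightarrow> (\<exists>a b d a' b' d'. s = ratc a b d \<and> t = ratc a' b' d' \<and>
     \<Psi> (a * Suc d' + b' * Suc d) (b * Suc d' + a' * Suc d) (Suc d * Suc d'))"

definition lt_rat :: "nat \<Rightarrow> nat \<Rightarrow> nat \<Rightarrow> bool" where
  "lt_rat n s t \<longleftrightarrow> wr s t (\<lambda>P Q D. 2 ^ n * ((P - Q) + (Q - P)) < D)"

definition le_rat :: "nat \<Rightarrow> nat \<Rightarrow> nat \<Rightarrow> bool" where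
  "le_rat n s t \<longleftrightarrow> wr s t (\<lambda>P Q D. 2 ^ n * ((P - Q) + (Q - P)) \<le> D + D)"

definition rat_val :: "nat \<Rightarrow> real \<Rightarrow> bool" where
  "rat_val s x \<longleftrightarrow> (\<exists>a b d. s = ratc a b d \<and> x = (real a - real b) / real (Suc d))"

lemma rat_val_unique: "rat_val s x \<Longrightarrow> rat_val s y \<Longrightarrow> x = y"
  unfolding rat_val_def ratc_def by auto

text \<open>The difference of the coded rationals is \<open>(P - Q) / D\<close>. This turns
  arithmetic with truncated subtraction into statements about real differences.\<close>

lemma wr_rat_val:
  assumes "\<And>P Q D :: nat. D > 0 \<Longrightarrow> \<Psi> P Q D \<longleftrightarrow> R ((real P - real Q) / real D)"
  shows "wr s t \<Psi> \<longleftrightarrow> (\<exists>x y. rat_val s x \<and> rat_val t y \<and> R (x - y))"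
proof -
  have eq: "(real (a * Suc d' + b' * Suc d) - real (b * Suc d' + a' * Suc d)) / real (Suc d * Suc d') =
      (real a - real b) / real (Suc d) - (real a' - real b') / real (Suc d')" for a b d a' b' d' :: nat
    by (simp only: of_nat_mult of_nat_add) (simp add: field_simps del: of_nat_Suc)
  have "\<Psi> (a * Suc d' + b' * Suc d) (b * Suc d' + a' * Suc d) (Suc d * Suc d') \<longleftrightarrow>
      R ((real a - real b) / real (Suc d) - (real a' - real b') / real (Suc d'))" for a b d a' b' d'
    unfolding eq[symmetric] by (rule assms) simp
  then show ?thesis unfolding wr_def rat_val_def by blast
qed

lemma real_absdiff: "real ((P - Q) + (Q - P)) = \<bar>real P - real Q\<bar>"
  by (cases "P \<le> Q") (auto simp: of_nat_diff)

lemma lt_rat_iff: "lt_rat n s t \<longleftrightarrow> (\<exists>x y. rat_val s x \<and> rat_val t y \<and> 2 ^ n * \<bar>x - y\<bar> < 1)"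
  unfolding lt_rat_def
proof (rule wr_rat_val)
  fix P Q D :: nat assume "D > 0"
  have "2 ^ n * ((P - Q) + (Q - P)) < D \<longleftrightarrow> real (2 ^ n * ((P - Q) + (Q - P))) < real D"
    by (simp only: of_nat_less_iff)
  also have "\<dots> \<longleftrightarrow> 2 ^ n * \<bar>real P - real Q\<bar> < real D"
    unfolding of_nat_mult real_absdiff by simp
  also have "\<dots> \<longleftrightarrow> 2 ^ n * \<bar>(real P - real Q) / real D\<bar> < 1"
    using \<open>D > 0\<close> by (simp add: abs_divide field_simps)
  finally show "2 ^ n * ((P - Q) + (Q - P)) < D \<longleftrightarrow> 2 ^ n * \<bar>(real P - real Q) / real D\<bar> < 1" .
qed

lemma le_rat_iff: "le_rat n s t \<longleftrightarrow> (\<exists>x y. rat_val s x \<and> rat_val t y \<and> 2 ^ n * \<bar>x - y\<bar> \<le> 2)"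
  unfolding le_rat_def
proof (rule wr_rat_val)
  fix P Q D :: nat assume "D > 0"
  have "2 ^ n * ((P - Q) + (Q - P)) \<le> D + D \<longleftrightarrow> real (2 ^ n * ((P - Q) + (Q - P))) \<le> real (D + D)"
    by (simp only: of_nat_le_iff)
  also have "\<dots> \<longleftrightarrow> 2 ^ n * \<bar>real P - real Q\<bar> \<le> 2 * real D"
    unfolding of_nat_mult real_absdiff by simp
  also have "\<dots> \<longleftrightarrow> 2 ^ n * \<bar>(real P - real Q) / real D\<bar> \<le> 2"
    using \<open>D > 0\<close> by (simp add: abs_divide field_simps)
  finally show "2 ^ n * ((P - Q) + (Q - P)) \<le> D + D \<longleftrightarrow> 2 ^ n * \<bar>(real P - real Q) / real D\<bar> \<le> 2" .
qed

definition real_seq :: "(nat \<Rightarrow> nat) \<Rightarrow> bool" where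
  "real_seq f \<longleftrightarrow> (\<forall>n k. lt_rat n (f n) (f (n + k)))"

definition eq_seq :: "(nat \<Rightarrow> nat) \<Rightarrow> (nat \<Rightarrow> nat) \<Rightarrow> bool" where
  "eq_seq f g \<longleftrightarrow> (\<forall>n. le_rat n (f n) (g n))"

lemma real_seq_val:
  assumes "real_seq f"
  obtains x where "\<And>n. rat_val (f n) (x n)" "\<And>n k. 2 ^ n * \<bar>x n - x (n + k)\<bar> < 1"
proof -
  have "\<exists>x. rat_val (f n) x" for n
    using assms unfolding real_seq_def lt_rat_iff by blast
  then obtain x where x: "\<And>n. rat_val (f n) (x n)" by metis
  moreover have "2 ^ n * \<bar>x n - x (n + k)\<bar> < 1" for n k
    using assms x rat_val_unique unfolding real_seq_def lt_rat_iff by metis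
  ultimately show ?thesis using that by blast
qed

lemma eq_seq_sym: "eq_seq f g \<Longrightarrow> eq_seq g f"
  unfolding eq_seq_def le_rat_iff by (metis abs_minus_commute)

text \<open>At index \<open>n\<close> the two bounds only add up to 4 instead of 2, after scaling by
  \<open>2 ^ n\<close>. Passing to index \<open>n + k\<close>, the Cauchy errors of \<open>f\<close>
  and \<open>h\<close> contribute less than 1 each and the equalities at most
  \<open>4 / 2 ^ k\<close>, which is arbitrarily small.\<close>

lemma eq_seq_trans:
  assumes "real_seq f" "real_seq g" "real_seq h" "eq_seq f g" "eq_seq g h"
  shows "eq_seq f h"
proof -
  obtain x where x: "\<And>n. rat_val (f n) (x n)" "\<And>n k. 2 ^ n * \<bar>x n - x (n + k)\<bar> < 1"
    using real_seq_val[OF assms(1)] by metis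
  obtain y where y: "\<And>n. rat_val (g n) (y n)"
    using real_seq_val[OF assms(2)] by metis
  obtain z where z: "\<And>n. rat_val (h n) (z n)" "\<And>n k. 2 ^ n * \<bar>z n - z (n + k)\<bar> < 1"
    using real_seq_val[OF assms(3)] by metis
  have xy: "2 ^ n * \<bar>x n - y n\<bar> \<le> 2" for n
    using assms(4) x(1) y rat_val_unique unfolding eq_seq_def le_rat_iff by metis
  have yz: "2 ^ n * \<bar>y n - z n\<bar> \<le> 2" for n
    using assms(5) y z(1) rat_val_unique unfolding eq_seq_def le_rat_iff by metis
  have "2 ^ n * \<bar>x n - z n\<bar> \<le> 2" for n
  proof (rule ccontr)
    assume "\<not> 2 ^ n * \<bar>x n - z n\<bar> \<le> 2"
    then obtain e where e: "e > 0" "2 ^ n * \<bar>x n - z n\<bar> = 2 + e"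
      by (metis add_diff_cancel_left' add_diff_eq diff_gt_0_iff_gt not_le)
    obtain k where k: "(1 / 2) ^ k < e / 4"
      using real_arch_pow_inv[of "e / 4" "1 / 2"] e(1) by auto
    let ?m = "n + k"
    have "2 ^ k * (2 ^ n * \<bar>x ?m - y ?m\<bar>) \<le> 2" "2 ^ k * (2 ^ n * \<bar>y ?m - z ?m\<bar>) \<le> 2"
      using xy[of ?m] yz[of ?m] by (simp_all add: power_add mult_ac)
    then have "2 ^ n * \<bar>x ?m - y ?m\<bar> \<le> 2 * (1 / 2) ^ k" "2 ^ n * \<bar>y ?m - z ?m\<bar> \<le> 2 * (1 / 2) ^ k"
      by (simp_all add: field_simps)
    moreover have "\<bar>x n - z n\<bar> \<le> \<bar>x n - x ?m\<bar> + \<bar>x ?m - y ?m\<bar> + \<bar>y ?m - z ?m\<bar> + \<bar>z n - z ?m\<bar>" by simp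
    then have "2 ^ n * \<bar>x n - z n\<bar> \<le> 2 ^ n * (\<bar>x n - x ?m\<bar> + \<bar>x ?m - y ?m\<bar> + \<bar>y ?m - z ?m\<bar> + \<bar>z n - z ?m\<bar>)"
      by (rule mult_left_mono) simp
    moreover have "2 ^ n * \<bar>x n - x ?m\<bar> < 1" "2 ^ n * \<bar>z n - z ?m\<bar> < 1" using x(2) z(2) by auto
    ultimately show False using k e(2) by (simp add: distrib_left)
  qed
  then show ?thesis unfolding eq_seq_def le_rat_iff using x(1) z(1) by blast
qed

text \<open>The test to be used as \<open>q\<close> in \<open>closed2_selector\<close>. The index
  \<open>p1 w\<close> codes \<open>n\<close> and \<open>k\<close>, while \<open>u\<close> and
  \<open>v\<close> hold the values of the two sequences at \<open>n\<close> and
  \<open>n + k\<close>.\<close>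

definition realq :: "nat \<Rightarrow> nat" where
  "realq w = (let n = p1 (p1 w); u = p1 (p2 w); v = p2 (p2 w) in
     if lt_rat n (p1 u) (p2 u) \<and> lt_rat n (p1 v) (p2 v) \<and> le_rat n (p1 u) (p1 v) then 0 else 1)"

lemma realq_iff:
  "real_seq h \<and> real_seq f \<and> eq_seq h f \<longleftrightarrow>
    (\<forall>k. realq (pe k (pe (pe (h (p1 k)) (h (p1 k + p2 k))) (pe (f (p1 k)) (f (p1 k + p2 k))))) = 0)"
proof
  assume "real_seq h \<and> real_seq f \<and> eq_seq h f"
  then show "\<forall>k. realq (pe k (pe (pe (h (p1 k)) (h (p1 k + p2 k))) (pe (f (p1 k)) (f (p1 k + p2 k))))) = 0"
    by (simp add: realq_def Let_def real_seq_def eq_seq_def)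
next
  assume r: "\<forall>k. realq (pe k (pe (pe (h (p1 k)) (h (p1 k + p2 k))) (pe (f (p1 k)) (f (p1 k + p2 k))))) = 0"
  have "lt_rat n (h n) (h (n + m)) \<and> lt_rat n (f n) (f (n + m)) \<and> le_rat n (h n) (f n)" for n m
    using spec[OF r, of "pe n m"] by (simp add: realq_def Let_def split: if_splits)
  then show "real_seq h \<and> real_seq f \<and> eq_seq h f"
    by (simp add: real_seq_def eq_seq_def)
qed

abbreviation num :: "trm \<Rightarrow> bool" where
  "num t \<equiv> wt t \<and> typ_of t = Base"

lemma wff_with_rats:
  assumes "num s" "num t" "\<And>P Q D. num P \<Longrightarrow> num Q \<Longrightarrow> num D \<Longrightarrow> wff (\<Phi> P Q D)"
  shows "wff (with_rats s t \<Phi>)"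
  using assms by (simp add: with_rats_def Let_def rat_code_def pair_trm_def)

lemma wff_is_real: "wt x \<Longrightarrow> typ_of x = type1 \<Longrightarrow> wff (is_real x)"
  unfolding is_real_def Let_def wff.simps by (rule wff_with_rats) (simp_all add: Less_def Le_def)

lemma wff_eq_real: "wt x \<Longrightarrow> typ_of x = type1 \<Longrightarrow> wt y \<Longrightarrow> typ_of y = type1 \<Longrightarrow> wff (eq_real x y)"
  unfolding eq_real_def Let_def wff.simps by (rule wff_with_rats) (simp_all add: Le_def)

lemma wff_le_real: "wt x \<Longrightarrow> typ_of x = type1 \<Longrightarrow> wt y \<Longrightarrow> typ_of y = type1 \<Longrightarrow> wff (le_real x y)"
  unfolding le_real_def Let_def wff.simps by (rule wff_with_rats) (simp_all add: Le_def)

lemma wff_in_unit: "wt x \<Longrightarrow> typ_of x = type1 \<Longrightarrow> wff (in_unit x)"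
proof -
  have "wt zero_real" "typ_of zero_real = type1" "wt one_real" "typ_of one_real = type1"
    by (simp_all add: Defs.zero_real_def Defs.one_real_def rat_code_def pair_trm_def)
  then show "wt x \<Longrightarrow> typ_of x = type1 \<Longrightarrow> wff (in_unit x)"
    by (simp add: in_unit_def wff_is_real wff_le_real)
qed

section \<open>Formulas about reals in the model\<close>

context arith_closed
begin

definition tv :: "(var \<Rightarrow> tm) \<Rightarrow> trm \<Rightarrow> nat" where
  "tv E t = (THE n. ev (den E t) n)"

lemma tv_eqI: "ev (den E t) n \<Longrightarrow> tv E t = n"
  unfolding tv_def using ev_det by blast

lemma ev_tv: "good E \<Longrightarrow> num t \<Longrightarrow> ev (den E t) (tv E t)"
  using den_El[of E t] tv_eqI by (auto simp: eqv_Base)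

lemma sat_Eq_tv: "good E \<Longrightarrow> num s \<Longrightarrow> num t \<Longrightarrow> sat E (Eq s t) \<longleftrightarrow> tv E s = tv E t"
  by (rule sat_Eq_ev) (simp_all add: ev_tv)

lemma tv_simps:
  "tv E Zero = 0"
  "E (k, Base) = Num n \<Longrightarrow> tv E (Var (k, Base)) = n"
  "good E \<Longrightarrow> num t \<Longrightarrow> E (k, type1) = Fn f \<Longrightarrow> tv E (Var (k, type1) \<cdot> t) = f (tv E t)"
  "good E \<Longrightarrow> num t \<Longrightarrow> tv E (Succ \<cdot> t) = Suc (tv E t)"
  "good E \<Longrightarrow> num s \<Longrightarrow> num t \<Longrightarrow> tv E (plus_trm s t) = tv E s + tv E t"
  "good E \<Longrightarrow> num s \<Longrightarrow> num t \<Longrightarrow> tv E (times_trm s t) = tv E s * tv E t"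
  "good E \<Longrightarrow> num s \<Longrightarrow> num t \<Longrightarrow> tv E (minus_trm s t) = tv E s - tv E t"
  "good E \<Longrightarrow> num t \<Longrightarrow> tv E (pow2C \<cdot> t) = 2 ^ tv E t"
  by (rule tv_eqI, auto intro!: ev_Num ev_plus ev_times ev_minus ev_pow2 ev_Fn ev_tv)+

lemma sat_Le: "good E \<Longrightarrow> num s \<Longrightarrow> num t \<Longrightarrow> sat E (Le s t) \<longleftrightarrow> tv E s \<le> tv E t"
  unfolding Le_def by (subst sat_Eq_tv) (simp_all add: tv_simps)

lemma sat_Less: "good E \<Longrightarrow> num s \<Longrightarrow> num t \<Longrightarrow> sat E (Less s t) \<longleftrightarrow> tv E s < tv E t"
  unfolding Less_def by (subst sat_Le) (simp_all add: tv_simps Suc_le_eq)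

lemma good_Num: "good E \<Longrightarrow> good (E((k, Base) := Num n))"
  by (rule good_updB[OF _ ev_Num])

lemma good_Fn: "good E \<Longrightarrow> f \<in> M \<Longrightarrow> good (E((k, type1) := Fn f))"
  using good_upd[of E "Fn f" "(k, type1)"] Fn_El by simp

lemma sat_Exists_Base:
  assumes "good E" "wff \<phi>"
  shows "sat E (Exists (k, Base) \<phi>) \<longleftrightarrow> (\<exists>n. sat (E((k, Base) := Num n)) \<phi>)"
  using sat_Forall_Base[OF assms(1), of "Neg \<phi>" k] assms(2) by (simp del: sat.simps(4))

lemma tv_fresh: "(\<And>x. x \<in> fv_trm t \<Longrightarrow> E x = E' x) \<Longrightarrow> tv E t = tv E' t"
  unfolding tv_def using den_fresh[of t E E'] by simp

text \<open>The six quantifiers may be taken over numerals. They change the environment at the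
  variables 2 to 7 only, which is why the body is interpreted in all environments \<open>E'\<close>
  agreeing with \<open>E\<close> elsewhere.\<close>

lemma sat_with_rats:
  assumes E: "good E" and st: "num s" "num t"
    and fresh: "\<And>x. x \<in> fv_trm s \<union> fv_trm t \<Longrightarrow> x \<notin> {2..7} \<times> {Base}"
    and wff: "\<And>P Q D. num P \<Longrightarrow> num Q \<Longrightarrow> num D \<Longrightarrow> wff (\<Phi> P Q D)"
    and \<Phi>: "\<And>E' P Q D. good E' \<Longrightarrow> (\<And>x. x \<notin> {2..7} \<times> {Base} \<Longrightarrow> E' x = E x) \<Longrightarrow>
      num P \<Longrightarrow> num Q \<Longrightarrow> num D \<Longrightarrow> sat E' (\<Phi> P Q D) \<longleftrightarrow> \<Psi> (tv E' P) (tv E' Q) (tv E' D)"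
  shows "sat E (with_rats s t \<Phi>) \<longleftrightarrow> wr (tv E s) (tv E t) \<Psi>"
proof -
  let ?v = "\<lambda>k. Var (k, Base)"
  define P where "P = plus_trm (times_trm (?v 2) (Succ \<cdot> ?v 7)) (times_trm (?v 6) (Succ \<cdot> ?v 4))"
  define Q where "Q = plus_trm (times_trm (?v 3) (Succ \<cdot> ?v 7)) (times_trm (?v 5) (Succ \<cdot> ?v 4))"
  define D where "D = times_trm (Succ \<cdot> ?v 4) (Succ \<cdot> ?v 7)"
  define r where "r = rat_code (?v 2) (?v 3) (?v 4)"
  define r' where "r' = rat_code (?v 5) (?v 6) (?v 7)"
  note defs = P_def Q_def D_def r_def r'_def
  have num: "num P" "num Q" "num D" "num r" "num r'" by (simp_all add: defs rat_code_def pair_trm_def)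
  define B where "B = Conj (Conj (Eq s r) (Eq t r')) (\<Phi> P Q D)"
  have wB: "wff B" using num st wff by (simp add: B_def)
  define E' where "E' a b d a' b' d' = E((2, Base) := Num a, (3, Base) := Num b, (4, Base) := Num d,
    (5, Base) := Num a', (6, Base) := Num b', (7, Base) := Num d')" for a b d a' b' d'
  have goodE': "good (E' a b d a' b' d')" for a b d a' b' d'
    unfolding E'_def by (intro good_Num E)
  have agree: "E' a b d a' b' d' x = E x" if "x \<notin> {2..7} \<times> {Base}" for a b d a' b' d' x
    using that unfolding E'_def by auto
  have "with_rats s t \<Phi> = Exists (2, Base) (Exists (3, Base) (Exists (4, Base)
      (Exists (5, Base) (Exists (6, Base) (Exists (7, Base) B)))))"
    unfolding with_rats_def Let_def B_def defs by (rule HOL.refl)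
  then have "sat E (with_rats s t \<Phi>) \<longleftrightarrow> (\<exists>a b d a' b' d'. sat (E' a b d a' b' d') B)"
    unfolding E'_def by (simp only: sat_Exists_Base good_Num E wB wff.simps simp_thms)
  moreover have "sat (E' a b d a' b' d') B \<longleftrightarrow> tv E s = ratc a b d \<and> tv E t = ratc a' b' d' \<and>
     \<Psi> (a * Suc d' + b' * Suc d) (b * Suc d' + a' * Suc d) (Suc d * Suc d')" for a b d a' b' d'
  proof -
    let ?E = "E' a b d a' b' d'"
    have vars: "?E (2, Base) = Num a" "?E (3, Base) = Num b" "?E (4, Base) = Num d"
      "?E (5, Base) = Num a'" "?E (6, Base) = Num b'" "?E (7, Base) = Num d'"
      by (simp_all add: E'_def)
    have "tv ?E s = tv E s" "tv ?E t = tv E t"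
      by (rule tv_fresh, rule agree, rule fresh, simp)+
    moreover have "tv ?E r = ratc a b d" "tv ?E r' = ratc a' b' d'" "tv ?E D = Suc d * Suc d'"
      "tv ?E P = a * Suc d' + b' * Suc d" "tv ?E Q = b * Suc d' + a' * Suc d"
      unfolding defs rat_code_def pair_trm_def ratc_def pairq_def
      by (simp_all add: tv_simps goodE' vars)
    moreover have "sat ?E (\<Phi> P Q D) \<longleftrightarrow> \<Psi> (tv ?E P) (tv ?E Q) (tv ?E D)"
      by (rule \<Phi>[OF goodE' _ num(1-3)]) (rule agree)
    moreover have "sat ?E (Eq s r) \<longleftrightarrow> tv ?E s = tv ?E r" "sat ?E (Eq t r') \<longleftrightarrow> tv ?E t = tv ?E r'"
      using sat_Eq_tv[OF goodE'] st num by blast+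
    ultimately show ?thesis
      unfolding B_def by (simp only: sat.simps(2,3)) blast
  qed
  ultimately show ?thesis unfolding wr_def by (simp only:)
qed

lemma sat_is_real:
  assumes E: "good E" "E (k, type1) = Fn f"
  shows "sat E (is_real (Var (k, type1))) \<longleftrightarrow> real_seq f"
proof -
  let ?x = "Var (k, type1)" and ?n = "Var (0, Base)" and ?k = "Var (1, Base)"
  let ?\<Phi> = "\<lambda>P Q D. Less (times_trm (pow2C \<cdot> ?n) (absdiff_trm P Q)) D"
  let ?B = "with_rats (?x \<cdot> ?n) (?x \<cdot> plus_trm ?n ?k) ?\<Phi>"
  have w: "wff ?B" by (rule wff_with_rats) (simp_all add: Less_def Le_def)
  have "sat (E((0, Base) := Num n, (1, Base) := Num m)) ?B \<longleftrightarrow> lt_rat n (f n) (f (n + m))" for n m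
  proof -
    let ?E = "E((0, Base) := Num n, (1, Base) := Num m)"
    have g: "good ?E" by (intro good_Num E)
    have "sat ?E ?B \<longleftrightarrow> wr (tv ?E (?x \<cdot> ?n)) (tv ?E (?x \<cdot> plus_trm ?n ?k)) (\<lambda>P Q D. 2 ^ n * ((P - Q) + (Q - P)) < D)"
    proof (rule sat_with_rats[OF g])
      fix E' P Q D assume *: "good E'" "\<And>x. x \<notin> {2..7} \<times> {Base} \<Longrightarrow> E' x = ?E x" "num P" "num Q" "num D"
      have "E' (0, Base) = Num n" using *(2)[of "(0, Base)"] by simp
      then show "sat E' (?\<Phi> P Q D) \<longleftrightarrow> 2 ^ n * ((tv E' P - tv E' Q) + (tv E' Q - tv E' P)) < tv E' D"
        using * by (simp add: sat_Less tv_simps)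
    qed (auto simp: Less_def Le_def)
    moreover have "tv ?E (?x \<cdot> ?n) = f n" "tv ?E (?x \<cdot> plus_trm ?n ?k) = f (n + m)"
      using g E(2) by (simp_all add: tv_simps)
    ultimately show ?thesis unfolding lt_rat_def by simp
  qed
  then show ?thesis
    unfolding is_real_def Let_def real_seq_def
    by (simp only: sat_Forall_Base good_Num E w wff.simps simp_thms)
qed

lemma sat_eq_real:
  assumes E: "good E" "E (k, type1) = Fn f" "E (l, type1) = Fn g"
  shows "sat E (eq_real (Var (k, type1)) (Var (l, type1))) \<longleftrightarrow> eq_seq f g"
proof -
  let ?x = "Var (k, type1)" and ?y = "Var (l, type1)" and ?n = "Var (0, Base)"
  let ?\<Phi> = "\<lambda>P Q D. Le (times_trm (pow2C \<cdot> ?n) (absdiff_trm P Q)) (plus_trm D D)"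
  let ?B = "with_rats (?x \<cdot> ?n) (?y \<cdot> ?n) ?\<Phi>"
  have w: "wff ?B" by (rule wff_with_rats) (simp_all add: Le_def)
  have "sat (E((0, Base) := Num n)) ?B \<longleftrightarrow> le_rat n (f n) (g n)" for n
  proof -
    let ?E = "E((0, Base) := Num n)"
    have good: "good ?E" by (intro good_Num E)
    have "sat ?E ?B \<longleftrightarrow> wr (tv ?E (?x \<cdot> ?n)) (tv ?E (?y \<cdot> ?n)) (\<lambda>P Q D. 2 ^ n * ((P - Q) + (Q - P)) \<le> D + D)"
    proof (rule sat_with_rats[OF good])
      fix E' P Q D assume *: "good E'" "\<And>x. x \<notin> {2..7} \<times> {Base} \<Longrightarrow> E' x = ?E x" "num P" "num Q" "num D"
      have "E' (0, Base) = Num n" using *(2)[of "(0, Base)"] by simp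
      then show "sat E' (?\<Phi> P Q D) \<longleftrightarrow> 2 ^ n * ((tv E' P - tv E' Q) + (tv E' Q - tv E' P)) \<le> tv E' D + tv E' D"
        using * by (simp add: sat_Le tv_simps)
    qed (auto simp: Le_def)
    moreover have "tv ?E (?x \<cdot> ?n) = f n" "tv ?E (?y \<cdot> ?n) = g n"
      using good E(2,3) by (simp_all add: tv_simps)
    ultimately show ?thesis unfolding le_rat_def by simp
  qed
  then show ?thesis
    unfolding eq_real_def Let_def eq_seq_def
    by (simp only: sat_Forall_Base good_Num E w wff.simps simp_thms)
qed

lemma sat_Forall2_type1:
  assumes "good E" "wff \<phi>"
    and "\<And>f g. f \<in> M \<Longrightarrow> g \<in> M \<Longrightarrow> sat (E((k, type1) := Fn f, (l, type1) := Fn g)) \<phi>"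
  shows "sat E (Forall (k, type1) (Forall (l, type1) \<phi>))"
proof -
  have w: "wff (Forall (l, type1) \<phi>)" using assms(2) by simp
  show ?thesis
    unfolding sat_Forall_type1[OF assms(1) w]
  proof
    fix f assume f: "f \<in> M"
    show "sat (E((k, type1) := Fn f)) (Forall (l, type1) \<phi>)"
      unfolding sat_Forall_type1[OF good_Fn[OF assms(1) f] assms(2)] using assms(3) f by blast
  qed
qed

text \<open>The selector is applied to the partial equivalence relation of being two equal reals.
  The resulting functional takes the same value exactly on equal reals of \<open>M\<close>, which
  gives both extensionality and injectivity of the witness for \<open>Y\<close>.\<close>

lemma sat_Neg_NIN:
  assumes M: "countable M" "realq \<in> M" "(\<lambda>k. p1 k + p2 k) \<in> M" and E: "good E"
  shows "sat E (Neg NIN)"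
proof -
  let ?Q = "\<lambda>h f. real_seq h \<and> real_seq f \<and> eq_seq h f"
  have "\<exists>F. closed2 F \<and> (\<forall>f\<in>M. \<forall>g\<in>M. ?Q f f \<longrightarrow> ?Q g g \<longrightarrow> (F f = F g \<longleftrightarrow> ?Q f g))"
  proof (rule closed2_selector[OF M(1,2) M_fst M(3), of ?Q])
    show "?Q h f \<longleftrightarrow> (\<forall>k. realq (pe k (pe (pe (h (p1 k)) (h (p1 k + p2 k))) (pe (f (p1 k)) (f (p1 k + p2 k))))) = 0)" for h f
      by (rule realq_iff)
    show "?Q h f \<Longrightarrow> ?Q f h" for h f using eq_seq_sym by blast
    show "?Q h f \<Longrightarrow> ?Q f g \<Longrightarrow> ?Q h g" for h f g using eq_seq_trans by blast
  qed blast
  then obtain F where F: "closed2 F"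
    "\<And>f g. f \<in> M \<Longrightarrow> g \<in> M \<Longrightarrow> ?Q f f \<Longrightarrow> ?Q g g \<Longrightarrow> F f = F g \<longleftrightarrow> ?Q f g" by blast
  \<comment> \<open>The domain of this partial equivalence relation consists precisely of the Cauchy
    sequences in the sense of \<open>real_seq\<close>.\<close>
  have refl: "?Q f f" if "real_seq f" for f
  proof -
    have "\<exists>x. \<forall>n. rat_val (f n) (x n)" by (rule real_seq_val[OF that]) blast
    then have "eq_seq f f" unfolding eq_seq_def le_rat_iff by force
    with that show ?thesis by blast
  qed
  have F_eq: "F f = F g \<longleftrightarrow> eq_seq f g" if "f \<in> M" "g \<in> M" "real_seq f" "real_seq g" for f g
    using F(2)[OF that(1,2) refl[OF that(3)] refl[OF that(4)]] that(3,4) by blast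
  let ?x = "Var (0, type1)" and ?y = "Var (1, type1)" and ?Y = "Var (0, type2)"
  have d: "Fun2 F \<in> El type2" using rel_Fun2[OF F(1)] by simp
  let ?E = "E((0, type2) := Fun2 F)"
  have gE: "good ?E" using good_upd[OF E, of "Fun2 F" "(0, type2)"] d by simp
  let ?A = "Imp (Conj (in_unit ?x) (in_unit ?y)) (Imp (eq_real ?x ?y) (Eq (?Y \<cdot> ?x) (?Y \<cdot> ?y)))"
  let ?B = "Imp (Conj (in_unit ?x) (in_unit ?y)) (Imp (Eq (?Y \<cdot> ?x) (?Y \<cdot> ?y)) (eq_real ?x ?y))"
  have w: "wff ?A" "wff ?B" by (simp_all add: wff_in_unit wff_eq_real)
  have AB: "sat (?E((0, type1) := Fn f, (1, type1) := Fn g)) ?A \<and> sat (?E((0, type1) := Fn f, (1, type1) := Fn g)) ?B"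
    if fg: "f \<in> M" "g \<in> M" for f g
  proof -
    let ?E' = "?E((0, type1) := Fn f, (1, type1) := Fn g)"
    have g: "good ?E'" by (intro good_Fn gE fg)
    have vars: "?E' (0, type1) = Fn f" "?E' (1, type1) = Fn g" by simp_all
    have "ev (den ?E' (?Y \<cdot> ?x)) (F f)" "ev (den ?E' (?Y \<cdot> ?y)) (F g)"
      by (simp_all add: ev_Fun2 ev_Fn ev_Num)
    from sat_Eq_ev[OF this] have eq: "sat ?E' (Eq (?Y \<cdot> ?x) (?Y \<cdot> ?y)) \<longleftrightarrow> F f = F g" .
    have "real_seq f" if "sat ?E' (in_unit ?x)"
      using that sat_is_real[OF g vars(1)] unfolding in_unit_def sat.simps by blast
    moreover have "real_seq g" if "sat ?E' (in_unit ?y)"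
      using that sat_is_real[OF g vars(2)] unfolding in_unit_def sat.simps by blast
    ultimately show ?thesis
      using F_eq[OF fg] sat_eq_real[OF g vars] eq unfolding sat.simps(2,3) by blast
  qed
  have "sat ?E (Forall (0, type1) (Forall (1, type1) ?A))" "sat ?E (Forall (0, type1) (Forall (1, type1) ?B))"
    by (rule sat_Forall2_type1[OF gE]; use w AB in blast)+
  with d show ?thesis
    unfolding NIN_def Let_def sat.simps(2,3) sat.simps(4)[of E "(0, type2)"] snd_conv by blast
qed

end

section \<open>A countable class in which a transfinite recursion has no solution\<close>

text \<open>\<open>Orc\<close> names the base function and \<open>Bas k\<close> its section at
  \<open>k\<close>. Identity and projections have no constructor; they will be sections of the base
  function.\<close>

datatype code = Cst nat | Orc | Bas nat | Pr code code | Cmp code code | Rec code code | Mu code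

instance code :: countable by countable_datatype

fun val :: "(nat \<Rightarrow> nat) \<Rightarrow> code \<Rightarrow> nat \<Rightarrow> nat" where
  "val b (Cst c) x = c"
| "val b Orc x = b x"
| "val b (Bas k) x = b (pe k x)"
| "val b (Pr f g) x = pe (val b f x) (val b g x)"
| "val b (Cmp f g) x = val b f (val b g x)"
| "val b (Rec f g) x = rec_nat (val b f (p1 x)) (\<lambda>k r. val b g (pe r (pe k (p1 x)))) (p2 x)"
| "val b (Mu f) x = mu (\<lambda>n. val b f (pe x n))"

text \<open>Facts about these codes serve as axioms: \<open>premise\<close> offers no rule for
  them.\<close>

fun basic :: "code \<Rightarrow> bool" where
  "basic (Cst c) \<longleftrightarrow> True"
| "basic Orc \<longleftrightarrow> True"
| "basic (Bas k) \<longleftrightarrow> True"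
| "basic _ \<longleftrightarrow> False"

text \<open>The number \<open>0\<close> is not a value of \<open>fct\<close>: it serves as a trivially true premise below.\<close>

definition fct :: "code \<Rightarrow> nat \<Rightarrow> nat \<Rightarrow> nat" where
  "fct e x y = Suc (to_nat (e, x, y))"

lemma fct_simps [simp]: "fct e x y = fct e' x' y' \<longleftrightarrow> e = e' \<and> x = x' \<and> y = y'" "fct e x y \<noteq> 0"
  by (auto simp: fct_def)

definition holds :: "(nat \<Rightarrow> nat) \<Rightarrow> nat \<Rightarrow> bool" where
  "holds b n \<longleftrightarrow> (\<exists>e x. n = fct e x (val b e x))"

lemma holds_simps [simp]: "holds b (fct e x y) \<longleftrightarrow> val b e x = y" "\<not> holds b 0"
  unfolding holds_def by (auto simp: eq_commute[of 0])

text \<open>An \<open>\<omega>\<close>-rule system for the graphs of all coded functions: \<open>fct e x y\<close> follows if, for some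
  witness \<open>c\<close>, each \<open>u\<close> has a true premise \<open>w\<close>.  The single format of the rules keeps the formula
  of the transfinite recursion short.\<close>

fun premise :: "code \<Rightarrow> nat \<Rightarrow> nat \<Rightarrow> nat \<Rightarrow> nat \<Rightarrow> nat \<Rightarrow> bool" where
  "premise (Pr f g) x y c u w \<longleftrightarrow> w = (if u = 0 then fct f x (p1 y) else fct g x (p2 y))"
| "premise (Cmp f g) x y c u w \<longleftrightarrow> w = (if u = 0 then fct g x c else fct f c y)"
| "premise (Rec f g) x y c u w \<longleftrightarrow> (let l = from_nat c in y = l ! p2 x \<and>
     w = (if u = 0 then fct f (p1 x) (l ! 0)
       else if u \<le> p2 x then fct g (pe (l ! (u - 1)) (pe (u - 1) (p1 x))) (l ! u) else 0))"
| "premise (Mu f) x y c u w \<longleftrightarrow>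
     (if c = 0 then
        (if u < y then \<exists>v. w = fct f (pe x u) (Suc v) else if u = y then w = fct f (pe x y) 0 else w = 0)
      else y = 0 \<and> (\<exists>v. w = fct f (pe x u) (Suc v)))"
| "premise _ x y c u w \<longleftrightarrow> False"

text \<open>For \<open>Rec\<close>, the premises verify the list coded by \<open>c\<close> entry by
  entry. For \<open>Mu\<close>, a witness \<open>c = 0\<close> certifies \<open>y\<close> as the
  first zero, whereas \<open>c \<noteq> 0\<close> certifies a nonzero value at every
  \<open>u\<close>; this is where the infinitely many premises are essential.\<close>

lemma premise_sound:
  assumes "\<And>u. \<exists>w. premise e x y c u w \<and> (w = 0 \<or> holds b w)"
  shows "val b e x = y"
proof (cases e)
  case (Pr f g)
  then show ?thesis using assms[of 0] assms[of 1] by auto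
next
  case (Cmp f g)
  then show ?thesis using assms[of 0] assms[of 1] by auto
next
  case (Rec f g)
  define l :: "nat list" where "l = from_nat c"
  let ?r = "rec_nat (val b f (p1 x)) (\<lambda>k r. val b g (pe r (pe k (p1 x))))"
  have y: "y = l ! p2 x" and 0: "l ! 0 = val b f (p1 x)"
    using assms[of 0] Rec by (auto simp: Let_def l_def)
  have S: "l ! Suc k = val b g (pe (l ! k) (pe k (p1 x)))" if "Suc k \<le> p2 x" for k
    using assms[of "Suc k"] Rec that by (auto simp: Let_def l_def)
  have "k \<le> p2 x \<Longrightarrow> ?r k = l ! k" for k
    by (induction k) (use 0 S in auto)
  then show ?thesis using y Rec by simp
next
  case (Mu f)
  show ?thesis
  proof (cases "c = 0")
    case True
    have lt: "val b f (pe x u) \<noteq> 0" if "u < y" for u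
      using assms[of u] that Mu True by auto
    have y: "val b f (pe x y) = 0" using assms[of y] Mu True by auto
    have "(LEAST n. val b f (pe x n) = 0) = y"
      by (rule Least_equality) (rule y, metis lt not_le)
    moreover have "\<exists>n. val b f (pe x n) = 0" using y by blast
    ultimately show ?thesis using Mu by (simp add: mu_def)
  next
    case False
    then have "y = 0 \<and> val b f (pe x u) \<noteq> 0" for u
      using assms[of u] Mu by auto
    then have "y = 0" "\<not> (\<exists>n. val b f (pe x n) = 0)" by blast+
    then show ?thesis using Mu by (simp only: mu_def val.simps if_False)
  qed
qed (use assms in auto)

text \<open>The witness is 0 for \<open>Pr\<close>, the inner value for \<open>Cmp\<close>, the list
  of all recursion values for \<open>Rec\<close>, and for \<open>Mu\<close> either 0 or 1 according
  to whether a zero exists. Nontrivial premises concern codes of smaller size, so the size of a code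
  will bound the stage of its facts.\<close>

lemma premise_complete:
  assumes "\<not> basic e"
  shows "\<exists>c. \<forall>u. \<exists>w. premise e x (val b e x) c u w \<and>
    (w = 0 \<or> (\<exists>e' x'. size e' < size e \<and> w = fct e' x' (val b e' x')))"
proof (cases e)
  case (Pr f g)
  show ?thesis
  proof (rule exI[of _ 0], rule allI)
    fix u
    show "\<exists>w. premise e x (val b e x) 0 u w \<and>
      (w = 0 \<or> (\<exists>e' x'. size e' < size e \<and> w = fct e' x' (val b e' x')))"
      by (rule exI[of _ "if u = 0 then fct f x (val b f x) else fct g x (val b g x)"])
        (use Pr in \<open>auto intro: exI[of _ f] exI[of _ g]\<close>)
  qed
next
  case (Cmp f g)
  show ?thesis
  proof (rule exI[of _ "val b g x"], rule allI)
    fix u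
    show "\<exists>w. premise e x (val b e x) (val b g x) u w \<and>
      (w = 0 \<or> (\<exists>e' x'. size e' < size e \<and> w = fct e' x' (val b e' x')))"
      by (rule exI[of _ "if u = 0 then fct g x (val b g x) else fct f (val b g x) (val b e x)"])
        (use Cmp in \<open>auto intro: exI[of _ f] exI[of _ g]\<close>)
  qed
next
  case (Rec f g)
  let ?r = "rec_nat (val b f (p1 x)) (\<lambda>k r. val b g (pe r (pe k (p1 x))))"
  define l where "l = map ?r [0..<Suc (p2 x)]"
  have l: "l ! k = ?r k" if "k \<le> p2 x" for k
    using that unfolding l_def by (simp del: upt_Suc)
  show ?thesis
  proof (rule exI[of _ "to_nat l"], rule allI)
    fix u
    show "\<exists>w. premise e x (val b e x) (to_nat l) u w \<and>
      (w = 0 \<or> (\<exists>e' x'. size e' < size e \<and> w = fct e' x' (val b e' x')))"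
    proof (cases u)
      case 0
      then show ?thesis using Rec l[of 0] l[of "p2 x"] by (auto simp: Let_def)
    next
      case (Suc k)
      show ?thesis
      proof (cases "u \<le> p2 x")
        case True
        then have "l ! u = val b g (pe (l ! k) (pe k (p1 x)))" using Suc l[of k] l[of u] by simp
        then show ?thesis using Rec Suc True l[of "p2 x"] by (auto simp: Let_def)
      next
        case False
        then show ?thesis using Rec Suc l[of "p2 x"] by (auto simp: Let_def)
      qed
    qed
  qed
next
  case (Mu f)
  have nz: "\<exists>w v. w = fct f (pe x u) (Suc v) \<and>
      (w = 0 \<or> (\<exists>e' x'. size e' < size e \<and> w = fct e' x' (val b e' x')))"
    if pos: "val b f (pe x u) \<noteq> 0" for u
  proof -
    obtain v where v: "val b f (pe x u) = Suc v" using pos by (cases "val b f (pe x u)") auto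
    have "size f < size e" using Mu by simp
    then show ?thesis
      by (intro exI[of _ "fct f (pe x u) (Suc v)"] exI[of _ v] conjI disjI2 exI[of _ f] exI[of _ "pe x u"])
        (simp_all add: v)
  qed
  show ?thesis
  proof (cases "\<exists>n. val b f (pe x n) = 0")
    case True
    define y where "y = (LEAST n. val b f (pe x n) = 0)"
    have y: "val b f (pe x y) = 0" unfolding y_def by (rule LeastI_ex[OF True])
    have lt: "val b f (pe x u) \<noteq> 0" if "u < y" for u
      using that not_less_Least unfolding y_def by blast
    have val: "val b e x = y" using Mu True by (simp add: mu_def y_def)
    show ?thesis
    proof (rule exI[of _ 0], rule allI)
      fix u
      consider "u < y" | "u = y" | "u > y" by linarith
      then show "\<exists>w. premise e x (val b e x) 0 u w \<and>
        (w = 0 \<or> (\<exists>e' x'. size e' < size e \<and> w = fct e' x' (val b e' x')))"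
      proof cases
        case 1
        then show ?thesis using nz[OF lt[OF 1]] unfolding val by (auto simp: Mu)
      next
        case 2
        then show ?thesis unfolding val using y by (auto simp: Mu)
      next
        case 3
        then show ?thesis unfolding val by (auto simp: Mu)
      qed
    qed
  next
    case False
    have val: "val b e x = 0" using Mu False by (simp only: mu_def val.simps if_False)
    show ?thesis
    proof (rule exI[of _ 1], rule allI)
      fix u
      show "\<exists>w. premise e x (val b e x) 1 u w \<and>
        (w = 0 \<or> (\<exists>e' x'. size e' < size e \<and> w = fct e' x' (val b e' x')))"
        using nz[of u] False unfolding val by (auto simp: Mu)
    qed
  qed
qed (use assms in auto)

definition prem :: "nat \<Rightarrow> nat \<Rightarrow> nat \<Rightarrow> nat \<Rightarrow> bool" where
  "prem n c u w \<longleftrightarrow> (\<exists>e x y. n = fct e x y \<and> premise e x y c u w)"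

lemma prem_fct [simp]: "prem (fct e x y) c u w \<longleftrightarrow> premise e x y c u w"
  unfolding prem_def by auto

lemma prem_sound:
  assumes "\<And>u. \<exists>w. prem n c u w \<and> (w = 0 \<or> holds b w)"
  shows "holds b n"
proof -
  obtain e x y where n: "n = fct e x y" using assms[of 0] unfolding prem_def by blast
  have "val b e x = y" by (rule premise_sound) (use assms n in auto)
  with n show ?thesis by simp
qed

section \<open>The base function and the class generated from it\<close>

definition rule_set :: "nat set" where
  "rule_set = {pairq n (pairq c (pairq u w)) | n c u w. prem n c u w}"

lemma rule_set_iff [simp]: "pairq n (pairq c (pairq u w)) \<in> rule_set \<longleftrightarrow> prem n c u w"
  unfolding rule_set_def by auto

definition omega :: "nat set" where
  "omega = {pairq i j | i j. i \<le> j}"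

lemma omega_iff [simp]: "pairq i j \<in> omega \<longleftrightarrow> i \<le> j"
  unfolding omega_def by auto

text \<open>To avoid a circular definition of the base function, the true statements about basic codes are
  decided with one call of the base function, and only the syntactic functions \<open>query\<close> and \<open>answer\<close>
  enter its definition.\<close>

fun query_code :: "code \<Rightarrow> nat \<Rightarrow> nat" where
  "query_code Orc x = x"
| "query_code (Bas k) x = pe k x"
| "query_code _ x = 0"

fun answer_code :: "code \<Rightarrow> nat \<Rightarrow> nat \<Rightarrow> bool" where
  "answer_code (Cst c) y v \<longleftrightarrow> y = c"
| "answer_code Orc y v \<longleftrightarrow> y = v"
| "answer_code (Bas k) y v \<longleftrightarrow> y = v"
| "answer_code _ y v \<longleftrightarrow> False"

definition query :: "nat \<Rightarrow> nat" where
  "query n = (case from_nat (n - 1) of (e, x, y :: nat) \<Rightarrow> query_code e x)"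

definition answer :: "nat \<Rightarrow> nat" where
  "answer z = (if \<exists>e x y. p1 z = fct e x y \<and> answer_code e y (p2 z) then 1 else 0)"

definition base_facts :: "(nat \<Rightarrow> nat) \<Rightarrow> nat set" where
  "base_facts b = {n. \<exists>e x. basic e \<and> n = fct e x (val b e x)}"

text \<open>Valid for every \<open>b\<close>. Hence any class with the closure properties above that
  contains \<open>b\<close>, \<open>query\<close> and \<open>answer\<close> decides
  \<open>base_facts b\<close>.\<close>

lemma answer_query: "answer (pe n (b (query n))) = chi (base_facts b) n"
proof -
  have "answer_code e y (b (query_code e x)) \<longleftrightarrow> basic e \<and> val b e x = y" for e x y
    by (cases e) auto
  moreover have "query (fct e x y) = query_code e x" for e x y
    by (simp add: query_def fct_def)
  ultimately show ?thesis unfolding answer_def base_facts_def by auto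
qed

text \<open>At \<open>pe j (pe w (chi Y w))\<close> this is the characteristic function, at
  \<open>w\<close>, of the part of \<open>Y\<close> below \<open>j\<close>.\<close>

definition cut :: "nat \<Rightarrow> nat" where
  "cut z = (if p2 (p2 z) = 1 \<and> (\<exists>m i. p1 (p2 z) = pairq m i \<and> i < p1 z) then 1 else 0)"

text \<open>The argument codes \<open>x\<close>, a value \<open>y\<close> and a stage. The code
  numbered \<open>x\<close> is applied to \<open>x\<close> itself, in preparation for
  diagonalisation.\<close>

definition enum :: "nat \<Rightarrow> nat" where
  "enum z = pairq (fct (from_nat (p1 z)) (p1 z) (p1 (p2 z))) (p2 (p2 z))"

definition base_funs :: "(nat \<Rightarrow> nat) list" where
  "base_funs = [\<lambda>x. x, p1, p2, Suc, \<lambda>z. if p1 z = 0 then p1 (p2 z) else p2 (p2 z),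
     \<lambda>z. if p1 z = p2 z then 0 else 1, realq, \<lambda>z. p1 z + p2 z,
     query, answer, chi rule_set, chi omega, cut, enum]"

text \<open>All base functions are merged into one, selected by the first component. Beyond the end
  of the list the value is unspecified but fixed.\<close>

definition orac :: "nat \<Rightarrow> nat" where
  "orac z = (base_funs ! p1 z) (p2 z)"

definition MM :: "(nat \<Rightarrow> nat) set" where
  "MM = range (val orac)"

lemma MM_I: "(\<And>x. f x = val orac e x) \<Longrightarrow> f \<in> MM"
  unfolding MM_def by (rule range_eqI[of _ _ e]) (rule HOL.ext)

lemma MM_E:
  assumes "f \<in> MM"
  obtains e where "f = val orac e"
  using assms unfolding MM_def by blast

lemma countable_MM: "countable MM"
  unfolding MM_def by simp

lemma base_MM: "f \<in> set base_funs \<Longrightarrow> f \<in> MM"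
proof -
  assume "f \<in> set base_funs"
  then obtain k where "f = base_funs ! k" by (metis in_set_conv_nth)
  then show ?thesis by (intro MM_I[of _ "Bas k"]) (simp add: orac_def)
qed

interpretation MM: arith_closed MM
proof
  fix f g assume "f \<in> MM" "g \<in> MM"
  then obtain e d where fg: "f = val orac e" "g = val orac d" by (auto elim!: MM_E)
  show "(\<lambda>x. f (g x)) \<in> MM" by (rule MM_I[of _ "Cmp e d"]) (simp add: fg)
  show "(\<lambda>x. pe (f x) (g x)) \<in> MM" by (rule MM_I[of _ "Pr e d"]) (simp add: fg)
  show "(\<lambda>z. rec_nat (f (p1 z)) (\<lambda>k r. g (pe r (pe k (p1 z)))) (p2 z)) \<in> MM"
    by (rule MM_I[of _ "Rec e d"]) (simp add: fg)
  show "(\<lambda>x. mu (\<lambda>n. f (pe x n))) \<in> MM" by (rule MM_I[of _ "Mu e"]) (simp add: fg)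
next
  show "(\<lambda>x. c) \<in> MM" for c by (rule MM_I[of _ "Cst c"]) simp
qed (rule base_MM, simp add: base_funs_def)+

lemma orac_MM: "orac \<in> MM"
  by (rule MM_I[of _ Orc]) simp

lemma sets_MM: "rule_set \<in> MM.sets" "omega \<in> MM.sets" "base_facts orac \<in> MM.sets"
proof -
  show "rule_set \<in> MM.sets" "omega \<in> MM.sets"
    unfolding MM.sets_def mem_Collect_eq by (rule base_MM, simp add: base_funs_def)+
  have 1: "answer \<in> MM" and 2: "query \<in> MM" by (rule base_MM, simp add: base_funs_def)+
  have "(\<lambda>n. answer (pe n (orac (query n)))) \<in> MM"
    using MM.M_comp[OF 1 MM.M_pair[OF MM.M_id MM.M_comp[OF orac_MM 2]]] .
  then show "base_facts orac \<in> MM.sets" unfolding MM.sets_def answer_query by simp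
qed

text \<open>The model contains the set \<open>Z\<close> that the recursion formula asks for at stage
  \<open>j\<close>.\<close>

lemma cut_MM:
  assumes "Y \<in> MM.sets"
  shows "{w. \<exists>m i. w = pairq m i \<and> i < j \<and> pairq m i \<in> Y} \<in> MM.sets"
proof -
  have 1: "cut \<in> MM" by (rule base_MM) (simp add: base_funs_def)
  have 2: "chi Y \<in> MM" using assms by (simp add: MM.sets_def)
  have "(\<lambda>w. cut (pe j (pe w (chi Y w)))) \<in> MM"
    using MM.M_comp[OF 1 MM.M_pair[OF MM.M_const MM.M_pair[OF MM.M_id 2]]] .
  moreover have "cut (pe j (pe w (chi Y w))) = chi {w. \<exists>m i. w = pairq m i \<and> i < j \<and> pairq m i \<in> Y} w" for w
    by (auto simp: cut_def)
  ultimately show ?thesis unfolding MM.sets_def by simp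
qed

section \<open>Failure of transfinite recursion along omega\<close>

text \<open>A solution \<open>Y\<close> lists exactly the true facts, each from some stage on.
  Searching it yields a function in \<open>MM\<close> that evaluates every code at its own number,
  which diagonalisation refutes.\<close>

lemma no_recursion_solution:
  assumes "Y \<in> MM.sets"
    and Y: "\<And>n j. pairq n j \<in> Y \<longleftrightarrow> n \<in> base_facts orac \<or>
      (\<exists>c. \<forall>u. \<exists>w. prem n c u w \<and> (w = 0 \<or> (\<exists>i<j. pairq w i \<in> Y)))"
  shows False
proof -
  \<comment> \<open>By induction on the stage, since premises come from strictly earlier
    stages.\<close>
  have sound: "pairq n j \<in> Y \<Longrightarrow> holds orac n" for n j
  proof (induction j arbitrary: n rule: less_induct)
    case (less j)
    from less.prems consider "n \<in> base_facts orac"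
      | c where "\<And>u. \<exists>w. prem n c u w \<and> (w = 0 \<or> (\<exists>i<j. pairq w i \<in> Y))"
      unfolding Y[of n j] by blast
    then show ?case
    proof cases
      case 1
      then show ?thesis by (auto simp: base_facts_def)
    next
      case 2
      then show ?thesis using less.IH prem_sound[of n c orac] by blast
    qed
  qed
  \<comment> \<open>By induction on the size of the code: a fact about \<open>e\<close> is present
    at every stage from \<open>size e\<close> on.\<close>
  have complete: "size e \<le> j \<Longrightarrow> pairq (fct e x (val orac e x)) j \<in> Y" for e x j
  proof (induction e arbitrary: x j rule: measure_induct_rule[of size])
    case (less e)
    show ?case
    proof (cases "basic e")
      case True
      then show ?thesis unfolding Y[of _ j] base_facts_def by blast
    next
      case False
      from premise_complete[OF False, of x orac] obtain c where
        c: "\<And>u. \<exists>w. premise e x (val orac e x) c u w \<and>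
          (w = 0 \<or> (\<exists>e' x'. size e' < size e \<and> w = fct e' x' (val orac e' x')))" by blast
      have "\<exists>w. prem (fct e x (val orac e x)) c u w \<and> (w = 0 \<or> (\<exists>i<j. pairq w i \<in> Y))" for u
      proof -
        obtain w where w: "premise e x (val orac e x) c u w"
          "w = 0 \<or> (\<exists>e' x'. size e' < size e \<and> w = fct e' x' (val orac e' x'))" using c by blast
        from w(2) have "w = 0 \<or> (\<exists>i<j. pairq w i \<in> Y)"
        proof
          assume "\<exists>e' x'. size e' < size e \<and> w = fct e' x' (val orac e' x')"
          then obtain e' x' where "size e' < size e" "w = fct e' x' (val orac e' x')" by blast
          moreover from this(1) have "size e' < j" using less.prems by simp
          ultimately show ?thesis using less.IH[of e' "size e'" x'] by blast
        qed simp
        with w(1) show ?thesis by auto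
      qed
      then show ?thesis unfolding Y[of _ j] by blast
    qed
  qed
  \<comment> \<open>A zero of \<open>h x\<close> codes a value \<open>y\<close> and a stage at which
    \<open>Y\<close> asserts that the code numbered \<open>x\<close> maps \<open>x\<close> to
    \<open>y\<close>.\<close>
  define h where "h x z = (if chi Y (enum (pe x z)) = 0 then 1 else 0 :: nat)" for x z
  have h_zero: "h x (pe y i) = 0 \<longleftrightarrow> pairq (fct (from_nat x) x y) i \<in> Y" for x y i
    by (simp add: h_def enum_def)
  \<comment> \<open>Completeness makes the search succeed, and soundness makes the value it finds
    correct.\<close>
  have mu_h: "p1 (mu (h x)) = val orac (from_nat x) x" for x
  proof -
    let ?y = "val orac (from_nat x) x"
    have "h x (pe ?y (size (from_nat x :: code))) = 0" unfolding h_zero by (rule complete) simp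
    then have "h x (mu (h x)) = 0" by (rule mu_zero)
    then have "h x (pe (p1 (mu (h x))) (p2 (mu (h x)))) = 0" by simp
    then show ?thesis unfolding h_zero using sound by fastforce
  qed
  have 1: "chi Y \<in> MM" using assms(1) by (simp add: MM.sets_def)
  have 2: "enum \<in> MM" by (rule base_MM) (simp add: base_funs_def)
  have "(\<lambda>z. if chi Y (enum z) = 0 then 1 else 0) \<in> MM"
    using MM.M_if_zero[OF MM.M_comp[OF 1 2] MM.M_const MM.M_const] .
  from MM.M_mu[OF this] have "(\<lambda>x. mu (h x)) \<in> MM" by (simp add: h_def[abs_def])
  then have "(\<lambda>x. Suc (p1 (mu (h x)))) \<in> MM"
    using MM.M_comp[OF MM.M_Suc MM.M_fst'] by blast
  then obtain e where "(\<lambda>x. Suc (p1 (mu (h x)))) = val orac e" by (rule MM_E)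
  \<comment> \<open>At its own number the code \<open>e\<close> would have a value equal to its own
    successor.\<close>
  from fun_cong[OF this, of "to_nat e"] show False unfolding mu_h by simp
qed

text \<open>Set parameter 3 stands for the basic facts and 4 for the rules; set variable 0 is
  \<open>Z\<close>, the facts from earlier stages. The number variables 6, 7, 8, 9 are the witness
  \<open>c\<close>, the index \<open>u\<close>, the premise \<open>w\<close> and its stage.\<close>

definition theta :: fm2 where
  "theta = Disj2 (Mem2 (NVar 0) 3) (ExN 6 (AllN 7 (ExN 8 (Conj2
     (Mem2 (pair2 (NVar 0) (pair2 (NVar 6) (pair2 (NVar 7) (NVar 8)))) 4)
     (Disj2 (Eq2 (NVar 8) Zero2) (ExN 9 (Mem2 (pair2 (NVar 8) (NVar 9)) 0)))))))"

definition atr_sentence :: fm2 where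
  "atr_sentence = AllS 3 (AllS 4 (ATR_instance theta))"

lemma atr_sentence_ATR0: "atr_sentence \<in> ATR0"
proof -
  have "ATR_instance theta \<in> ATR0_ax"
    by (rule ATR0_ax.transfinite_recursion) (auto simp: theta_def pair2_def)
  then have "atr_sentence \<in> generalisations ATR0_ax"
    unfolding atr_sentence_def by (intro generalisations.set generalisations.base)
  moreover have "fvN atr_sentence = {}" "fvS atr_sentence = {}"
    by (auto simp: atr_sentence_def ATR_instance_def theta_def WO2_def LO2_def WF2_def H2_def
        fun_into_field2_def lt2_def le2_def field2_def pair2_def Let_def)
  ultimately show ?thesis by (simp add: ATR0_def)
qed

lemma tv2_pair2 [simp]: "tv2 \<nu> (pair2 s t) = pairq (tv2 \<nu> s) (tv2 \<nu> t)"
  by (simp add: pair2_def pairq_def)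

lemma sat2_connectives:
  "sat2 S \<nu> \<sigma> (Conj2 \<phi> \<psi>) \<longleftrightarrow> sat2 S \<nu> \<sigma> \<phi> \<and> sat2 S \<nu> \<sigma> \<psi>"
  "sat2 S \<nu> \<sigma> (Disj2 \<phi> \<psi>) \<longleftrightarrow> sat2 S \<nu> \<sigma> \<phi> \<or> sat2 S \<nu> \<sigma> \<psi>"
  "sat2 S \<nu> \<sigma> (ExN n \<phi>) \<longleftrightarrow> (\<exists>k. sat2 S (\<nu>(n := k)) \<sigma> \<phi>)"
  "sat2 S \<nu> \<sigma> (ExS X \<phi>) \<longleftrightarrow> (\<exists>A\<in>S. sat2 S \<nu> (\<sigma>(X := A)) \<phi>)"
  by auto

lemma sat2_Iff2: "sat2 S \<nu> \<sigma> (Iff2 \<phi> \<psi>) \<longleftrightarrow> (sat2 S \<nu> \<sigma> \<phi> \<longleftrightarrow> sat2 S \<nu> \<sigma> \<psi>)"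
  by auto

lemma sat2_Neg2: "sat2 S \<nu> \<sigma> (Neg2 \<phi>) \<longleftrightarrow> \<not> sat2 S \<nu> \<sigma> \<phi>"
  by simp

lemma sat2_lt2: "\<sigma> X = omega \<Longrightarrow> sat2 S \<nu> \<sigma> (lt2 X s t) \<longleftrightarrow> tv2 \<nu> s < tv2 \<nu> t"
  by (auto simp: lt2_def le2_def)

text \<open>\<open>omega\<close> is the true order of the natural numbers, hence well-founded for
  every choice of \<open>S\<close>: a descending \<open>f\<close> would satisfy
  \<open>f n + n \<le> f 0\<close> for all \<open>n\<close>.\<close>

lemma sat2_WO2:
  assumes "\<sigma> 1 = omega"
  shows "sat2 S \<nu> \<sigma> (WO2 1)"
proof -
  have "sat2 S \<nu> \<sigma> (LO2 1)"
    by (auto simp: LO2_def le2_def field2_def Let_def assms[simplified])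
  moreover have "\<not> sat2 S \<nu> (\<sigma>(2 := F)) (Conj2 (fun_into_field2 2 1)
      (AllN 0 (AllN 1 (AllN 2 (Imp2
        (Conj2 (Mem2 (pair2 (NVar 0) (NVar 1)) 2) (Mem2 (pair2 (Plus2 (NVar 0) One2) (NVar 2)) 2))
        (lt2 1 (NVar 2) (NVar 1)))))))" (is "\<not> sat2 _ _ ?\<sigma> (Conj2 ?f ?d)") for F
  proof
    assume *: "sat2 S \<nu> ?\<sigma> (Conj2 ?f ?d)"
    then have "sat2 S \<nu> ?\<sigma> ?f" unfolding sat2_connectives ..
    then have "\<forall>n. \<exists>m. sat2 S (\<nu>(1 := n, 2 := m)) ?\<sigma> (Mem2 (pair2 (NVar 1) (NVar 2)) 2)"
      unfolding fun_into_field2_def Let_def sat2_connectives sat2.simps(6) by blast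
    then have "\<forall>n. \<exists>m. pairq n m \<in> F" by simp
    then obtain f where f: "\<And>n. pairq n (f n) \<in> F" by metis
    have "\<forall>n m m'. pairq n m \<in> F \<and> pairq (n + 1) m' \<in> F \<longrightarrow> m' < m"
      using * assms by (simp add: sat2_lt2) blast
    then have dec: "f (Suc n) < f n" for n using f[of n] f[of "Suc n"] by simp
    have "f n + n \<le> f 0" for n
    proof (induction n)
      case (Suc n)
      then show ?case using dec[of n] by simp
    qed simp
    from this[of "Suc (f 0)"] show False by simp
  qed
  then have "\<not> (\<exists>F\<in>S. sat2 S \<nu> (\<sigma>(2 := F)) (Conj2 ?f ?d))" by blast
  then have "sat2 S \<nu> \<sigma> (WF2 1)"
    unfolding WF2_def Let_def Suc_1 by (subst sat2_Neg2, subst sat2_connectives(4))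
  ultimately show ?thesis unfolding WO2_def sat2_connectives ..
qed

text \<open>The parameters and the order are instantiated by sets of the model, so truth of the
  sentence would yield a solution \<open>Y\<close> in the model.\<close>

lemma not_sat2_atr_sentence: "\<not> sat2 MM.sets \<nu> \<sigma> atr_sentence"
proof
  assume "sat2 MM.sets \<nu> \<sigma> atr_sentence"
  let ?\<sigma> = "\<sigma>(3 := base_facts orac, 4 := rule_set, 1 := omega)"
  have "sat2 MM.sets \<nu> ?\<sigma> (Imp2 (WO2 1) (ExS 2 (H2 theta)))"
    using \<open>sat2 MM.sets \<nu> \<sigma> atr_sentence\<close> sets_MM unfolding atr_sentence_def ATR_instance_def sat2.simps(7) by blast
  moreover have "sat2 MM.sets \<nu> ?\<sigma> (WO2 1)" by (rule sat2_WO2) simp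
  ultimately obtain Y where Y: "Y \<in> MM.sets" and H: "sat2 MM.sets \<nu> (?\<sigma>(2 := Y)) (H2 theta)"
    unfolding sat2.simps by blast
  let ?Z = "\<lambda>j. {w. \<exists>m i. w = pairq m i \<and> i < j \<and> pairq m i \<in> Y}"
  let ?\<theta> = "\<lambda>n Z. n \<in> base_facts orac \<or>
      (\<exists>c. \<forall>u. \<exists>w. prem n c u w \<and> (w = 0 \<or> (\<exists>i. pairq w i \<in> Z)))"
  have "sat2 MM.sets \<nu> (?\<sigma>(2 := Y)) (H2 theta) \<longleftrightarrow>
      (\<forall>k. k \<in> Y \<longleftrightarrow> (\<exists>n j. k = pairq n j \<and> (\<exists>Z\<in>MM.sets. (\<forall>w. w \<in> Z \<longleftrightarrow> w \<in> ?Z j) \<and> ?\<theta> n Z)))"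
    unfolding H2_def theta_def Let_def
    \<comment> \<open>The rewriting is staged because \<open>Iff2\<close> is itself a conjunction:
      its law must be applied before the law for \<open>Conj2\<close> breaks it up.\<close>
    by (simp only: sat2.simps(6) sat2_Iff2, simp only: sat2_connectives,
      simp only: sat2.simps(6) sat2_Iff2, simp only: sat2_connectives sat2.simps(6),
      simp add: sat2_lt2 field2_def le2_def)
  with H have H': "\<forall>k. k \<in> Y \<longleftrightarrow>
      (\<exists>n j. k = pairq n j \<and> (\<exists>Z\<in>MM.sets. (\<forall>w. w \<in> Z \<longleftrightarrow> w \<in> ?Z j) \<and> ?\<theta> n Z))"
    by (rule iffD1[rotated])
  \<comment> \<open>The quantifier over \<open>Z\<close> is eliminated: its defining condition fixes
    \<open>Z\<close> extensionally, and \<open>cut_MM\<close> puts the set into the model.\<close>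
  have unique: "(\<exists>Z\<in>MM.sets. (\<forall>w. w \<in> Z \<longleftrightarrow> w \<in> ?Z j) \<and> P Z) \<longleftrightarrow> P (?Z j)" for j P
    unfolding set_eq_iff[symmetric] using cut_MM[OF Y, of j] by blast
  have sol: "pairq n j \<in> Y \<longleftrightarrow> ?\<theta> n (?Z j)" for n j
  proof -
    have "(\<exists>n' j'. (n = n' \<and> j = j') \<and> P n' j') \<longleftrightarrow> P n j" for P :: "nat \<Rightarrow> nat \<Rightarrow> bool" by blast
    then show ?thesis using spec[OF H', of "pairq n j"] unfolding unique pairq_inj by (simp only:)
  qed
  have below: "(\<exists>i. pairq w i \<in> ?Z j) \<longleftrightarrow> (\<exists>i<j. pairq w i \<in> Y)" for w j
    by (simp add: conj_commute)
  have "pairq n j \<in> Y \<longleftrightarrow> n \<in> base_facts orac \<or>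
      (\<exists>c. \<forall>u. \<exists>w. prem n c u w \<and> (w = 0 \<or> (\<exists>i<j. pairq w i \<in> Y)))" for n j
    using sol[of n j] unfolding below .
  with Y show False by (rule no_recursion_solution)
qed

theorem theorem3p12:
  shows "\<not> proves_system (ACA0w \<union> {Neg NIN}) ATR0"
proof
  assume "proves_system (ACA0w \<union> {Neg NIN}) ATR0"
  then have prov: "ACA0w \<union> {Neg NIN} \<turnstile> tr atr_sentence"
    using atr_sentence_ATR0 unfolding proves_system_def by blast
  have "realq \<in> MM" "(\<lambda>k. p1 k + p2 k) \<in> MM" by (rule base_MM, simp add: base_funs_def)+
  note NIN = MM.sat_Neg_NIN[OF countable_MM this]
  let ?E = "\<lambda>x. MM.dflt (snd x)"
  have "MM.sat ?E (tr atr_sentence)"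
    by (rule MM.soundness[OF prov _ MM.good_dflt])
      (auto simp: ACA0w_def simp del: MM.sat.simps intro: MM.sat_RCA0w MM.sat_exists2 NIN)
  \<comment> \<open>In the default environment every number variable is 0 and every type-1 variable
    is the zero function, the characteristic function of the empty set.\<close>
  moreover have "MM.sat ?E (tr atr_sentence) \<longleftrightarrow> sat2 MM.sets (\<lambda>_. 0) (\<lambda>_. {}) atr_sentence"
    by (rule MM.sat_tr[OF MM.good_dflt]) (auto intro: ev_Num ev_step[OF step_K])
  ultimately show False using not_sat2_atr_sentence by blast
qed

end
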